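(* Let $\mathbb{k}$ be a field and let $I \subseteq S=\mathbb{k}[x_1,\dots,x_n]$ be a square-free monomial ideal with a $d$-linear resolution. Let $k$ be a positive integer and let $\mathfrak{n}=(y_1,\dots,y_k) \subseteq \mathbb{k}[y_1,\dots,y_k]$, where $y_1,\dots,y_k$ are new variables. Then the ideal $\mathfrak{n} I \subseteq R=\mathbb{k}[x_1,\dots,x_n,y_1,\dots,y_k]$ (the product of the extensions of $\mathfrak{n}$ and $I$ to $R$) has a $(d+1)$-linear resolution and $$\beta_i(\mathfrak{n} I)=\sum_{s=0}^{k-1}\binom{k}{s+1}\beta_{i-s}(I) \quad\text{for every } i \geq 0.$$
   Context: For a monomial ideal $I$ in a polynomial ring over $\mathbb{k}$ (standard grading), $\beta_{i,j}(I)=\dim_{\mathbb{k}}\mathrm{Tor}_i(I,\mathbb{k})_j$ are the graded Betti numbers and $\beta_i(I)=\sum_j\beta_{i,j}(I)$ the total Betti numbers, computed over the ambient polynomial ring, with $\beta_i(I)=0$ for $i<0$. An ideal $I$ generated in degree $d$ has a $d$-linear resolution if $\beta_{i,i+j}(I)=0$ for all $i\in\mathbb{N}$ and all $j\ne d$. *)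

theory Defs
  imports Complex_Main "HOL-Algebra.Ideal_Product" "HOL-Library.Poly_Mapping"
begin

section \<open>Polynomial rings\<close>

text \<open>
  A polynomial is a finitely supported map from exponent vectors to coefficients; the variables
  are indexed by natural numbers. Rings in different sets of variables are subrings of this one
  type, so that extending an ideal to a ring with more variables needs no embedding.
\<close>

type_synonym 'a mpol = "(nat \<Rightarrow>\<^sub>0 nat) \<Rightarrow>\<^sub>0 'a"

definition poly_ring :: "nat set \<Rightarrow> 'a::field mpol ring" where
  "poly_ring V =
    \<lparr> carrier = {p. \<forall>m\<in>Poly_Mapping.keys p. Poly_Mapping.keys m \<subseteq> V},
      mult = (*), one = 1, zero = 0, add = (+) \<rparr>"

definition monomial :: "(nat \<Rightarrow>\<^sub>0 nat) \<Rightarrow> 'a::field mpol" where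
  "monomial m = Poly_Mapping.single m 1"

definition variable :: "nat \<Rightarrow> 'a::field mpol" where
  "variable v = monomial (Poly_Mapping.single v 1)"

definition homogeneous :: "nat \<Rightarrow> 'a::field mpol \<Rightarrow> bool" where
  "homogeneous j p \<longleftrightarrow>
    (\<forall>m\<in>Poly_Mapping.keys p. (\<Sum>v\<in>Poly_Mapping.keys m. Poly_Mapping.lookup m v) = j)"

definition const_coeff :: "'a::field mpol \<Rightarrow> 'a" where
  "const_coeff p = Poly_Mapping.lookup p 0"

definition squarefree_monomial_ideal :: "nat set \<Rightarrow> 'a::field mpol set \<Rightarrow> bool" where
  "squarefree_monomial_ideal V I \<longleftrightarrow>
    (\<exists>M. (\<forall>m\<in>M. Poly_Mapping.keys m \<subseteq> V \<and> (\<forall>v. Poly_Mapping.lookup m v \<le> 1)) \<and>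
         I = genideal (poly_ring V) (monomial ` M))"

definition irrelevant_ideal :: "nat set \<Rightarrow> 'a::field mpol set" where
  "irrelevant_ideal V = genideal (poly_ring V) (variable ` V)"

definition extend_ideal :: "nat set \<Rightarrow> 'a::field mpol set \<Rightarrow> 'a mpol set" where
  "extend_ideal W I = genideal (poly_ring W) I"


section \<open>Graded free resolutions\<close>

text \<open>
  Elements of a free module are finitely supported families of coefficients over its basis;
  \<open>lin_ext f\<close> is the linear map sending the basis element \<open>b\<close> to \<open>f b\<close>.
\<close>

definition scale :: "'r::comm_ring_1 \<Rightarrow> ('b \<Rightarrow>\<^sub>0 'r) \<Rightarrow> ('b \<Rightarrow>\<^sub>0 'r)" where
  "scale c u = Poly_Mapping.map ((*) c) u"

definition lin_ext :: "('b \<Rightarrow> ('c \<Rightarrow>\<^sub>0 'r::comm_ring_1)) \<Rightarrow> ('b \<Rightarrow>\<^sub>0 'r) \<Rightarrow> ('c \<Rightarrow>\<^sub>0 'r)" where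
  "lin_ext f u = (\<Sum>b\<in>Poly_Mapping.keys u. scale (Poly_Mapping.lookup u b) (f b))"

text \<open>
  A sequence of graded free modules \<open>F\<^sub>i = \<Oplus>\<^sub>j S(-j)\<^bsup>gens i j\<^esup>\<close> with maps
  \<open>\<dots> \<rightarrow> F\<^sub>1 \<rightarrow> F\<^sub>0 \<rightarrow> S\<close>. The basis elements of \<open>F\<^sub>i\<close> are the pairs \<open>(j, a)\<close> with
  \<open>a < gens i j\<close>, the pair \<open>(j, a)\<close> having degree \<open>j\<close>. On basis elements, \<open>aug\<close> gives the map
  \<open>F\<^sub>0 \<rightarrow> S\<close> and \<open>bd i\<close> the map \<open>F\<^sub>i\<^sub>+\<^sub>1 \<rightarrow> F\<^sub>i\<close>. Each \<open>F\<^sub>i\<close> has finitely many generators in each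
  degree, but need not be finitely generated, and the resolution need not be minimal.
\<close>

record (overloaded) 'a free_cplx =
  gens :: "nat \<Rightarrow> nat \<Rightarrow> nat"
  aug :: "nat \<times> nat \<Rightarrow> 'a mpol"
  bd :: "nat \<Rightarrow> nat \<times> nat \<Rightarrow> (nat \<times> nat \<Rightarrow>\<^sub>0 'a mpol)"

definition basis :: "'a::field free_cplx \<Rightarrow> nat \<Rightarrow> (nat \<times> nat) set" where
  "basis F i = {(j, a). a < gens F i j}"

definition free_mod :: "nat set \<Rightarrow> 'a::field free_cplx \<Rightarrow> nat \<Rightarrow> (nat \<times> nat \<Rightarrow>\<^sub>0 'a mpol) set" where
  "free_mod V F i = {u. Poly_Mapping.keys u \<subseteq> basis F i \<and>
                        (\<forall>b. Poly_Mapping.lookup u b \<in> carrier (poly_ring V))}"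

definition homogeneous_vec :: "nat \<Rightarrow> (nat \<times> nat \<Rightarrow>\<^sub>0 'a::field mpol) \<Rightarrow> bool" where
  "homogeneous_vec j u \<longleftrightarrow>
    (\<forall>b\<in>Poly_Mapping.keys u. fst b \<le> j \<and> homogeneous (j - fst b) (Poly_Mapping.lookup u b))"

definition aug_map :: "'a::field free_cplx \<Rightarrow> (nat \<times> nat \<Rightarrow>\<^sub>0 'a mpol) \<Rightarrow> 'a mpol" where
  "aug_map F u = (\<Sum>b\<in>Poly_Mapping.keys u. Poly_Mapping.lookup u b * aug F b)"

definition bd_map ::
  "'a::field free_cplx \<Rightarrow> nat \<Rightarrow> (nat \<times> nat \<Rightarrow>\<^sub>0 'a mpol) \<Rightarrow> (nat \<times> nat \<Rightarrow>\<^sub>0 'a mpol)" where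
  "bd_map F i = lin_ext (bd F i)"

definition graded_free_resolution :: "nat set \<Rightarrow> 'a::field mpol set \<Rightarrow> 'a free_cplx \<Rightarrow> bool" where
  "graded_free_resolution V I F \<longleftrightarrow>
    (\<forall>b\<in>basis F 0. aug F b \<in> carrier (poly_ring V) \<and> homogeneous (fst b) (aug F b)) \<and>
    (\<forall>i. \<forall>b\<in>basis F (Suc i). bd F i b \<in> free_mod V F i \<and> homogeneous_vec (fst b) (bd F i b)) \<and>
    aug_map F ` free_mod V F 0 = I \<and>
    {u \<in> free_mod V F 0. aug_map F u = 0} = bd_map F 0 ` free_mod V F 1 \<and>
    (\<forall>i. {u \<in> free_mod V F (Suc i). bd_map F i u = 0} = bd_map F (Suc i) ` free_mod V F (Suc (Suc i)))"


section \<open>Tor and graded Betti numbers\<close>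

text \<open>
  The residue field is the quotient of the polynomial ring by its irrelevant ideal, the quotient
  map being \<^const>\<open>const_coeff\<close>. So tensoring with it turns the free module \<open>F\<^sub>i\<close> into the vector
  space on the same basis, and replaces every matrix entry of the differential by its constant
  coefficient.
\<close>

definition tensor_mod :: "'a::field free_cplx \<Rightarrow> nat \<Rightarrow> nat \<Rightarrow> (nat \<times> nat \<Rightarrow>\<^sub>0 'a) set" where
  "tensor_mod F i j = {c. Poly_Mapping.keys c \<subseteq> {b \<in> basis F i. fst b = j}}"

definition tensor_bd ::
  "'a::field free_cplx \<Rightarrow> nat \<Rightarrow> (nat \<times> nat \<Rightarrow>\<^sub>0 'a) \<Rightarrow> (nat \<times> nat \<Rightarrow>\<^sub>0 'a)" where
  "tensor_bd F i = lin_ext (\<lambda>b. Poly_Mapping.map const_coeff (bd F i b))"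

definition tor_cycles :: "'a::field free_cplx \<Rightarrow> nat \<Rightarrow> nat \<Rightarrow> (nat \<times> nat \<Rightarrow>\<^sub>0 'a) set" where
  "tor_cycles F i j = {c \<in> tensor_mod F i j. \<forall>l. i = Suc l \<longrightarrow> tensor_bd F l c = 0}"

definition tor_boundaries :: "'a::field free_cplx \<Rightarrow> nat \<Rightarrow> nat \<Rightarrow> (nat \<times> nat \<Rightarrow>\<^sub>0 'a) set" where
  "tor_boundaries F i j = tensor_bd F i ` tensor_mod F (Suc i) j"

text \<open>
  Tor does not depend on the resolution, so any one may be chosen. Each \<open>tensor_mod F i j\<close> is
  finite-dimensional, so the dimension of the quotient is the difference of the dimensions.
\<close>

definition betti :: "nat set \<Rightarrow> 'a::field mpol set \<Rightarrow> nat \<Rightarrow> nat \<Rightarrow> nat" where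
  "betti V I i j =
    (let F = (SOME F. graded_free_resolution V I F)
     in vector_space.dim scale (tor_cycles F i j) - vector_space.dim scale (tor_boundaries F i j))"

definition total_betti :: "nat set \<Rightarrow> 'a::field mpol set \<Rightarrow> int \<Rightarrow> nat" where
  "total_betti V I i = (if i < 0 then 0 else Sum_any (betti V I (nat i)))"

text \<open>
  In the vanishing condition on \<open>\<beta>\<^sub>i\<^sub>,\<^sub>i\<^sub>+\<^sub>j\<close> the index \<open>j\<close> runs over the integers other than \<open>d\<close>, so the
  internal degree \<open>l = i + j\<close> runs over everything other than \<open>i + d\<close>.
\<close>

definition linear_resolution :: "nat set \<Rightarrow> nat \<Rightarrow> 'a::field mpol set \<Rightarrow> bool" where
  "linear_resolution V d I \<longleftrightarrow>
    I = genideal (poly_ring V) {p \<in> I. homogeneous d p} \<and>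
    (\<forall>i l. l \<noteq> i + d \<longrightarrow> betti V I i l = 0)"


section \<open>Basic facts\<close>

text \<open>
  The ring and vector space laws, on which the meaning of \<^const>\<open>genideal\<close> and of the dimension in
  \<^const>\<open>betti\<close> depends.
\<close>

lemma poly_ring_simps [simp]:
  "mult (poly_ring V) = (*)" "one (poly_ring V) = 1"
  "zero (poly_ring V) = 0" "add (poly_ring V) = (+)"
  by (simp_all add: poly_ring_def)

lemma poly_ring_carrier:
  "p \<in> carrier (poly_ring V) \<longleftrightarrow> (\<forall>m\<in>Poly_Mapping.keys p. Poly_Mapping.keys m \<subseteq> V)"
  by (simp add: poly_ring_def)

lemma cring_poly_ring: "cring (poly_ring V :: 'a::field mpol ring)"
proof (rule cringI)
  show "abelian_group (poly_ring V :: 'a mpol ring)"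
  proof (rule abelian_groupI)
    fix x y :: "'a mpol"
    assume x: "x \<in> carrier (poly_ring V)"
    then have "- x \<in> carrier (poly_ring V)"
      by (simp add: poly_ring_carrier)
    then show "\<exists>y\<in>carrier (poly_ring V). y \<oplus>\<^bsub>poly_ring V\<^esub> x = \<zero>\<^bsub>poly_ring V\<^esub>"
      by (intro bexI[of _ "- x"]) auto
    assume "y \<in> carrier (poly_ring V)"
    with x show "x \<oplus>\<^bsub>poly_ring V\<^esub> y \<in> carrier (poly_ring V)"
      using Poly_Mapping.keys_add[of x y] by (fastforce simp: poly_ring_carrier)
  qed (auto simp: poly_ring_carrier algebra_simps)
  show "Group.comm_monoid (poly_ring V :: 'a mpol ring)"
  proof (rule comm_monoidI)
    fix x y :: "'a mpol"
    assume xy: "x \<in> carrier (poly_ring V)" "y \<in> carrier (poly_ring V)"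
    have "Poly_Mapping.keys m \<subseteq> V" if m: "m \<in> Poly_Mapping.keys (x * y)" for m
    proof -
      obtain a b where ab: "m = a + b" "a \<in> Poly_Mapping.keys x" "b \<in> Poly_Mapping.keys y"
        using m keys_mult[of x y] by blast
      then show ?thesis
        using xy Poly_Mapping.keys_add[of a b] unfolding poly_ring_carrier by blast
    qed
    then show "x \<otimes>\<^bsub>poly_ring V\<^esub> y \<in> carrier (poly_ring V)"
      by (simp add: poly_ring_carrier)
  qed (auto simp: poly_ring_carrier algebra_simps)
qed (auto simp: algebra_simps)

lemma lookup_scale [simp]: "Poly_Mapping.lookup (scale c u) b = c * Poly_Mapping.lookup u b"
  by (simp add: scale_def Poly_Mapping.map.rep_eq when_def)

lemma vector_space_scale: "vector_space (scale :: 'k::field \<Rightarrow> ('b \<Rightarrow>\<^sub>0 'k) \<Rightarrow> ('b \<Rightarrow>\<^sub>0 'k))"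
  by unfold_locales (auto intro!: poly_mapping_eqI simp: lookup_add algebra_simps)

end

theory Submission
  imports Defs
begin

text \<open>
  Add the new variables one at a time. If \<open>J\<close> is the product for the first \<open>k\<close> variables and \<open>y\<close> is
  the next one, then the next product is \<open>J + y I\<close>, with \<open>J\<close> and \<open>I\<close> extended to the larger ring.
  Minimal resolutions \<open>G\<close> of \<open>J\<close> and \<open>F\<close> of \<open>I\<close> stay exact after the extension, and
  a lift \<open>\<phi>\<close> of the inclusion of \<open>J\<close> in \<open>I\<close> gives a mapping cone \<open>G \<oplus> F(-1) \<oplus> G[-1](-1)\<close> that
  resolves \<open>J + y I\<close>. The generators of \<open>G\<^sub>i\<close> have degree \<open>i + d + 1\<close> and those of \<open>F\<^sub>i\<close> degree
  \<open>i + d\<close>, so the entries of \<open>\<phi>\<close> are linear forms. Hence the cone is again minimal and linear, its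
  ranks are Betti numbers, and they add up by Pascal's rule.

  Betti numbers are defined from an arbitrary resolution. It is compared with a minimal one by
  chain maps in both directions. These become mutually inverse on homology after tensoring with
  the residue field, where the minimal resolution has zero differentials.
\<close>

section \<open>Polynomials and free modules\<close>

text \<open>The cone resolves \<open>J + y I\<close> because both ideals are extended from a ring
  without \<open>y\<close>. So \<open>y\<close> is a nonzerodivisor modulo the extension of
  \<open>J\<close>, \<open>y I\<close> meets \<open>J\<close> exactly in \<open>y J\<close>, and the
  kernel of the map from \<open>J \<oplus> I(-1)\<close> is a copy of \<open>J(-1)\<close>. The
  induction on the number of new variables carries a whole minimal resolution with prescribed ranks,
  since the next cone needs its maps and not just its Betti numbers. It starts with no new variable,
  where the product is the zero ideal, so the binomial coefficients come out of the recursion alone.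
  The definition fixes bases made of pairs of numbers, while the cone needs tags for its summands.
  Resolutions are therefore treated over any basis type, and after each step a fresh minimal
  resolution of the same ideal is chosen; its ranks are read off from the cone, as both count the
  same Betti numbers. Bases may be infinite, but every dimension is counted within one degree, where
  everything is finite.\<close>

abbreviation lookup where "lookup \<equiv> Poly_Mapping.lookup"
abbreviation keys where "keys \<equiv> Poly_Mapping.keys"
abbreviation single where "single \<equiv> Poly_Mapping.single"

abbreviation polys :: "nat set \<Rightarrow> 'a::field mpol set" where
  "polys V \<equiv> carrier (poly_ring V)"

lemma single_sum_keys: "p = (\<Sum>m\<in>keys p. single m (lookup p m))"
proof (rule poly_mapping_eqI)
  fix k
  have "(\<Sum>m\<in>keys p. lookup (single m (lookup p m)) k) = (\<Sum>m\<in>keys p. if m = k then lookup p m else 0)"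
    by (rule sum.cong) (auto simp: lookup_single)
  also have "\<dots> = lookup p k"
    by (simp add: in_keys_iff)
  finally show "lookup p k = lookup (\<Sum>m\<in>keys p. single m (lookup p m)) k"
    by (simp add: lookup_sum)
qed

text \<open>Reduces additive statements to monomials and to vectors with a single entry. The
  summands in the last case may share keys, so no disjointness has to be tracked.\<close>

lemma poly_mapping_induct_add [case_names zero single add]:
  fixes p :: "'b \<Rightarrow>\<^sub>0 'c::comm_monoid_add"
  assumes "P 0" "\<And>k c. P (single k c)" "\<And>p q. P p \<Longrightarrow> P q \<Longrightarrow> P (p + q)"
  shows "P p"
proof -
  have "P (\<Sum>m\<in>A. single m (lookup p m))" if "finite A" for A
    using that by (induction A rule: finite_induct) (auto intro: assms)
  then show ?thesis
    by (subst single_sum_keys) simp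
qed

lemma lookup_map: "f 0 = 0 \<Longrightarrow> lookup (Poly_Mapping.map f p) k = f (lookup p k)"
  by (simp add: Poly_Mapping.map.rep_eq when_def)

lemma polys_0 [simp]: "0 \<in> polys V"
  by (simp add: poly_ring_carrier)

lemma polys_1 [simp]: "1 \<in> polys V"
  by (simp add: poly_ring_carrier)

lemma polys_add: "p \<in> polys V \<Longrightarrow> q \<in> polys V \<Longrightarrow> p + q \<in> polys V"
  using cring.cring_simprules(1)[OF cring_poly_ring] by simp

lemma polys_mult: "p \<in> polys V \<Longrightarrow> q \<in> polys V \<Longrightarrow> p * q \<in> polys V"
  using cring.cring_simprules(5)[OF cring_poly_ring] by simp

lemma polys_uminus: "p \<in> polys V \<Longrightarrow> - p \<in> polys V"
  by (simp add: poly_ring_carrier)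

lemma polys_single: "keys m \<subseteq> V \<Longrightarrow> single m c \<in> polys V"
  by (simp add: poly_ring_carrier)

lemma polys_const [simp]: "single 0 c \<in> polys V"
  by (simp add: polys_single)

lemma polys_variable: "v \<in> V \<Longrightarrow> variable v \<in> polys V"
  by (simp add: variable_def monomial_def polys_single)

lemma polys_mono: "p \<in> polys V \<Longrightarrow> V \<subseteq> W \<Longrightarrow> p \<in> polys W"
  unfolding poly_ring_carrier by blast

lemma keys_scale: "keys (scale c u) \<subseteq> keys u"
  by (auto simp: in_keys_iff)

text \<open>Coefficients may come from any commutative ring, so the facts on \<open>lin_ext\<close>
  serve both for a resolution over the polynomial ring and for its reduction over the field.\<close>

interpretation scale: module "scale :: 'r::comm_ring_1 \<Rightarrow> ('b \<Rightarrow>\<^sub>0 'r) \<Rightarrow> ('b \<Rightarrow>\<^sub>0 'r)"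
  by unfold_locales (auto intro!: poly_mapping_eqI simp: lookup_add algebra_simps)

lemma scale_single: "scale c (single b d) = single b (c * d)"
  by (rule poly_mapping_eqI) (simp add: lookup_single when_def)

lemma lin_ext_superset:
  assumes "finite S" "keys u \<subseteq> S"
  shows "lin_ext f u = (\<Sum>b\<in>S. scale (lookup u b) (f b))"
  unfolding lin_ext_def
  by (rule sum.mono_neutral_left) (use assms in \<open>auto simp: in_keys_iff\<close>)

lemma lin_ext_0 [simp]: "lin_ext f 0 = 0"
  by (simp add: lin_ext_def)

lemma lin_ext_add: "lin_ext f (u + v) = lin_ext f u + lin_ext f v"
proof -
  let ?S = "keys u \<union> keys v"
  have "keys (u + v) \<subseteq> ?S"
    by (rule Poly_Mapping.keys_add)
  then have "lin_ext f (u + v) = (\<Sum>b\<in>?S. scale (lookup (u + v) b) (f b))"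
    by (intro lin_ext_superset) auto
  also have "\<dots> = lin_ext f u + lin_ext f v"
    by (subst (1 2) lin_ext_superset[of ?S])
      (auto simp: lookup_add scale.scale_left_distrib sum.distrib)
  finally show ?thesis .
qed

lemma lin_ext_scale: "lin_ext f (scale c u) = scale c (lin_ext f u)"
  by (subst lin_ext_superset[of "keys u"], simp, rule keys_scale)
    (simp add: lin_ext_def scale.scale_sum_right)

interpretation lin_ext: module_hom scale scale "lin_ext f"
  by unfold_locales (simp_all add: lin_ext_add lin_ext_scale)

lemma lin_ext_single [simp]: "lin_ext f (single b c) = scale c (f b)"
  by (subst lin_ext_superset[of "{b}"]) auto

lemma lin_ext_cong: "(\<And>b. b \<in> keys u \<Longrightarrow> f b = g b) \<Longrightarrow> lin_ext f u = lin_ext g u"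
  by (simp add: lin_ext_def)

lemma lin_ext_comp: "lin_ext g (lin_ext f u) = lin_ext (\<lambda>b. lin_ext g (f b)) u"
  unfolding lin_ext_def[of f u] lin_ext_def[of _ u] by (simp add: lin_ext.sum lin_ext_scale)

lemma lin_ext_fun_add: "lin_ext (\<lambda>b. f b + g b) u = lin_ext f u + lin_ext g u"
  by (simp add: lin_ext_def scale.scale_right_distrib sum.distrib)

lemma lin_ext_fun_diff: "lin_ext (\<lambda>b. f b - g b) u = lin_ext f u - lin_ext g u"
  by (simp add: lin_ext_def scale.scale_right_diff_distrib sum_subtractf)

lemma lin_ext_fun_scale: "lin_ext (\<lambda>b. scale c (f b)) u = scale c (lin_ext f u)"
  by (simp add: lin_ext_def scale.scale_sum_right mult.commute)

lemma lin_ext_fun_zero [simp]: "lin_ext (\<lambda>b. 0) u = 0"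
  by (simp add: lin_ext_def)

lemma lin_ext_id [simp]: "lin_ext (\<lambda>b. single b 1) u = u"
  using single_sum_keys[of u] by (simp add: lin_ext_def scale_single)

lemma lookup_lin_ext: "lookup (lin_ext f u) b' = (\<Sum>b\<in>keys u. lookup u b * lookup (f b) b')"
  by (simp add: lin_ext_def lookup_sum)

text \<open>\<open>free_mod\<close> for an arbitrary basis type: in a mapping cone the basis
  elements carry tags, and in the choice of minimal generators they are vectors themselves.\<close>

definition free_on :: "nat set \<Rightarrow> 'b set \<Rightarrow> ('b \<Rightarrow>\<^sub>0 'a::field mpol) set" where
  "free_on V B = {u. keys u \<subseteq> B \<and> (\<forall>b. lookup u b \<in> polys V)}"

lemma free_on_0 [simp]: "0 \<in> free_on V B"
  by (simp add: free_on_def)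

lemma free_on_add: "u \<in> free_on V B \<Longrightarrow> v \<in> free_on V B \<Longrightarrow> u + v \<in> free_on V B"
  using Poly_Mapping.keys_add[of u v] by (auto simp: free_on_def lookup_add polys_add)

lemma free_on_uminus: "u \<in> free_on V B \<Longrightarrow> - u \<in> free_on V B"
  by (simp add: free_on_def polys_uminus)

lemma free_on_diff: "u \<in> free_on V B \<Longrightarrow> v \<in> free_on V B \<Longrightarrow> u - v \<in> free_on V B"
  using free_on_add[OF _ free_on_uminus] by (metis diff_conv_add_uminus)

lemma free_on_sum: "(\<And>x. x \<in> A \<Longrightarrow> f x \<in> free_on V B) \<Longrightarrow> sum f A \<in> free_on V B"
  by (induction A rule: infinite_finite_induct) (auto intro: free_on_add)

lemma free_on_scale: "c \<in> polys V \<Longrightarrow> u \<in> free_on V B \<Longrightarrow> scale c u \<in> free_on V B"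
  using keys_scale[of c u] by (auto simp: free_on_def polys_mult)

lemma free_on_single: "b \<in> B \<Longrightarrow> c \<in> polys V \<Longrightarrow> single b c \<in> free_on V B"
  by (auto simp: free_on_def lookup_single when_def)

lemma free_on_lin_ext:
  assumes "\<And>b. b \<in> B \<Longrightarrow> f b \<in> free_on V C" "u \<in> free_on V B"
  shows "lin_ext f u \<in> free_on V C"
  unfolding lin_ext_def
  by (intro free_on_sum free_on_scale) (use assms in \<open>auto simp: free_on_def\<close>)

lemma free_on_mono: "V \<subseteq> W \<Longrightarrow> u \<in> free_on V B \<Longrightarrow> u \<in> free_on W B"
  by (auto simp: free_on_def intro: polys_mono)

lemma lin_ext_cong_free:
  "u \<in> free_on V B \<Longrightarrow> (\<And>b. b \<in> B \<Longrightarrow> f b = g b) \<Longrightarrow> lin_ext f u = lin_ext g u"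
  by (rule lin_ext_cong) (auto simp: free_on_def)

section \<open>Reduction to the residue field\<close>

lemma const_coeff_add: "const_coeff (p + q) = const_coeff p + const_coeff q"
  by (simp add: const_coeff_def lookup_add)

lemma add_eq_0_nat_map: "(a :: nat \<Rightarrow>\<^sub>0 nat) + b = 0 \<longleftrightarrow> a = 0 \<and> b = 0"
  by (auto simp: poly_mapping_eq_iff fun_eq_iff lookup_add)

text \<open>Exponents cannot cancel, so the constant term of a product receives only the product of
  the constant terms. Thus \<open>const_coeff\<close> is the ring homomorphism onto the residue
  field.\<close>

lemma const_coeff_mult: "const_coeff (p * q) = const_coeff p * const_coeff q"
proof (induction p rule: poly_mapping_induct_add)
  case (single k c)
  show ?case
  proof (induction q rule: poly_mapping_induct_add)
    case (single l d)
    show ?case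
      by (simp add: const_coeff_def mult_single lookup_single when_def add_eq_0_nat_map)
  qed (simp_all add: const_coeff_add distrib_left, simp add: const_coeff_def)
qed (simp_all add: const_coeff_add distrib_right, simp add: const_coeff_def)

lemma const_coeff_0 [simp]: "const_coeff 0 = 0"
  by (simp add: const_coeff_def)

lemma const_coeff_single_0 [simp]: "const_coeff (single 0 c) = c"
  by (simp add: const_coeff_def)

lemma const_coeff_1 [simp]: "const_coeff 1 = 1"
  by (simp add: const_coeff_def)

lemma const_coeff_variable [simp]: "const_coeff (variable v) = 0"
  by (simp add: const_coeff_def variable_def monomial_def lookup_single when_def
      poly_mapping_eq_iff fun_eq_iff)

definition const_part :: "('b \<Rightarrow>\<^sub>0 'a::field mpol) \<Rightarrow> ('b \<Rightarrow>\<^sub>0 'a)" where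
  "const_part u = Poly_Mapping.map const_coeff u"

lemma lookup_const_part [simp]: "lookup (const_part u) b = const_coeff (lookup u b)"
  by (simp add: const_part_def lookup_map)

lemma const_part_0 [simp]: "const_part 0 = 0"
  by (rule poly_mapping_eqI) simp

lemma const_part_add: "const_part (u + v) = const_part u + const_part v"
  by (rule poly_mapping_eqI) (simp add: lookup_add const_coeff_add)

lemma const_part_diff: "const_part (u - v) = const_part u - const_part v"
  by (rule poly_mapping_eqI) (simp add: const_coeff_def lookup_minus)

lemma const_part_scale: "const_part (scale c u) = scale (const_coeff c) (const_part u)"
  by (rule poly_mapping_eqI) (simp add: const_coeff_mult)

lemma const_part_sum: "const_part (sum f A) = (\<Sum>x\<in>A. const_part (f x))"
  by (induction A rule: infinite_finite_induct) (simp_all add: const_part_add)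

lemma const_part_single: "const_part (single b c) = single b (const_coeff c)"
  by (rule poly_mapping_eqI) (simp add: lookup_single when_def)

text \<open>Compatibility of the reduction with composition: identities for chain maps and
  homotopies over the polynomial ring pass to the tensored complexes.\<close>

lemma const_part_lin_ext: "const_part (lin_ext f u) = lin_ext (\<lambda>b. const_part (f b)) (const_part u)"
proof -
  have "keys (const_part u) \<subseteq> keys u"
    by (auto simp: in_keys_iff)
  then show ?thesis
    by (subst lin_ext_superset[of "keys u" "const_part u"])
      (auto simp: lin_ext_def const_part_sum const_part_scale)
qed

section \<open>Homogeneous components\<close>

definition mdeg :: "(nat \<Rightarrow>\<^sub>0 nat) \<Rightarrow> nat" where
  "mdeg m = (\<Sum>v\<in>keys m. lookup m v)"

lemma mdeg_add: "mdeg (a + b) = mdeg a + mdeg b"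
  unfolding mdeg_def by (rule setsum_keys_plus_distrib) auto

lemma mdeg_0 [simp]: "mdeg 0 = 0"
  by (simp add: mdeg_def)

lemma mdeg_single [simp]: "mdeg (single v n) = n"
  by (simp add: mdeg_def)

lemma homogeneous_iff: "homogeneous j p \<longleftrightarrow> (\<forall>m\<in>keys p. mdeg m = j)"
  by (simp add: homogeneous_def mdeg_def)

lemma homogeneous_0 [simp]: "homogeneous j 0"
  by (simp add: homogeneous_iff)

lemma homogeneous_add: "homogeneous j p \<Longrightarrow> homogeneous j q \<Longrightarrow> homogeneous j (p + q)"
  using Poly_Mapping.keys_add[of p q] by (auto simp: homogeneous_iff)

lemma homogeneous_uminus: "homogeneous j p \<Longrightarrow> homogeneous j (- p)"
  by (simp add: homogeneous_iff)

lemma homogeneous_mult: "homogeneous i p \<Longrightarrow> homogeneous j q \<Longrightarrow> homogeneous (i + j) (p * q)"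
  using keys_mult[of p q] by (fastforce simp: homogeneous_iff mdeg_add)

lemma homogeneous_single: "mdeg m = j \<Longrightarrow> homogeneous j (single m c)"
  by (simp add: homogeneous_iff)

lemma homogeneous_variable: "homogeneous 1 (variable v)"
  by (simp add: variable_def monomial_def homogeneous_single)

lemma const_coeff_homogeneous: "homogeneous j p \<Longrightarrow> j \<noteq> 0 \<Longrightarrow> const_coeff p = 0"
  by (metis const_coeff_def homogeneous_iff in_keys_iff mdeg_0)

lemma homogeneous_0_const: "homogeneous 0 p \<Longrightarrow> p = single 0 (const_coeff p)"
proof (rule poly_mapping_eqI)
  fix m assume "homogeneous 0 p"
  then have "lookup p m = 0" if "m \<noteq> 0"
    using that unfolding homogeneous_iff mdeg_def
    by (metis (no_types, lifting) finite_keys in_keys_iff sum_eq_0_iff lookup_zero poly_mapping_eqI)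
  then show "lookup p m = lookup (single 0 (const_coeff p)) m"
    by (cases "m = 0") (auto simp: const_coeff_def lookup_single)
qed

definition hcomp :: "nat \<Rightarrow> 'a::field mpol \<Rightarrow> 'a mpol" where
  "hcomp j p = Poly_Mapping.mapp (\<lambda>m c. if mdeg m = j then c else 0) p"

lemma lookup_hcomp: "lookup (hcomp j p) m = (if mdeg m = j then lookup p m else 0)"
  by (auto simp: hcomp_def lookup_mapp when_def in_keys_iff)

lemma keys_hcomp: "keys (hcomp j p) = {m \<in> keys p. mdeg m = j}"
  by (auto simp: in_keys_iff lookup_hcomp split: if_splits)

lemma hcomp_0 [simp]: "hcomp j 0 = 0"
  by (rule poly_mapping_eqI) (simp add: lookup_hcomp)

lemma hcomp_add: "hcomp j (p + q) = hcomp j p + hcomp j q"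
  by (rule poly_mapping_eqI) (simp add: lookup_hcomp lookup_add)

lemma hcomp_sum: "hcomp j (sum f A) = (\<Sum>x\<in>A. hcomp j (f x))"
  by (induction A rule: infinite_finite_induct) (simp_all add: hcomp_add)

lemma hcomp_homogeneous: "homogeneous i p \<Longrightarrow> hcomp j p = (if i = j then p else 0)"
  by (rule poly_mapping_eqI) (auto simp: lookup_hcomp homogeneous_iff in_keys_iff)

lemma homogeneous_hcomp [simp]: "homogeneous j (hcomp j p)"
  by (simp add: homogeneous_iff keys_hcomp)

lemma hcomp_polys: "p \<in> polys V \<Longrightarrow> hcomp j p \<in> polys V"
  by (simp add: poly_ring_carrier keys_hcomp)

text \<open>The guard \<open>e \<le> j\<close> is needed because truncated subtraction would
  otherwise produce a spurious component of degree 0.\<close>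

lemma hcomp_mult:
  assumes "homogeneous e q"
  shows "hcomp j (p * q) = (if e \<le> j then hcomp (j - e) p * q else 0)"
proof (induction p rule: poly_mapping_induct_add)
  case (single k c)
  have "homogeneous (mdeg k + e) (single k c * q)"
    by (intro homogeneous_mult homogeneous_single assms refl)
  moreover have "homogeneous (mdeg k) (single k c)"
    by (simp add: homogeneous_single)
  ultimately show ?case
    by (auto simp: hcomp_homogeneous)
qed (auto simp: distrib_right hcomp_add)

section \<open>Vectors graded by a degree function on the basis\<close>

definition hvec :: "('b \<Rightarrow> nat) \<Rightarrow> nat \<Rightarrow> ('b \<Rightarrow>\<^sub>0 'a::field mpol) \<Rightarrow> bool" where
  "hvec deg j u \<longleftrightarrow> (\<forall>b\<in>keys u. deg b \<le> j \<and> homogeneous (j - deg b) (lookup u b))"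

lemma hvec_fst: "hvec fst = homogeneous_vec"
  by (intro ext) (simp add: hvec_def homogeneous_vec_def)

lemma hvec_0 [simp]: "hvec deg j 0"
  by (simp add: hvec_def)

lemma hvec_lookup: "hvec deg j u \<Longrightarrow> homogeneous (j - deg b) (lookup u b)"
  by (cases "b \<in> keys u") (auto simp: hvec_def in_keys_iff)

lemma hvec_add: "hvec deg j u \<Longrightarrow> hvec deg j v \<Longrightarrow> hvec deg j (u + v)"
  using Poly_Mapping.keys_add[of u v]
  by (auto simp: hvec_def[of _ _ "u + v"] lookup_add intro!: homogeneous_add hvec_lookup)
    (auto simp: hvec_def)

lemma hvec_uminus: "hvec deg j u \<Longrightarrow> hvec deg j (- u)"
  by (simp add: hvec_def homogeneous_uminus)

lemma hvec_diff: "hvec deg j u \<Longrightarrow> hvec deg j v \<Longrightarrow> hvec deg j (u - v)"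
  using hvec_add[OF _ hvec_uminus] by (metis diff_conv_add_uminus)

lemma hvec_sum: "(\<And>x. x \<in> A \<Longrightarrow> hvec deg j (f x)) \<Longrightarrow> hvec deg j (sum f A)"
  by (induction A rule: infinite_finite_induct) (auto intro: hvec_add)

lemma hvec_scale: "homogeneous i c \<Longrightarrow> hvec deg j u \<Longrightarrow> hvec deg (i + j) (scale c u)"
  using keys_scale[of c u] homogeneous_mult[of i c]
  by (fastforce simp: hvec_def)

lemma hvec_single: "homogeneous i c \<Longrightarrow> hvec deg (deg b + i) (single b c)"
  by (simp add: hvec_def)

lemma hvec_lin_ext:
  assumes "\<And>b. b \<in> keys u \<Longrightarrow> hvec deg' (deg b) (f b)" "hvec deg j u"
  shows "hvec deg' j (lin_ext f u)"
  unfolding lin_ext_def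
proof (rule hvec_sum)
  fix b assume b: "b \<in> keys u"
  with assms(2) have "deg b \<le> j" "homogeneous (j - deg b) (lookup u b)"
    by (auto simp: hvec_def)
  with hvec_scale[OF this(2) assms(1)[OF b]] show "hvec deg' j (scale (lookup u b) (f b))"
    by simp
qed

definition vcomp :: "('b \<Rightarrow> nat) \<Rightarrow> nat \<Rightarrow> ('b \<Rightarrow>\<^sub>0 'a::field mpol) \<Rightarrow> ('b \<Rightarrow>\<^sub>0 'a mpol)" where
  "vcomp deg j u = Poly_Mapping.mapp (\<lambda>b p. if deg b \<le> j then hcomp (j - deg b) p else 0) u"

lemma lookup_vcomp:
  "lookup (vcomp deg j u) b = (if deg b \<le> j then hcomp (j - deg b) (lookup u b) else 0)"
  by (auto simp: vcomp_def lookup_mapp when_def in_keys_iff)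

lemma keys_vcomp: "keys (vcomp deg j u) \<subseteq> keys u"
  by (auto simp: in_keys_iff lookup_vcomp split: if_splits)

lemma hvec_vcomp [simp]: "hvec deg j (vcomp deg j u)"
  by (auto simp: hvec_def in_keys_iff lookup_vcomp split: if_splits)

lemma vcomp_hvec: "hvec deg j u \<Longrightarrow> vcomp deg j u = u"
proof (rule poly_mapping_eqI)
  fix b assume "hvec deg j u"
  then show "lookup (vcomp deg j u) b = lookup u b"
    by (cases "lookup u b = 0") (auto simp: lookup_vcomp hvec_def in_keys_iff hcomp_homogeneous[of "j - deg b"])
qed

lemma vcomp_free_on: "u \<in> free_on V B \<Longrightarrow> vcomp deg j u \<in> free_on V B"
  using keys_vcomp[of deg j u] by (auto simp: free_on_def lookup_vcomp hcomp_polys)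

lemma vcomp_add: "vcomp deg j (u + v) = vcomp deg j u + vcomp deg j v"
  by (rule poly_mapping_eqI) (simp add: lookup_vcomp lookup_add hcomp_add)

text \<open>Entry by entry this is \<open>hcomp_mult\<close>, the entry of \<open>f b\<close> at
  \<open>b'\<close> having degree \<open>deg b - deg' b'\<close>. It makes kernels graded and
  provides homogeneous preimages of homogeneous elements.\<close>

lemma vcomp_lin_ext:
  assumes "\<And>b. b \<in> keys u \<Longrightarrow> hvec deg' (deg b) (f b)"
  shows "vcomp deg' j (lin_ext f u) = lin_ext f (vcomp deg j u)"
proof (rule poly_mapping_eqI)
  fix b'
  have *: "(if deg' b' \<le> j then hcomp (j - deg' b') (lookup u b * lookup (f b) b') else 0) =
      lookup (vcomp deg j u) b * lookup (f b) b'" if b: "b \<in> keys u" for b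
  proof (cases "lookup (f b) b' = 0")
    case False
    with assms[OF b] have "deg' b' \<le> deg b" "homogeneous (deg b - deg' b') (lookup (f b) b')"
      by (auto simp: hvec_def in_keys_iff)
    then show ?thesis
      by (auto simp: hcomp_mult lookup_vcomp)
  qed simp
  have "lookup (vcomp deg' j (lin_ext f u)) b' =
      (\<Sum>b\<in>keys u. if deg' b' \<le> j then hcomp (j - deg' b') (lookup u b * lookup (f b) b') else 0)"
    by (simp add: lookup_vcomp lookup_lin_ext hcomp_sum)
  also have "\<dots> = (\<Sum>b\<in>keys u. lookup (vcomp deg j u) b * lookup (f b) b')"
    by (rule sum.cong[OF refl *])
  also have "\<dots> = lookup (lin_ext f (vcomp deg j u)) b'"
    by (subst lin_ext_superset[OF finite_keys keys_vcomp]) (simp add: lookup_sum)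
  finally show "lookup (vcomp deg' j (lin_ext f u)) b' = lookup (lin_ext f (vcomp deg j u)) b'" .
qed

lemma sum_vcomp:
  fixes u :: "'b \<Rightarrow>\<^sub>0 'a::field mpol"
  shows "\<exists>N. u = (\<Sum>j<N. vcomp deg j u)"
proof -
  have 0: "\<exists>N0. \<forall>N\<ge>N0. (0 :: 'b \<Rightarrow>\<^sub>0 'a mpol) = (\<Sum>j<N. vcomp deg j 0)"
    by (simp add: vcomp_def) (simp add: poly_mapping_eq_iff fun_eq_iff lookup_mapp lookup_sum)
  \<comment> \<open>The equation is proved for all large \<open>N\<close> instead of a single one,
    so that the bounds for two summands can be merged by their maximum.\<close>
  have sum_closed: "\<exists>N0. \<forall>N\<ge>N0. u + v = (\<Sum>j<N. vcomp deg j (u + v))"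
    if "\<exists>N0. \<forall>N\<ge>N0. u = (\<Sum>j<N. vcomp deg j u)" "\<exists>N0. \<forall>N\<ge>N0. v = (\<Sum>j<N. vcomp deg j v)"
    for u v :: "'b \<Rightarrow>\<^sub>0 'a mpol"
  proof -
    from that obtain N M where "\<forall>L\<ge>N. u = (\<Sum>j<L. vcomp deg j u)" "\<forall>L\<ge>M. v = (\<Sum>j<L. vcomp deg j v)"
      by blast
    then show ?thesis
      by (intro exI[of _ "max N M"]) (simp add: vcomp_add sum.distrib)
  qed
  have "\<exists>N0. \<forall>N\<ge>N0. u = (\<Sum>j<N. vcomp deg j u)"
  proof (induction u rule: poly_mapping_induct_add)
    case (single b p)
    show ?case
    proof (induction p rule: poly_mapping_induct_add)
      case (single m c)
      let ?d = "deg b + mdeg m"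
      have *: "vcomp deg j (single b (single m c)) = (if j = ?d then single b (single m c) else 0)" for j
        by (rule poly_mapping_eqI)
          (auto simp: lookup_vcomp lookup_single when_def hcomp_homogeneous[OF homogeneous_single[OF refl]])
      show ?case
        by (rule exI[of _ "Suc ?d"]) (auto simp: *)
    next
      case (add p q)
      then show ?case
        unfolding single_add by (rule sum_closed)
    qed (simp only: single_zero 0)
  qed (simp only: 0, rule sum_closed)
  then show ?thesis by blast
qed

section \<open>Augmented resolutions and their comparison\<close>

text \<open>
  The ring is placed in position 0, as the free module on the single basis element \<open>e\<close>, so that
  the augmentation is one of the differentials. Then the cycles in position 0 stand for the
  ideal, and exactness in all positions takes the same form.
\<close>

definition cycles ::
  "nat set \<Rightarrow> 'a::field mpol set \<Rightarrow> (nat \<Rightarrow> 'b set) \<Rightarrow> (nat \<Rightarrow> 'b \<Rightarrow> ('b \<Rightarrow>\<^sub>0 'a mpol)) \<Rightarrow> 'b \<Rightarrow> nat \<Rightarrow>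
    ('b \<Rightarrow>\<^sub>0 'a mpol) set" where
  "cycles V I B D e i = (case i of 0 \<Rightarrow> single e ` I
    | Suc l \<Rightarrow> {u \<in> free_on V (B (Suc l)). lin_ext (D l) u = 0})"

lemma cycles_simps [simp]:
  "cycles V I B D e 0 = single e ` I"
  "cycles V I B D e (Suc l) = {u \<in> free_on V (B (Suc l)). lin_ext (D l) u = 0}"
  by (simp_all add: cycles_def)

locale graded_res =
  fixes V :: "nat set" and I :: "'a::field mpol set" and B :: "nat \<Rightarrow> 'b set" and deg :: "'b \<Rightarrow> nat"
    and D :: "nat \<Rightarrow> 'b \<Rightarrow> ('b \<Rightarrow>\<^sub>0 'a mpol)" and e :: 'b
  assumes B_0: "B 0 = {e}" and deg_e: "deg e = 0"
    and D_free: "\<And>i b. b \<in> B (Suc i) \<Longrightarrow> D i b \<in> free_on V (B i)"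
    and D_hvec: "\<And>i b. b \<in> B (Suc i) \<Longrightarrow> hvec deg (deg b) (D i b)"
    and exact: "\<And>i. lin_ext (D i) ` free_on V (B (Suc i)) = cycles V I B D e i"
begin

lemma lin_ext_D_cycles: "u \<in> free_on V (B (Suc i)) \<Longrightarrow> lin_ext (D i) u \<in> cycles V I B D e i"
  using exact by blast

lemma D_cycles: "b \<in> B (Suc i) \<Longrightarrow> D i b \<in> cycles V I B D e i"
  using lin_ext_D_cycles[of "single b 1" i] by (simp add: free_on_single)

lemma D_D: "b \<in> B (Suc (Suc i)) \<Longrightarrow> lin_ext (D i) (D (Suc i) b) = 0"
  using D_cycles[of b "Suc i"] by (simp only: cycles_simps mem_Collect_eq)

lemma lin_ext_D_D: "u \<in> free_on V (B (Suc (Suc i))) \<Longrightarrow> lin_ext (D i) (lin_ext (D (Suc i)) u) = 0"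
  using lin_ext_D_cycles[of u "Suc i"] by (simp only: cycles_simps mem_Collect_eq)

lemma cycles_free: "u \<in> cycles V I B D e i \<Longrightarrow> u \<in> free_on V (B i)"
  unfolding exact[symmetric] by (auto intro!: free_on_lin_ext D_free)

lemma vcomp_D:
  "u \<in> free_on V (B (Suc i)) \<Longrightarrow> vcomp deg j (lin_ext (D i) u) = lin_ext (D i) (vcomp deg j u)"
  by (rule vcomp_lin_ext) (auto simp: free_on_def intro: D_hvec)

text \<open>An arbitrary preimage may have components in other degrees. Its component in degree
  \<open>j\<close> is still a preimage, because the differential preserves degrees.\<close>

lemma lift:
  assumes "u \<in> cycles V I B D e i" "hvec deg j u"
  obtains w where "w \<in> free_on V (B (Suc i))" "hvec deg j w" "lin_ext (D i) w = u"
proof -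
  from assms(1) obtain w where w: "w \<in> free_on V (B (Suc i))" "lin_ext (D i) w = u"
    unfolding exact[symmetric] by blast
  show ?thesis
    by (rule that[of "vcomp deg j w"])
      (use w assms(2) in \<open>simp_all add: vcomp_free_on vcomp_hvec flip: vcomp_D\<close>)
qed

end

text \<open>The source is free and the target exact, so the image of each basis element can be
  lifted along the next differential. The inclusion \<open>I \<subseteq> J\<close> makes the
  identity of the ring send cycles to cycles in position 0.\<close>

lemma comparison:
  assumes "graded_res V I B deg D e" "graded_res V J B' deg' D' e'" "I \<subseteq> J"
  obtains \<phi> where "\<phi> 0 = (\<lambda>_. single e' 1)"
    "\<And>i b. b \<in> B i \<Longrightarrow> \<phi> i b \<in> free_on V (B' i)"
    "\<And>i b. b \<in> B i \<Longrightarrow> hvec deg' (deg b) (\<phi> i b)"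
    "\<And>i b. b \<in> B (Suc i) \<Longrightarrow> lin_ext (D' i) (\<phi> (Suc i) b) = lin_ext (\<phi> i) (D i b)"
proof -
  interpret F: graded_res V I B deg D e by fact
  interpret G: graded_res V J B' deg' D' e' by fact
  \<comment> \<open>The last clause, that cycles go to cycles, is the invariant that makes the next
    lift possible; dependent choice then fixes the maps one position at a time.\<close>
  define P where "P n x \<longleftrightarrow> (n = 0 \<longrightarrow> x = (\<lambda>_. single e' 1)) \<and>
    (\<forall>b\<in>B n. x b \<in> free_on V (B' n) \<and> hvec deg' (deg b) (x b)) \<and>
    (\<forall>u\<in>cycles V I B D e n. lin_ext x u \<in> cycles V J B' D' e' n)" for n x
  define Q where "Q n x y \<longleftrightarrow> (\<forall>b\<in>B (Suc n). lin_ext (D' n) (y b) = lin_ext x (D n b))" for n and x y :: "'b \<Rightarrow> ('c \<Rightarrow>\<^sub>0 'a mpol)"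
  have "\<exists>\<phi>. \<forall>n. P n (\<phi> n) \<and> Q n (\<phi> n) (\<phi> (Suc n))"
  proof (rule dependent_nat_choice)
    have "hvec deg' 0 (single e' (1 :: 'a mpol))"
      using hvec_single[of 0 "1 :: 'a mpol" deg' e'] by (simp add: G.deg_e homogeneous_iff)
    then show "\<exists>x. P 0 x"
      using \<open>I \<subseteq> J\<close>
      by (intro exI[of _ "\<lambda>_. single e' 1"]) (auto simp: P_def F.B_0 G.B_0 F.deg_e scale_single intro!: free_on_single)
  next
    fix x n assume P: "P n x"
    have "\<exists>w. w \<in> free_on V (B' (Suc n)) \<and> hvec deg' (deg b) w \<and> lin_ext (D' n) w = lin_ext x (D n b)"
      if b: "b \<in> B (Suc n)" for b
    proof -
      have "lin_ext x (D n b) \<in> cycles V J B' D' e' n"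
        using P F.D_cycles[OF b] by (simp add: P_def)
      moreover have "hvec deg' (deg b) (lin_ext x (D n b))"
      proof (rule hvec_lin_ext[OF _ F.D_hvec[OF b]])
        fix c assume "c \<in> keys (D n b)"
        with F.D_free[OF b] have "c \<in> B n" by (auto simp: free_on_def)
        with P show "hvec deg' (deg c) (x c)" by (simp add: P_def)
      qed
      ultimately show ?thesis
        by (rule G.lift) blast
    qed
    then obtain y where y: "\<And>b. b \<in> B (Suc n) \<Longrightarrow> y b \<in> free_on V (B' (Suc n))"
      "\<And>b. b \<in> B (Suc n) \<Longrightarrow> hvec deg' (deg b) (y b)"
      "\<And>b. b \<in> B (Suc n) \<Longrightarrow> lin_ext (D' n) (y b) = lin_ext x (D n b)"
      by metis
    have "lin_ext y u \<in> cycles V J B' D' e' (Suc n)" if u: "u \<in> cycles V I B D e (Suc n)" for u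
    proof -
      have free: "u \<in> free_on V (B (Suc n))" and 0: "lin_ext (D n) u = 0"
        using u by auto
      have "lin_ext (D' n) (lin_ext y u) = lin_ext (\<lambda>b. lin_ext x (D n b)) u"
        by (simp only: lin_ext_comp) (rule lin_ext_cong_free[OF free y(3)])
      also have "\<dots> = 0"
        by (simp flip: lin_ext_comp add: 0)
      finally show ?thesis
        using free_on_lin_ext[OF y(1) free] by simp
    qed
    then show "\<exists>y. P (Suc n) y \<and> Q n x y"
      using y by (intro exI[of _ y]) (simp add: P_def Q_def)
  qed
  then obtain \<phi> where "\<forall>n. P n (\<phi> n) \<and> Q n (\<phi> n) (\<phi> (Suc n))" ..
  then show ?thesis
    by (intro that[of \<phi>]) (auto simp: P_def Q_def)
qed

text \<open>Because the two maps agree in position 0, the homotopy can start with zero there. That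
  value is recorded in the conclusion, since the comparison of Tor in homological degree 0 relies on
  it.\<close>

lemma homotopy:
  assumes "graded_res V I B deg D e" "graded_res V J B' deg' D' e'"
    and \<alpha>: "\<And>i b. b \<in> B i \<Longrightarrow> \<alpha> i b \<in> free_on V (B' i)"
      "\<And>i b. b \<in> B i \<Longrightarrow> hvec deg' (deg b) (\<alpha> i b)"
      "\<And>i b. b \<in> B (Suc i) \<Longrightarrow> lin_ext (D' i) (\<alpha> (Suc i) b) = lin_ext (\<alpha> i) (D i b)"
    and \<beta>: "\<And>i b. b \<in> B i \<Longrightarrow> \<beta> i b \<in> free_on V (B' i)"
      "\<And>i b. b \<in> B i \<Longrightarrow> hvec deg' (deg b) (\<beta> i b)"
      "\<And>i b. b \<in> B (Suc i) \<Longrightarrow> lin_ext (D' i) (\<beta> (Suc i) b) = lin_ext (\<beta> i) (D i b)"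
    and 0: "\<And>b. b \<in> B 0 \<Longrightarrow> \<alpha> 0 b = \<beta> 0 b"
  obtains s where "s 0 = (\<lambda>_. 0)"
    "\<And>i b. b \<in> B i \<Longrightarrow> s i b \<in> free_on V (B' (Suc i))"
    "\<And>i b. b \<in> B i \<Longrightarrow> hvec deg' (deg b) (s i b)"
    "\<And>i b. b \<in> B (Suc i) \<Longrightarrow>
      lin_ext (D' (Suc i)) (s (Suc i) b) = \<alpha> (Suc i) b - \<beta> (Suc i) b - lin_ext (s i) (D i b)"
proof -
  interpret F: graded_res V I B deg D e by fact
  interpret G: graded_res V J B' deg' D' e' by fact
  \<comment> \<open>On cycles the term \<open>s D\<close> drops out of the homotopy identity. This
    restricted form, applied to \<open>D n b\<close>, shows that the element to be lifted next is a
    cycle.\<close>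
  define P where "P n x \<longleftrightarrow> (n = 0 \<longrightarrow> x = (\<lambda>_. 0)) \<and>
    (\<forall>b\<in>B n. x b \<in> free_on V (B' (Suc n)) \<and> hvec deg' (deg b) (x b)) \<and>
    (\<forall>u\<in>cycles V I B D e n. lin_ext (D' n) (lin_ext x u) = lin_ext (\<alpha> n) u - lin_ext (\<beta> n) u)" for n x
  define Q where "Q n x y \<longleftrightarrow> (\<forall>b\<in>B (Suc n). lin_ext (D' (Suc n)) (y b) =
    \<alpha> (Suc n) b - \<beta> (Suc n) b - lin_ext x (D n b))" for n and x y :: "'b \<Rightarrow> ('c \<Rightarrow>\<^sub>0 'a mpol)"
  have "\<exists>s. \<forall>n. P n (s n) \<and> Q n (s n) (s (Suc n))"
  proof (rule dependent_nat_choice)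
    show "\<exists>x. P 0 x"
      using 0 by (intro exI[of _ "\<lambda>_. 0"]) (auto simp: P_def F.B_0 scale_single)
  next
    fix x n assume P: "P n x"
    have "\<exists>w. w \<in> free_on V (B' (Suc (Suc n))) \<and> hvec deg' (deg b) w \<and>
        lin_ext (D' (Suc n)) w = \<alpha> (Suc n) b - \<beta> (Suc n) b - lin_ext x (D n b)"
      if b: "b \<in> B (Suc n)" for b
    proof -
      have "lin_ext x (D n b) \<in> free_on V (B' (Suc n))"
        using P by (intro free_on_lin_ext[OF _ F.D_free[OF b]]) (simp add: P_def)
      then have "\<alpha> (Suc n) b - \<beta> (Suc n) b - lin_ext x (D n b) \<in> cycles V J B' D' e' (Suc n)"
        using P F.D_cycles[OF b] \<alpha>(1,3)[OF b] \<beta>(1,3)[OF b] F.D_free[OF b]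
        by (simp add: P_def lin_ext.diff free_on_diff)
      moreover have "hvec deg' (deg b) (lin_ext x (D n b))"
      proof (rule hvec_lin_ext[OF _ F.D_hvec[OF b]])
        fix c assume "c \<in> keys (D n b)"
        with F.D_free[OF b] have "c \<in> B n" by (auto simp: free_on_def)
        with P show "hvec deg' (deg c) (x c)" by (simp add: P_def)
      qed
      then have "hvec deg' (deg b) (\<alpha> (Suc n) b - \<beta> (Suc n) b - lin_ext x (D n b))"
        using b by (intro hvec_diff \<alpha> \<beta>)
      ultimately show ?thesis
        by (rule G.lift) blast
    qed
    then obtain y where y: "\<And>b. b \<in> B (Suc n) \<Longrightarrow> y b \<in> free_on V (B' (Suc (Suc n)))"
      "\<And>b. b \<in> B (Suc n) \<Longrightarrow> hvec deg' (deg b) (y b)"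
      "\<And>b. b \<in> B (Suc n) \<Longrightarrow> lin_ext (D' (Suc n)) (y b) = \<alpha> (Suc n) b - \<beta> (Suc n) b - lin_ext x (D n b)"
      by metis
    have "lin_ext (D' (Suc n)) (lin_ext y u) = lin_ext (\<alpha> (Suc n)) u - lin_ext (\<beta> (Suc n)) u"
      if u: "u \<in> cycles V I B D e (Suc n)" for u
    proof -
      have free: "u \<in> free_on V (B (Suc n))" and 0: "lin_ext (D n) u = 0"
        using u by auto
      have "lin_ext (D' (Suc n)) (lin_ext y u) =
          lin_ext (\<lambda>b. \<alpha> (Suc n) b - \<beta> (Suc n) b - lin_ext x (D n b)) u"
        by (simp only: lin_ext_comp) (rule lin_ext_cong_free[OF free y(3)])
      also have "\<dots> = lin_ext (\<alpha> (Suc n)) u - lin_ext (\<beta> (Suc n)) u"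
        by (simp add: lin_ext_fun_diff flip: lin_ext_comp) (simp add: 0)
      finally show ?thesis .
    qed
    then show "\<exists>y. P (Suc n) y \<and> Q n x y"
      using y by (intro exI[of _ y]) (simp add: P_def Q_def)
  qed
  then obtain s where "\<forall>n. P n (s n) \<and> Q n (s n) (s (Suc n))" ..
  then show ?thesis
    by (intro that[of s]) (auto simp: P_def Q_def)
qed

section \<open>Free complexes as augmented resolutions\<close>

definition aug_basis :: "'a::field free_cplx \<Rightarrow> nat \<Rightarrow> (nat \<times> nat) set" where
  "aug_basis F i = (case i of 0 \<Rightarrow> {(0, 0)} | Suc l \<Rightarrow> basis F l)"

definition aug_bd :: "'a::field free_cplx \<Rightarrow> nat \<Rightarrow> nat \<times> nat \<Rightarrow> (nat \<times> nat \<Rightarrow>\<^sub>0 'a mpol)" where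
  "aug_bd F i = (case i of 0 \<Rightarrow> (\<lambda>b. single (0, 0) (aug F b)) | Suc l \<Rightarrow> bd F l)"

lemma aug_simps [simp]:
  "aug_basis F 0 = {(0, 0)}" "aug_basis F (Suc l) = basis F l"
  "aug_bd F 0 = (\<lambda>b. single (0, 0) (aug F b))" "aug_bd F (Suc l) = bd F l"
  by (simp_all add: aug_basis_def aug_bd_def)

lemma free_mod_eq: "free_mod V F i = free_on V (basis F i)"
  by (simp add: free_mod_def free_on_def)

lemma lin_ext_single_basis: "lin_ext (\<lambda>b. single e (f b)) u = single e (\<Sum>b\<in>keys u. lookup u b * f b)"
  by (rule poly_mapping_eqI) (auto simp: lookup_lin_ext lookup_single when_def)

text \<open>Positions 0, 1 and beyond of the uniform exactness condition are the conditions on the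
  image of the augmentation, on its kernel and on the later kernels. The pair \<open>(0, 0)\<close>
  that stands for the ring may also be a generator of the first module: positions are never mixed,
  and \<open>fst\<close> gives it degree 0 anyway.\<close>

lemma graded_free_resolution_iff:
  "graded_free_resolution V I F \<longleftrightarrow> graded_res V I (aug_basis F) fst (aug_bd F) (0, 0)"
proof -
  have single: "single (0, 0) ` A = single (0, 0) ` I \<longleftrightarrow> A = I" for A :: "'a mpol set"
    by (rule inj_image_eq_iff) simp
  have aug: "lin_ext (\<lambda>b. single (0, 0) (aug F b)) ` A = single (0, 0) ` (aug_map F ` A)" for A
    by (simp add: lin_ext_single_basis aug_map_def image_image)
  have free: "single (0, 0) p \<in> free_on V {(0 :: nat, 0 :: nat)} \<longleftrightarrow> p \<in> polys V" for p :: "'a mpol"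
    by (auto simp: free_on_def lookup_single when_def)
  have hvec: "hvec fst j (single (0 :: nat, 0 :: nat) p) \<longleftrightarrow> homogeneous j p" for p :: "'a mpol" and j
    by (auto simp: hvec_def)
  have ker0: "lin_ext (\<lambda>b. single (0, 0) (aug F b)) u = 0 \<longleftrightarrow> aug_map F u = 0" for u
    by (simp add: lin_ext_single_basis aug_map_def poly_mapping_eq_iff[of "single _ _"] fun_eq_iff lookup_single when_def)
  have "graded_res V I (aug_basis F) fst (aug_bd F) (0, 0) \<longleftrightarrow>
    (\<forall>i. \<forall>b\<in>aug_basis F (Suc i). aug_bd F i b \<in> free_on V (aug_basis F i) \<and> hvec fst (fst b) (aug_bd F i b)) \<and>
    (\<forall>i. lin_ext (aug_bd F i) ` free_on V (aug_basis F (Suc i)) = cycles V I (aug_basis F) (aug_bd F) (0, 0) i)"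
    by (simp add: graded_res_def Ball_def del: split_paired_All) blast
  also have "\<dots> \<longleftrightarrow> graded_free_resolution V I F"
  proof -
    have split: "(\<forall>i. P i) \<longleftrightarrow> P 0 \<and> (\<forall>i. P (Suc i))" for P :: "nat \<Rightarrow> bool"
      by (metis not0_implies_Suc)
    have split2: "(\<forall>i. P i) \<longleftrightarrow> P 0 \<and> P 1 \<and> (\<forall>i. P (Suc (Suc i)))" for P :: "nat \<Rightarrow> bool"
      by (metis One_nat_def not0_implies_Suc)
    have "(\<forall>i. \<forall>b\<in>aug_basis F (Suc i). aug_bd F i b \<in> free_on V (aug_basis F i) \<and> hvec fst (fst b) (aug_bd F i b)) \<longleftrightarrow>
      (\<forall>b\<in>basis F 0. aug F b \<in> polys V \<and> homogeneous (fst b) (aug F b)) \<and>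
      (\<forall>i. \<forall>b\<in>basis F (Suc i). bd F i b \<in> free_mod V F i \<and> homogeneous_vec (fst b) (bd F i b))"
      by (subst split) (simp add: free hvec free_mod_eq flip: hvec_fst)
    moreover have "(\<forall>i. lin_ext (aug_bd F i) ` free_on V (aug_basis F (Suc i)) = cycles V I (aug_basis F) (aug_bd F) (0, 0) i) \<longleftrightarrow>
      aug_map F ` free_mod V F 0 = I \<and>
      {u \<in> free_mod V F 0. aug_map F u = 0} = bd_map F 0 ` free_mod V F 1 \<and>
      (\<forall>i. {u \<in> free_mod V F (Suc i). bd_map F i u = 0} = bd_map F (Suc i) ` free_mod V F (Suc (Suc i)))"
      by (subst split2)
        (simp add: aug single bd_map_def free_mod_eq ker0
          eq_commute[of "Collect P" "image f A" for P :: "(nat \<times> nat \<Rightarrow>\<^sub>0 'a mpol) \<Rightarrow> bool" and f A])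
    ultimately show ?thesis
      by (simp add: graded_free_resolution_def)
  qed
  finally show ?thesis ..
qed

section \<open>The dimension of Tor\<close>

interpretation vec: vector_space "scale :: 'k::field \<Rightarrow> ('b \<Rightarrow>\<^sub>0 'k) \<Rightarrow> ('b \<Rightarrow>\<^sub>0 'k)"
  by (rule vector_space_scale)

text \<open>\<open>f\<close> kills \<open>W\<close> and is inverse to \<open>g\<close> on one side,
  while every \<open>z\<close> differs from \<open>g (f z)\<close> by an element of
  \<open>W\<close>. So \<open>Z\<close> is the direct sum of \<open>W\<close> and the span of the
  \<open>g s\<close>. For Tor, \<open>Z\<close> and \<open>W\<close> are cycles and boundaries, and
  \<open>f\<close>, \<open>g\<close> come from the comparison maps.\<close>

lemma dim_split:
  fixes Z W :: "('b \<Rightarrow>\<^sub>0 'k::field) set" and f :: "'b \<Rightarrow> ('c \<Rightarrow>\<^sub>0 'k)" and g :: "'c \<Rightarrow> ('b \<Rightarrow>\<^sub>0 'k)"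
  assumes S: "finite S" and W: "finite T" "W \<subseteq> scale.span T" "W \<subseteq> Z"
    and g: "\<And>s. s \<in> S \<Longrightarrow> g s \<in> Z"
    and fW: "\<And>w. w \<in> W \<Longrightarrow> lin_ext f w = 0"
    and fg: "\<And>s. s \<in> S \<Longrightarrow> lin_ext f (g s) = single s 1"
    and Z: "\<And>z. z \<in> Z \<Longrightarrow> keys (lin_ext f z) \<subseteq> S"
      "\<And>z. z \<in> Z \<Longrightarrow> z - lin_ext g (lin_ext f z) \<in> W"
  shows "vec.dim Z = vec.dim W + card S"
proof -
  obtain A where A: "A \<subseteq> W" "scale.independent A" "W \<subseteq> scale.span A" "card A = vec.dim W"
    using vec.basis_exists by blast
  have "A \<subseteq> scale.span T"
    using A(1) W(2) by blast
  then have finA: "finite A"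
    using vec.independent_span_bound[OF W(1) A(2)] by blast
  have *: "scale.independent (A \<union> g ` S') \<and> card (A \<union> g ` S') = card A + card S'" if "S' \<subseteq> S" for S'
    using finite_subset[OF that S] that
  proof (induction S' rule: finite_induct)
    case empty
    then show ?case using A by simp
  next
    case (insert s S')
    \<comment> \<open>The coordinate \<open>s\<close> of \<open>f\<close> separates the new vector
      from the old ones: it is 0 on \<open>A\<close> and on the earlier \<open>g s'\<close>, but 1
      on \<open>g s\<close>.\<close>
    have sub: "scale.span (A \<union> g ` S') \<subseteq> {x. lookup (lin_ext f x) s = 0}"
    proof (rule scale.span_minimal)
      show "A \<union> g ` S' \<subseteq> {x. lookup (lin_ext f x) s = 0}"
        using insert A(1) by (auto simp: fW fg subset_iff lookup_single when_def)
      show "scale.subspace {x. lookup (lin_ext f x) s = 0}"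
        by (rule scale.subspaceI) (simp_all add: lin_ext_add lin_ext_scale lookup_add)
    qed
    have s: "g s \<notin> scale.span (A \<union> g ` S')"
    proof
      assume "g s \<in> scale.span (A \<union> g ` S')"
      then have "g s \<in> {x. lookup (lin_ext f x) s = 0}"
        by (rule subsetD[OF sub])
      then show False
        using insert.prems fg[of s] by simp
    qed
    then have "g s \<notin> A \<union> g ` S'"
      by (rule contrapos_nn) (rule scale.span_base)
    moreover have "scale.independent (insert (g s) (A \<union> g ` S'))"
      using s insert by (intro vec.independent_insertI) auto
    ultimately show ?case
      using insert finA by simp
  qed
  have "A \<union> g ` S \<subseteq> Z"
    using A(1) W(3) g by auto
  moreover have "Z \<subseteq> scale.span (A \<union> g ` S)"
  proof
    fix z assume z: "z \<in> Z"
    have "z - lin_ext g (lin_ext f z) \<in> scale.span (A \<union> g ` S)"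
      using Z(2)[OF z] A(3) scale.span_mono[of A "A \<union> g ` S"] by auto
    moreover have "lin_ext g (lin_ext f z) \<in> scale.span (A \<union> g ` S)"
      unfolding lin_ext_def[of g]
      using Z(1)[OF z] by (intro scale.span_sum scale.span_scale scale.span_base) auto
    ultimately have "z - lin_ext g (lin_ext f z) + lin_ext g (lin_ext f z) \<in> scale.span (A \<union> g ` S)"
      by (rule scale.span_add)
    then show "z \<in> scale.span (A \<union> g ` S)"
      by simp
  qed
  ultimately have "card (A \<union> g ` S) = vec.dim Z"
    using *[of S] by (intro vec.basis_card_eq_dim) auto
  with *[of S] A(4) show ?thesis by simp
qed

lemma keys_lin_ext: "(\<And>b. b \<in> keys u \<Longrightarrow> keys (f b) \<subseteq> S) \<Longrightarrow> keys (lin_ext f u) \<subseteq> S"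
  unfolding lin_ext_def using Poly_Mapping.keys_sum keys_scale by fastforce

text \<open>At a basis element of degree below \<open>j\<close> the entry is homogeneous of positive
  degree and has no constant term. So reduced maps preserve the internal degree, and a
  degree-preserving map between modules generated in different degrees reduces to zero.\<close>

lemma keys_const_part:
  assumes "u \<in> free_on V B" "hvec deg j u"
  shows "keys (const_part u) \<subseteq> {b \<in> B. deg b = j}"
proof
  fix b assume "b \<in> keys (const_part u)"
  then have b: "const_coeff (lookup u b) \<noteq> 0"
    by (simp add: in_keys_iff)
  then have "b \<in> keys u"
    by (auto simp: in_keys_iff)
  with assms have "b \<in> B" "deg b \<le> j" "homogeneous (j - deg b) (lookup u b)"
    by (auto simp: free_on_def hvec_def)
  with const_coeff_homogeneous[OF this(3)] b show "b \<in> {b \<in> B. deg b = j}"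
    by auto
qed

lemma keys_lin_ext_const_part:
  assumes "\<And>b. b \<in> B \<Longrightarrow> f b \<in> free_on V C" "\<And>b. b \<in> B \<Longrightarrow> hvec deg' (deg b) (f b)"
    and "keys c \<subseteq> {b \<in> B. deg b = j}"
  shows "keys (lin_ext (\<lambda>b. const_part (f b)) c) \<subseteq> {b \<in> C. deg' b = j}"
proof (rule keys_lin_ext)
  fix b assume "b \<in> keys c"
  with assms(3) have "b \<in> B" "deg b = j" by auto
  with keys_const_part[OF assms(1,2)] show "keys (const_part (f b)) \<subseteq> {b \<in> C. deg' b = j}"
    by blast
qed

text \<open>On the minimal side the reduced differentials vanish, so \<open>f\<close> after
  \<open>g\<close> is exactly the identity; on the side of \<open>F\<close>, \<open>g\<close> after
  \<open>f\<close> is the identity on cycles up to boundaries. This is the situation of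
  \<open>dim_split\<close>. Position \<open>Suc i\<close> of the augmented complexes holds the
  \<open>i\<close>-th module. The additive form shows that the truncated subtraction in
  \<open>betti\<close> is a true one.\<close>

lemma tor_dim_minimal:
  fixes F :: "'a::field free_cplx"
  assumes F: "graded_free_resolution V I F"
    and M: "graded_res V I B deg D e"
    and minimal: "\<And>i b. b \<in> B (Suc (Suc i)) \<Longrightarrow> const_part (D (Suc i) b) = 0"
    and fin: "finite {b \<in> B (Suc i). deg b = j}"
  shows "vec.dim (tor_cycles F i j) = vec.dim (tor_boundaries F i j) + card {b \<in> B (Suc i). deg b = j}"
proof -
  let ?FB = "aug_basis F" and ?FD = "aug_bd F"
  have F': "graded_res V I ?FB fst ?FD (0, 0)"
    using F by (simp add: graded_free_resolution_iff)
  interpret F: graded_res V I ?FB fst ?FD "(0, 0)" by (rule F')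
  interpret M: graded_res V I B deg D e by fact
  obtain \<phi> where \<phi>0: "\<phi> 0 = (\<lambda>_. single e 1)" and
    \<phi>: "\<And>i b. b \<in> ?FB i \<Longrightarrow> \<phi> i b \<in> free_on V (B i)" "\<And>i b. b \<in> ?FB i \<Longrightarrow> hvec deg (fst b) (\<phi> i b)"
    "\<And>i b. b \<in> ?FB (Suc i) \<Longrightarrow> lin_ext (D i) (\<phi> (Suc i) b) = lin_ext (\<phi> i) (?FD i b)"
    using comparison[OF F' M subset_refl] by blast
  obtain \<psi> where \<psi>0: "\<psi> 0 = (\<lambda>_. single (0, 0) 1)" and
    \<psi>: "\<And>i b. b \<in> B i \<Longrightarrow> \<psi> i b \<in> free_on V (?FB i)" "\<And>i b. b \<in> B i \<Longrightarrow> hvec fst (deg b) (\<psi> i b)"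
    "\<And>i b. b \<in> B (Suc i) \<Longrightarrow> lin_ext (?FD i) (\<psi> (Suc i) b) = lin_ext (\<psi> i) (D i b)"
    using comparison[OF M F' subset_refl] by blast
  have hvec1: "hvec d (d b) (single b (1 :: 'a mpol))" for d :: "'x \<Rightarrow> nat" and b
    using hvec_single[of 0 "1 :: 'a mpol" d b] by (simp add: homogeneous_iff)
  obtain s where s0: "s 0 = (\<lambda>_. 0)" and
    s: "\<And>i b. b \<in> ?FB i \<Longrightarrow> s i b \<in> free_on V (?FB (Suc i))" "\<And>i b. b \<in> ?FB i \<Longrightarrow> hvec fst (fst b) (s i b)"
    "\<And>i b. b \<in> ?FB (Suc i) \<Longrightarrow> lin_ext (?FD (Suc i)) (s (Suc i) b) =
      lin_ext (\<psi> (Suc i)) (\<phi> (Suc i) b) - single b 1 - lin_ext (s i) (?FD i b)"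
  proof (rule homotopy[OF F' F', of "\<lambda>i b. lin_ext (\<psi> i) (\<phi> i b)" "\<lambda>i b. single b 1"])
    fix i b
    {
      assume b: "b \<in> ?FB i"
      show "lin_ext (\<psi> i) (\<phi> i b) \<in> free_on V (?FB i)"
        by (rule free_on_lin_ext[OF \<psi>(1) \<phi>(1)[OF b]])
      show "hvec fst (fst b) (lin_ext (\<psi> i) (\<phi> i b))"
        by (rule hvec_lin_ext[OF _ \<phi>(2)[OF b]]) (use \<phi>(1)[OF b] \<psi>(2) in \<open>auto simp: free_on_def\<close>)
      show "single b 1 \<in> free_on V (?FB i)"
        using b by (simp add: free_on_single)
    }
    assume b: "b \<in> ?FB (Suc i)"
    have "lin_ext (?FD i) (lin_ext (\<psi> (Suc i)) (\<phi> (Suc i) b)) =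
        lin_ext (\<lambda>b. lin_ext (\<psi> i) (D i b)) (\<phi> (Suc i) b)"
      by (simp only: lin_ext_comp) (rule lin_ext_cong_free[OF \<phi>(1)[OF b] \<psi>(3)])
    also have "\<dots> = lin_ext (\<lambda>b. lin_ext (\<psi> i) (\<phi> i b)) (?FD i b)"
      by (simp only: lin_ext_comp[symmetric] \<phi>(3)[OF b])
    finally show "lin_ext (?FD i) (lin_ext (\<psi> (Suc i)) (\<phi> (Suc i) b)) =
        lin_ext (\<lambda>b. lin_ext (\<psi> i) (\<phi> i b)) (?FD i b)" .
  qed (auto simp: \<phi>0 \<psi>0 scale_single hvec1)
  obtain t where t0: "t 0 = (\<lambda>_. 0)" and
    t: "\<And>i b. b \<in> B i \<Longrightarrow> t i b \<in> free_on V (B (Suc i))" "\<And>i b. b \<in> B i \<Longrightarrow> hvec deg (deg b) (t i b)"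
    "\<And>i b. b \<in> B (Suc i) \<Longrightarrow> lin_ext (D (Suc i)) (t (Suc i) b) =
      lin_ext (\<phi> (Suc i)) (\<psi> (Suc i) b) - single b 1 - lin_ext (t i) (D i b)"
  proof (rule homotopy[OF M M, of "\<lambda>i b. lin_ext (\<phi> i) (\<psi> i b)" "\<lambda>i b. single b 1"])
    fix i b
    {
      assume b: "b \<in> B i"
      show "lin_ext (\<phi> i) (\<psi> i b) \<in> free_on V (B i)"
        by (rule free_on_lin_ext[OF \<phi>(1) \<psi>(1)[OF b]])
      show "hvec deg (deg b) (lin_ext (\<phi> i) (\<psi> i b))"
        by (rule hvec_lin_ext[OF _ \<psi>(2)[OF b]]) (use \<psi>(1)[OF b] \<phi>(2) in \<open>auto simp: free_on_def\<close>)
      show "single b 1 \<in> free_on V (B i)"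
        using b by (simp add: free_on_single)
    }
    assume b: "b \<in> B (Suc i)"
    have "lin_ext (D i) (lin_ext (\<phi> (Suc i)) (\<psi> (Suc i) b)) =
        lin_ext (\<lambda>b. lin_ext (\<phi> i) (?FD i b)) (\<psi> (Suc i) b)"
      by (simp only: lin_ext_comp) (rule lin_ext_cong_free[OF \<psi>(1)[OF b] \<phi>(3)])
    also have "\<dots> = lin_ext (\<lambda>b. lin_ext (\<phi> i) (\<psi> i b)) (D i b)"
      by (simp only: lin_ext_comp[symmetric] \<psi>(3)[OF b])
    finally show "lin_ext (D i) (lin_ext (\<phi> (Suc i)) (\<psi> (Suc i) b)) =
        lin_ext (\<lambda>b. lin_ext (\<phi> i) (\<psi> i b)) (D i b)" .
  qed (auto simp: \<phi>0 \<psi>0 scale_single hvec1 M.B_0)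
  define f where "f b = const_part (\<phi> (Suc i) b)" for b
  define g where "g b = const_part (\<psi> (Suc i) b)" for b
  have tensor_bd: "tensor_bd F l = lin_ext (\<lambda>b. const_part (bd F l b))" for l
    by (simp add: tensor_bd_def const_part_def)
  have tensor_bd_keys: "keys (tensor_bd F l c) \<subseteq> {b \<in> basis F l. fst b = j}"
    if "c \<in> tensor_mod F (Suc l) j" for l c
    using that F.D_free[of _ "Suc l"] F.D_hvec[of _ "Suc l"]
    unfolding tensor_bd tensor_mod_def by (intro keys_lin_ext_const_part) auto
  have DM: "lin_ext (\<lambda>b. const_part (D (Suc l) b)) c = 0" if "keys c \<subseteq> B (Suc (Suc l))" for l c
    using that minimal by (simp add: lin_ext_def subset_iff)
  have "vec.dim (tor_cycles F i j) = vec.dim (tor_boundaries F i j) + card {b \<in> B (Suc i). deg b = j}"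
  proof (rule dim_split[OF fin, of "(\<lambda>b. const_part (bd F i b)) ` {b \<in> basis F (Suc i). fst b = j}" _ _ g f])
    have "{b \<in> basis F (Suc i). fst b = j} \<subseteq> {j} \<times> {..<gens F (Suc i) j}"
      by (auto simp: basis_def)
    then show "finite ((\<lambda>b. const_part (bd F i b)) ` {b \<in> basis F (Suc i). fst b = j})"
      by (intro finite_imageI) (erule finite_subset, intro finite_cartesian_product, auto)
    show "tor_boundaries F i j \<subseteq> scale.span ((\<lambda>b. const_part (bd F i b)) ` {b \<in> basis F (Suc i). fst b = j})"
    proof
      fix w assume "w \<in> tor_boundaries F i j"
      then obtain c where "keys c \<subseteq> {b \<in> basis F (Suc i). fst b = j}" and
        w: "w = (\<Sum>b\<in>keys c. scale (lookup c b) (const_part (bd F i b)))"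
        by (auto simp: tor_boundaries_def tensor_bd lin_ext_def tensor_mod_def)
      then show "w \<in> scale.span ((\<lambda>b. const_part (bd F i b)) ` {b \<in> basis F (Suc i). fst b = j})"
        unfolding w by (intro scale.span_sum scale.span_scale) (rule scale.span_base, blast)
    qed
    show "tor_boundaries F i j \<subseteq> tor_cycles F i j"
    proof
      fix w assume "w \<in> tor_boundaries F i j"
      then obtain c where c: "c \<in> tensor_mod F (Suc i) j" "w = tensor_bd F i c"
        by (auto simp: tor_boundaries_def)
      have "tensor_bd F l w = 0" if "i = Suc l" for l
      proof -
        have "tensor_bd F l w = lin_ext (\<lambda>b. const_part (lin_ext (bd F l) (bd F i b))) c"
          by (simp add: c(2) tensor_bd lin_ext_comp const_part_lin_ext)
        also have "\<dots> = lin_ext (\<lambda>b. 0) c"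
          using c(1) F.D_D[of _ i] that by (intro lin_ext_cong) (auto simp: tensor_mod_def)
        finally show ?thesis by simp
      qed
      then show "w \<in> tor_cycles F i j"
        using tensor_bd_keys[OF c(1)] c(2) by (simp add: tor_cycles_def tensor_mod_def)
    qed
    show "g b \<in> tor_cycles F i j" if "b \<in> {b \<in> B (Suc i). deg b = j}" for b
    proof -
      have "keys (g b) \<subseteq> {b \<in> basis F i. fst b = j}"
        unfolding g_def using that \<psi>(1,2)[of b "Suc i"] by (intro keys_const_part) auto
      moreover have "tensor_bd F l (g b) = 0" if l: "i = Suc l" for l
      proof -
        have "tensor_bd F l (g b) = const_part (lin_ext (bd F l) (\<psi> (Suc i) b))"
          by (simp add: tensor_bd g_def const_part_lin_ext)
        also have "\<dots> = const_part (lin_ext (\<psi> i) (D i b))"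
          using \<psi>(3)[of b i] \<open>b \<in> _\<close> l by simp
        also have "\<dots> = 0"
          using minimal[of b l] \<open>b \<in> _\<close> l by (simp add: const_part_lin_ext)
        finally show ?thesis .
      qed
      ultimately show ?thesis
        by (simp add: tor_cycles_def tensor_mod_def)
    qed
    show "lin_ext f w = 0" if w: "w \<in> tor_boundaries F i j" for w
    proof -
      obtain c where c: "c \<in> tensor_mod F (Suc i) j" "w = tensor_bd F i c"
        using w by (auto simp: tor_boundaries_def)
      have "lin_ext f w = lin_ext (\<lambda>b. const_part (lin_ext (\<phi> (Suc i)) (bd F i b))) c"
        by (simp add: c(2) f_def[abs_def] tensor_bd lin_ext_comp const_part_lin_ext)
      also have "\<dots> = lin_ext (\<lambda>b. const_part (lin_ext (D (Suc i)) (\<phi> (Suc (Suc i)) b))) c"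
        using c(1) \<phi>(3)[of _ "Suc i"] by (intro lin_ext_cong) (auto simp: tensor_mod_def)
      also have "\<dots> = lin_ext (\<lambda>b. const_part (D (Suc i) b)) (lin_ext (\<lambda>b. const_part (\<phi> (Suc (Suc i)) b)) c)"
        by (simp add: lin_ext_comp const_part_lin_ext)
      also have "\<dots> = 0"
      proof (rule DM)
        have "keys (lin_ext (\<lambda>b. const_part (\<phi> (Suc (Suc i)) b)) c) \<subseteq> {b \<in> B (Suc (Suc i)). deg b = j}"
          using c(1) \<phi>(1,2)[of _ "Suc (Suc i)"] by (intro keys_lin_ext_const_part) (auto simp: tensor_mod_def)
        then show "keys (lin_ext (\<lambda>b. const_part (\<phi> (Suc (Suc i)) b)) c) \<subseteq> B (Suc (Suc i))"
          by blast
      qed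
      finally show ?thesis .
    qed
    show "lin_ext f (g b) = single b 1" if "b \<in> {b \<in> B (Suc i). deg b = j}" for b
    proof -
      have b: "b \<in> B (Suc i)" using that by simp
      have "lin_ext f (g b) = const_part (lin_ext (\<phi> (Suc i)) (\<psi> (Suc i) b))"
        by (simp add: f_def[abs_def] g_def const_part_lin_ext)
      also have "lin_ext (\<phi> (Suc i)) (\<psi> (Suc i) b) =
          lin_ext (D (Suc i)) (t (Suc i) b) + single b 1 + lin_ext (t i) (D i b)"
        using t(3)[OF b] by (simp add: algebra_simps)
      also have "const_part \<dots> = single b 1"
      proof -
        have "const_part (lin_ext (D (Suc i)) (t (Suc i) b)) = 0"
          unfolding const_part_lin_ext
          by (rule DM) (use keys_const_part[OF t(1,2)[OF b]] in auto)
        \<comment> \<open>For \<open>i = 0\<close> this holds by \<open>t 0 = 0\<close>: minimality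
          does not cover the augmentation, which may have constant entries.\<close>
        moreover have "const_part (lin_ext (t i) (D i b)) = 0"
          using b minimal by (cases i) (simp_all add: t0 const_part_lin_ext)
        ultimately show ?thesis
          by (simp add: const_part_add const_part_single)
      qed
      finally show ?thesis .
    qed
    show "keys (lin_ext f z) \<subseteq> {b \<in> B (Suc i). deg b = j}" if "z \<in> tor_cycles F i j" for z
      unfolding f_def using that
      by (intro keys_lin_ext_const_part[OF \<phi>(1,2)]) (auto simp: tor_cycles_def tensor_mod_def)
    show "z - lin_ext g (lin_ext f z) \<in> tor_boundaries F i j" if z: "z \<in> tor_cycles F i j" for z
    proof -
      have keys: "keys z \<subseteq> {b \<in> ?FB (Suc i). fst b = j}"
        using z by (auto simp: tor_cycles_def tensor_mod_def)
      \<comment> \<open>The reduced homotopy turns \<open>z\<close> into the bounding chain, up to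
        sign. Its boundary is \<open>g (f z) - z\<close>, because the other homotopy term vanishes:
        for positive \<open>i\<close> since \<open>z\<close> is a cycle, for \<open>i = 0\<close>
        since \<open>s 0\<close> is zero.\<close>
      define w where "w = lin_ext (\<lambda>b. const_part (s (Suc i) b)) z"
      have w: "w \<in> tensor_mod F (Suc i) j"
        unfolding w_def tensor_mod_def mem_Collect_eq
        using keys s(1,2)[of _ "Suc i"] by (intro keys_lin_ext_const_part) auto
      have "tensor_bd F i w = lin_ext (\<lambda>b. const_part (lin_ext (?FD (Suc i)) (s (Suc i) b))) z"
        by (simp add: w_def tensor_bd lin_ext_comp const_part_lin_ext)
      also have "\<dots> = lin_ext (\<lambda>b. lin_ext g (f b) - single b 1 -
          lin_ext (\<lambda>b. const_part (s i b)) (const_part (?FD i b))) z"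
      proof (rule lin_ext_cong)
        fix b assume "b \<in> keys z"
        then have "b \<in> ?FB (Suc i)" using keys by blast
        from s(3)[OF this] show "const_part (lin_ext (?FD (Suc i)) (s (Suc i) b)) =
            lin_ext g (f b) - single b 1 - lin_ext (\<lambda>b. const_part (s i b)) (const_part (?FD i b))"
          by (simp add: const_part_diff const_part_single f_def g_def[abs_def] flip: const_part_lin_ext)
      qed
      also have "\<dots> = lin_ext g (lin_ext f z) - z -
          lin_ext (\<lambda>b. const_part (s i b)) (lin_ext (\<lambda>b. const_part (?FD i b)) z)"
        by (simp add: lin_ext_fun_diff lin_ext_comp)
      also have "lin_ext (\<lambda>b. const_part (s i b)) (lin_ext (\<lambda>b. const_part (?FD i b)) z) = 0"
      proof (cases i)
        case 0
        then show ?thesis by (simp add: s0)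
      next
        case (Suc l)
        then have "tensor_bd F l z = 0"
          using z by (simp add: tor_cycles_def)
        then show ?thesis using Suc by (simp add: tensor_bd)
      qed
      finally have "z - lin_ext g (lin_ext f z) = tensor_bd F i (- w)"
        by (simp add: tensor_bd lin_ext.neg)
      moreover have "- w \<in> tensor_mod F (Suc i) j"
        using w by (simp add: tensor_mod_def)
      ultimately show ?thesis
        by (auto simp: tor_boundaries_def)
    qed
  qed
  then show ?thesis .
qed

text \<open>\<open>F\<close> only witnesses that a resolution exists, so that the one selected in
  \<open>betti\<close> is a resolution; \<open>tor_dim_minimal\<close> gives the same count for
  every resolution.\<close>

theorem betti_minimal:
  fixes F :: "'a::field free_cplx"
  assumes "graded_free_resolution V I F"
    and "graded_res V I B deg D e"
    and "\<And>i b. b \<in> B (Suc (Suc i)) \<Longrightarrow> const_part (D (Suc i) b) = 0"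
    and "finite {b \<in> B (Suc i). deg b = j}"
  shows "betti V I i j = card {b \<in> B (Suc i). deg b = j}"
  using tor_dim_minimal[OF someI[of "graded_free_resolution V I", OF assms(1)] assms(2-4)]
  by (simp add: betti_def Let_def)

section \<open>Minimal resolutions\<close>

text \<open>The field acts through constant polynomials. In this vector space structure the
  complements are chosen that yield minimal generators.\<close>

definition kscale :: "'a::field \<Rightarrow> ('b \<Rightarrow>\<^sub>0 'a mpol) \<Rightarrow> ('b \<Rightarrow>\<^sub>0 'a mpol)" where
  "kscale c u = scale (single 0 c) u"

interpretation kvec: vector_space "kscale :: 'a::field \<Rightarrow> ('b \<Rightarrow>\<^sub>0 'a mpol) \<Rightarrow> ('b \<Rightarrow>\<^sub>0 'a mpol)"
  by unfold_locales (simp_all add: kscale_def scale.scale_right_distrib single_add scale.scale_left_distrib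
      mult_single)

lemma hvec_kscale: "hvec deg j u \<Longrightarrow> hvec deg j (kscale c u)"
  using hvec_scale[of 0 "single 0 c" deg j u] by (simp add: kscale_def homogeneous_single)

lemma finite_monomials:
  assumes "finite V"
  shows "finite {m :: nat \<Rightarrow>\<^sub>0 nat. keys m \<subseteq> V \<and> mdeg m = e}"
proof (rule finite_imageD[of lookup])
  have le: "lookup m v \<le> mdeg m" for m v
  proof (cases "v \<in> keys m")
    case True
    then show ?thesis
      unfolding mdeg_def by (rule member_le_sum) auto
  qed (simp add: in_keys_iff)
  have zero: "lookup m v = 0" if "keys m \<subseteq> V" "v \<notin> V" for m :: "nat \<Rightarrow>\<^sub>0 nat" and v
    using that by (meson in_keys_iff subsetD)
  have "lookup ` {m :: nat \<Rightarrow>\<^sub>0 nat. keys m \<subseteq> V \<and> mdeg m = e} \<subseteq>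
      {f. \<forall>x. (x \<in> V \<longrightarrow> f x \<in> {..e}) \<and> (x \<notin> V \<longrightarrow> f x = 0)}"
  proof (intro image_subsetI CollectI allI)
    fix m :: "nat \<Rightarrow>\<^sub>0 nat" and x
    assume "m \<in> {m. keys m \<subseteq> V \<and> mdeg m = e}"
    then show "(x \<in> V \<longrightarrow> lookup m x \<in> {..e}) \<and> (x \<notin> V \<longrightarrow> lookup m x = 0)"
      using le[of m x] zero[of m x] by simp
  qed
  then show "finite (lookup ` {m :: nat \<Rightarrow>\<^sub>0 nat. keys m \<subseteq> V \<and> mdeg m = e})"
    by (rule finite_subset) (intro finite_set_of_finite_funs assms finite_atMost)
  show "inj_on lookup {m :: nat \<Rightarrow>\<^sub>0 nat. keys m \<subseteq> V \<and> mdeg m = e}"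
    by (rule inj_onI) (simp only: lookup_inject)
qed

text \<open>Monomials times basis elements span, and only basis elements of degree at most
  \<open>j\<close> take part. This bounds the number of minimal generators in each degree.\<close>

lemma finite_span_hvec:
  fixes B :: "'b set"
  assumes "finite V" "\<And>i. finite {b \<in> B. deg b = i}"
  obtains T :: "('b \<Rightarrow>\<^sub>0 'a::field mpol) set" where "finite T"
    "{u \<in> free_on V B. hvec deg j u} \<subseteq> kvec.span T"
proof
  let ?K = "\<Union>i\<le>j. {b \<in> B. deg b = i} \<times> {m. keys m \<subseteq> V \<and> mdeg m = j - i}"
  let ?T = "(\<lambda>(b, m). single b (single m (1 :: 'a))) ` ?K"
  show "finite ?T"
    using assms by (intro finite_imageI finite_UN_I finite_cartesian_product finite_monomials) auto
  show "{u \<in> free_on V B. hvec deg j u} \<subseteq> kvec.span ?T"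
  proof
    fix u :: "'b \<Rightarrow>\<^sub>0 'a mpol" assume "u \<in> {u \<in> free_on V B. hvec deg j u}"
    then have u: "u \<in> free_on V B" "hvec deg j u" by auto
    have "single b (lookup u b) \<in> kvec.span ?T" if b: "b \<in> keys u" for b
    proof -
      have "b \<in> B" "lookup u b \<in> polys V" "deg b \<le> j" "homogeneous (j - deg b) (lookup u b)"
        using u b by (auto simp: free_on_def hvec_def)
      then have "(b, m) \<in> ?K" if "m \<in> keys (lookup u b)" for m
        using that by (auto simp: poly_ring_carrier homogeneous_iff)
      then have mem: "single b (single m 1) \<in> kvec.span ?T" if "m \<in> keys (lookup u b)" for m
        using that by (intro kvec.span_base image_eqI[of _ _ "(b, m)"]) auto
      have "single b (lookup u b) = (\<Sum>m\<in>keys (lookup u b). single b (single m (lookup (lookup u b) m)))"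
        by (subst single_sum_keys[of "lookup u b"], rule poly_mapping_eqI)
          (auto simp: lookup_sum lookup_single when_def)
      also have "\<dots> = (\<Sum>m\<in>keys (lookup u b). kscale (lookup (lookup u b) m) (single b (single m 1)))"
        by (simp add: kscale_def scale_single mult_single)
      also have "\<dots> \<in> kvec.span ?T"
        by (intro kvec.span_sum kvec.span_scale mem)
      finally show ?thesis .
    qed
    then show "u \<in> kvec.span ?T"
      by (subst single_sum_keys) (rule kvec.span_sum)
  qed
qed

definition graded_submodule ::
  "nat set \<Rightarrow> ('b \<Rightarrow> nat) \<Rightarrow> ('b \<Rightarrow>\<^sub>0 'a::field mpol) set \<Rightarrow> bool" where
  "graded_submodule V deg Z \<longleftrightarrow> 0 \<in> Z \<and> (\<forall>u\<in>Z. \<forall>v\<in>Z. u + v \<in> Z) \<and>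
    (\<forall>p\<in>polys V. \<forall>u\<in>Z. scale p u \<in> Z) \<and> (\<forall>u\<in>Z. \<forall>j. vcomp deg j u \<in> Z)"

lemma submodule_sum:
  assumes "graded_submodule V deg Z" "\<And>x. x \<in> A \<Longrightarrow> f x \<in> Z"
  shows "sum f A \<in> Z"
  using assms(2)
  by (induction A rule: infinite_finite_induct) (use assms(1) in \<open>auto simp: graded_submodule_def\<close>)

definition index_set :: "(nat \<Rightarrow> nat) \<Rightarrow> (nat \<times> nat) set" where
  "index_set g = {(j, a). a < g j}"

text \<open>
  In degree \<open>j\<close> the minimal generators form a basis of a complement of the elements generated in
  lower degrees. Independence modulo those elements is the last claim: no relation has
  a nonzero constant coefficient.
\<close>

lemma minimal_generators:
  fixes Z :: "('b \<Rightarrow>\<^sub>0 'a::field mpol) set"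
  assumes V: "finite V" and B: "\<And>j. finite {b \<in> B. deg b = j}"
    and Z: "graded_submodule V deg Z" "Z \<subseteq> free_on V B"
  obtains g D where "\<And>b. b \<in> index_set g \<Longrightarrow> D b \<in> Z"
    "\<And>b. b \<in> index_set g \<Longrightarrow> hvec deg (fst b) (D b)"
    "lin_ext D ` free_on V (index_set g) = Z"
    "\<And>u j. u \<in> free_on V (index_set g) \<Longrightarrow> hvec fst j u \<Longrightarrow> lin_ext D u = 0 \<Longrightarrow> const_part u = 0"
proof -
  have Z0: "0 \<in> Z" and Zadd: "\<And>u v. u \<in> Z \<Longrightarrow> v \<in> Z \<Longrightarrow> u + v \<in> Z"
    and Zscale: "\<And>p u. p \<in> polys V \<Longrightarrow> u \<in> Z \<Longrightarrow> scale p u \<in> Z"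
    and Zcomp: "\<And>j u. u \<in> Z \<Longrightarrow> vcomp deg j u \<in> Z"
    using Z(1) by (auto simp: graded_submodule_def)
  define Zd where "Zd j = {u \<in> Z. hvec deg j u}" for j
  \<comment> \<open>Here the vectors themselves serve as basis elements, so that
    \<open>lin_ext\<close> of the identity sums them up; its image is the submodule generated by the
    elements of lower degree.\<close>
  define W where "W j = Zd j \<inter> lin_ext (\<lambda>x. x) ` free_on V (\<Union>i<j. Zd i)" for j
  have Zd_kscale: "kscale c u \<in> Zd j" if "u \<in> Zd j" for c u j
    using that Zscale[of "single 0 c" u] hvec_kscale[of deg j u c] by (simp add: Zd_def kscale_def)
  have Zd_add: "u + v \<in> Zd j" if "u \<in> Zd j" "v \<in> Zd j" for u v j
    using that by (auto simp: Zd_def Zadd hvec_add)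
  have Zd_sub: "kvec.subspace (Zd j)" for j
    by (rule kvec.subspaceI) (auto simp: Zd_kscale Zd_add, simp add: Zd_def Z0)
  have "\<exists>A E. kvec.independent (A \<union> E) \<and> A \<inter> E = {} \<and> finite E \<and> A \<subseteq> W j \<and> W j \<subseteq> kvec.span A \<and>
      E \<subseteq> Zd j \<and> Zd j \<subseteq> kvec.span (A \<union> E)" for j
  proof -
    obtain A where A: "A \<subseteq> W j" "kvec.independent A" "W j \<subseteq> kvec.span A"
      using kvec.maximal_independent_subset by blast
    have "A \<subseteq> Zd j"
      using A(1) by (auto simp: W_def)
    then obtain C where C: "A \<subseteq> C" "C \<subseteq> Zd j" "kvec.independent C" "Zd j \<subseteq> kvec.span C"
      using kvec.maximal_independent_subset_extend[OF _ A(2)] by blast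
    obtain T :: "('b \<Rightarrow>\<^sub>0 'a mpol) set" where T: "finite T" "{u \<in> free_on V B. hvec deg j u} \<subseteq> kvec.span T"
      using finite_span_hvec[OF V B] by blast
    have "C \<subseteq> kvec.span T"
      using C(2) T(2) Z(2) by (auto simp: Zd_def)
    then have "finite C"
      using kvec.independent_span_bound[OF T(1) C(3)] by blast
    then show ?thesis
      using A C by (intro exI[of _ A] exI[of _ "C - A"]) (auto simp: Un_absorb1)
  qed
  then obtain A E where AE: "\<And>j. kvec.independent (A j \<union> E j)" "\<And>j. A j \<inter> E j = {}"
    "\<And>j. finite (E j)" "\<And>j. A j \<subseteq> W j" "\<And>j. W j \<subseteq> kvec.span (A j)" "\<And>j. E j \<subseteq> Zd j"
    "\<And>j. Zd j \<subseteq> kvec.span (A j \<union> E j)"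
    by metis
  have "\<exists>h. bij_betw h {0..<card (E j)} (E j)" for j
    by (rule ex_bij_betw_nat_finite[OF AE(3)])
  then obtain h where h: "\<And>j. bij_betw (h j) {0..<card (E j)} (E j)"
    by metis
  define g where "g j = card (E j)" for j
  define D where "D b = h (fst b) (snd b)" for b
  have D_E: "D b \<in> E (fst b)" if "b \<in> index_set g" for b
    using that bij_betwE[OF h[of "fst b"]] by (auto simp: D_def index_set_def g_def)
  have D_Zd: "D b \<in> Zd (fst b)" if "b \<in> index_set g" for b
    using D_E[OF that] AE(6) by blast
  define Im where "Im = lin_ext D ` free_on V (index_set g)"
  have Im_add: "x + y \<in> Im" if xy: "x \<in> Im" "y \<in> Im" for x y
  proof -
    obtain u v where "u \<in> free_on V (index_set g)" "x = lin_ext D u"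
      "v \<in> free_on V (index_set g)" "y = lin_ext D v"
      using xy by (auto simp: Im_def)
    then show ?thesis
      unfolding Im_def by (intro image_eqI[of _ _ "u + v"]) (auto simp: lin_ext_add free_on_add)
  qed
  have Im_scale: "scale p x \<in> Im" if px: "p \<in> polys V" "x \<in> Im" for p x
  proof -
    obtain u where "u \<in> free_on V (index_set g)" "x = lin_ext D u"
      using px by (auto simp: Im_def)
    then show ?thesis
      using px unfolding Im_def by (intro image_eqI[of _ _ "scale p u"]) (auto simp: lin_ext_scale free_on_scale)
  qed
  have Im_0: "0 \<in> Im"
    unfolding Im_def by (intro image_eqI[of _ _ 0]) auto
  have Im_sum: "sum f X \<in> Im" if "\<And>x. x \<in> X \<Longrightarrow> f x \<in> Im" for f and X :: "'x set"
    using that by (induction X rule: infinite_finite_induct) (auto intro: Im_add Im_0)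
  have Im_sub: "kvec.subspace Im"
    by (rule kvec.subspaceI) (auto simp: kscale_def intro: Im_0 Im_add Im_scale)
  \<comment> \<open>By induction on the degree: elements of \<open>E j\<close> are generators, and
    elements of \<open>A j\<close> are combinations of elements of lower degree, which are already
    in the image.\<close>
  have Zd_Im: "Zd j \<subseteq> Im" for j
  proof (induction j rule: less_induct)
    case (less j)
    have "A j \<union> E j \<subseteq> Im"
    proof
      fix x assume x: "x \<in> A j \<union> E j"
      show "x \<in> Im"
      proof (cases "x \<in> E j")
        case True
        then have "x \<in> h j ` {0..<card (E j)}"
          using bij_betw_imp_surj_on[OF h[of j]] by simp
        then obtain a where "a < g j" "x = h j a"
          by (auto simp: g_def)
        then show ?thesis
          unfolding Im_def
          by (intro image_eqI[of _ _ "single (j, a) 1"] free_on_single) (auto simp: D_def index_set_def)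
      next
        case False
        then have "x \<in> lin_ext (\<lambda>x. x) ` free_on V (\<Union>i<j. Zd i)"
          using x AE(4)[of j] by (auto simp: W_def)
        then obtain u where u: "u \<in> free_on V (\<Union>i<j. Zd i)" "x = lin_ext (\<lambda>x. x) u"
          by blast
        have "(\<Union>i<j. Zd i) \<subseteq> Im"
          using less by (intro UN_least) simp
        then have "keys u \<subseteq> Im" "\<And>b. lookup u b \<in> polys V"
          using u(1) by (auto simp: free_on_def)
        then show ?thesis
          unfolding u(2) lin_ext_def by (intro Im_sum Im_scale) auto
      qed
    qed
    then show ?case
      using AE(7)[of j] kvec.span_minimal[OF _ Im_sub] by blast
  qed
  show thesis
  proof (rule that[of g D])
    show "D b \<in> Z" "hvec deg (fst b) (D b)" if "b \<in> index_set g" for b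
      using D_Zd[OF that] by (auto simp: Zd_def)
    have "Im \<subseteq> Z"
    proof
      fix x assume "x \<in> Im"
      then obtain u where u: "u \<in> free_on V (index_set g)" "x = lin_ext D u"
        by (auto simp: Im_def)
      then show "x \<in> Z"
        unfolding u(2) lin_ext_def
        using D_Zd by (intro submodule_sum[OF Z(1)] Zscale) (auto simp: free_on_def Zd_def)
    qed
    moreover have "Z \<subseteq> Im"
    proof
      fix z assume z: "z \<in> Z"
      obtain N where N: "z = (\<Sum>j<N. vcomp deg j z)"
        using sum_vcomp by blast
      have "vcomp deg j z \<in> Im" for j
        using Zd_Im[of j] Zcomp[OF z, of j] by (auto simp: Zd_def)
      then show "z \<in> Im"
        by (subst N) (rule Im_sum)
    qed
    ultimately show "lin_ext D ` free_on V (index_set g) = Z"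
      by (simp add: Im_def)
  next
    fix u j assume u: "u \<in> free_on V (index_set g)" "hvec fst j u" "lin_ext D u = 0"
    have keys_u: "b \<in> index_set g" "fst b \<le> j" "homogeneous (j - fst b) (lookup u b)" if "b \<in> keys u" for b
      using u(1,2) that by (auto simp: free_on_def hvec_def)
    \<comment> \<open>In a relation of degree \<open>j\<close> the generators of degree
      \<open>j\<close> (\<open>K1\<close>) have constant coefficients, and the other terms
      (\<open>K2\<close>) come from lower degrees. So the sum over \<open>K1\<close> lies in
      \<open>W j\<close>, and independence of \<open>E j\<close> modulo \<open>A j\<close> forces
      its coefficients to vanish.\<close>
    define K1 where "K1 = {b \<in> keys u. fst b = j}"
    define K2 where "K2 = {b \<in> keys u. fst b < j}"
    define c where "c b = const_coeff (lookup u b)" for b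
    have fin: "finite K1" "finite K2" and "keys u = K1 \<union> K2" "K1 \<inter> K2 = {}"
      using keys_u(2) by (auto simp: K1_def K2_def le_less)
    then have "lin_ext D u = (\<Sum>b\<in>K1. scale (lookup u b) (D b)) + (\<Sum>b\<in>K2. scale (lookup u b) (D b))"
      by (simp add: lin_ext_def sum.union_disjoint)
    moreover have "scale (lookup u b) (D b) = kscale (c b) (D b)" if "b \<in> K1" for b
      using homogeneous_0_const[of "lookup u b"] keys_u(3)[of b] that by (simp add: K1_def kscale_def c_def)
    ultimately have sum: "(\<Sum>b\<in>K1. kscale (c b) (D b)) = - (\<Sum>b\<in>K2. scale (lookup u b) (D b))"
      using u(3) by (simp add: eq_neg_iff_add_eq_0)
    have "(\<Sum>b\<in>K1. kscale (c b) (D b)) \<in> Zd j"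
      by (intro kvec.subspace_sum[OF Zd_sub] Zd_kscale) (use D_Zd keys_u(1) in \<open>auto simp: K1_def\<close>)
    moreover have "(\<Sum>b\<in>K1. kscale (c b) (D b)) \<in> lin_ext (\<lambda>x. x) ` free_on V (\<Union>i<j. Zd i)"
    proof (rule image_eqI)
      show "(\<Sum>b\<in>K1. kscale (c b) (D b)) = lin_ext (\<lambda>x. x) (- (\<Sum>b\<in>K2. single (D b) (lookup u b)))"
        by (simp add: sum lin_ext.neg lin_ext.sum)
      show "- (\<Sum>b\<in>K2. single (D b) (lookup u b)) \<in> free_on V (\<Union>i<j. Zd i)"
      proof (intro free_on_uminus free_on_sum free_on_single)
        fix b assume "b \<in> K2"
        then have b: "b \<in> keys u" "fst b < j"
          by (auto simp: K2_def)
        show "D b \<in> (\<Union>i<j. Zd i)"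
          using D_Zd[OF keys_u(1)[OF b(1)]] b(2) by blast
        show "lookup u b \<in> polys V"
          using u(1) by (simp add: free_on_def del: split_paired_All)
      qed
    qed
    ultimately have W: "(\<Sum>b\<in>K1. kscale (c b) (D b)) \<in> kvec.span (A j)"
      using AE(5)[of j] by (auto simp: W_def)
    have D_inj: "b = b'" if "b \<in> K1" "b' \<in> K1" "D b = D b'" for b b'
    proof -
      have "fst b = j" "snd b < card (E j)" "fst b' = j" "snd b' < card (E j)"
        using keys_u(1)[of b] keys_u(1)[of b'] that by (auto simp: K1_def index_set_def g_def)
      then show ?thesis
        using inj_onD[OF bij_betw_imp_inj_on[OF h[of j]], of "snd b" "snd b'"] that(3)
        by (simp add: D_def prod_eq_iff)
    qed
    have c_0: "c b = 0" if b: "b \<in> K1" for b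
    proof (rule ccontr)
      assume "c b \<noteq> 0"
      let ?S = "(A j \<union> E j) - {D b}"
      have E: "D b' \<in> E j" if "b' \<in> K1" for b'
        using D_E[of b'] that keys_u(1) by (auto simp: K1_def)
      have "A j \<subseteq> ?S"
        using AE(2) E[OF b] by blast
      then have 1: "(\<Sum>b\<in>K1. kscale (c b) (D b)) \<in> kvec.span ?S"
        using W kvec.span_mono by blast
      have 2: "(\<Sum>b'\<in>K1 - {b}. kscale (c b') (D b')) \<in> kvec.span ?S"
        using E D_inj[OF _ b] by (intro kvec.span_sum kvec.span_scale) (rule kvec.span_base, auto)
      have "kscale (c b) (D b) = (\<Sum>b\<in>K1. kscale (c b) (D b)) - (\<Sum>b'\<in>K1 - {b}. kscale (c b') (D b'))"
        using fin(1) b by (simp add: sum.remove)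
      also have "\<dots> \<in> kvec.span ?S"
        by (intro kvec.span_diff 1 2)
      finally have "kscale (inverse (c b)) (kscale (c b) (D b)) \<in> kvec.span ?S"
        by (rule kvec.span_scale)
      then have "D b \<in> kvec.span ?S"
        using \<open>c b \<noteq> 0\<close> by simp
      then show False
        using AE(1)[of j] E[OF b] unfolding kvec.dependent_def by blast
    qed
    show "const_part u = 0"
    proof (rule poly_mapping_eqI)
      fix b
      show "lookup (const_part u) b = lookup 0 b"
      proof (cases "b \<in> keys u")
        case True
        then show ?thesis
          using c_0[of b] const_coeff_homogeneous[OF keys_u(3)[OF True]] keys_u(2)[OF True]
          by (cases "fst b = j") (auto simp: K1_def c_def)
      qed (simp add: in_keys_iff)
    qed
  qed
qed


section \<open>Existence of minimal resolutions\<close>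

definition graded_ideal :: "nat set \<Rightarrow> 'a::field mpol set \<Rightarrow> bool" where
  "graded_ideal V I \<longleftrightarrow> I \<subseteq> polys V \<and> 0 \<in> I \<and> (\<forall>p\<in>I. \<forall>q\<in>I. p + q \<in> I) \<and>
    (\<forall>c\<in>polys V. \<forall>p\<in>I. c * p \<in> I) \<and> (\<forall>p\<in>I. \<forall>j. hcomp j p \<in> I)"

text \<open>Minimal generators are chosen for the ideal and then for each kernel in turn. Minimality
  of a differential is due to the choice before it: its values on basis elements are homogeneous
  relations among minimal generators, so they have no constant coefficients.\<close>

theorem minimal_resolution_exists:
  fixes I :: "'a::field mpol set"
  assumes V: "finite V" and I: "graded_ideal V I"
  obtains F where "graded_free_resolution V I F"
    "\<And>i b. b \<in> basis F (Suc i) \<Longrightarrow> const_part (bd F i b) = 0"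
proof -
  \<comment> \<open>A state consists of the ambient basis, the submodule to be covered, the numbers
    of generators and the covering map; \<open>Q\<close> below makes the kernel of that map the next
    submodule.\<close>
  define P :: "nat \<Rightarrow> (nat \<times> nat) set \<times> (nat \<times> nat \<Rightarrow>\<^sub>0 'a mpol) set \<times> (nat \<Rightarrow> nat) \<times>
      (nat \<times> nat \<Rightarrow> (nat \<times> nat \<Rightarrow>\<^sub>0 'a mpol)) \<Rightarrow> bool" where
    "P n = (\<lambda>(B, Z, g, D). (n = 0 \<longrightarrow> B = {(0, 0)} \<and> Z = single (0, 0) ` I) \<and>
      Z \<subseteq> free_on V B \<and>
      (\<forall>b\<in>index_set g. D b \<in> Z \<and> hvec fst (fst b) (D b)) \<and>
      lin_ext D ` free_on V (index_set g) = Z \<and>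
      (\<forall>u j. u \<in> free_on V (index_set g) \<longrightarrow> hvec fst j u \<longrightarrow> lin_ext D u = 0 \<longrightarrow> const_part u = 0))"
    for n
  define Q :: "nat \<Rightarrow> (nat \<times> nat) set \<times> (nat \<times> nat \<Rightarrow>\<^sub>0 'a mpol) set \<times> (nat \<Rightarrow> nat) \<times>
      (nat \<times> nat \<Rightarrow> (nat \<times> nat \<Rightarrow>\<^sub>0 'a mpol)) \<Rightarrow>
      (nat \<times> nat) set \<times> (nat \<times> nat \<Rightarrow>\<^sub>0 'a mpol) set \<times> (nat \<Rightarrow> nat) \<times>
      (nat \<times> nat \<Rightarrow> (nat \<times> nat \<Rightarrow>\<^sub>0 'a mpol)) \<Rightarrow> bool" where
    "Q n = (\<lambda>(B, Z, g, D) (B', Z', g', D'). B' = index_set g \<and>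
      Z' = {u \<in> free_on V (index_set g). lin_ext D u = 0})" for n
  have step: "\<exists>g D. P n (B, Z, g, D)"
    if BZ: "n = 0 \<longrightarrow> B = {(0, 0)} \<and> Z = single (0, 0) ` I"
      "\<And>j. finite {b \<in> B. fst b = j}" "graded_submodule V fst Z" "Z \<subseteq> free_on V B"
    for n and B and Z :: "(nat \<times> nat \<Rightarrow>\<^sub>0 'a mpol) set"
  proof -
    obtain g D where "\<And>b. b \<in> index_set g \<Longrightarrow> D b \<in> Z"
      "\<And>b. b \<in> index_set g \<Longrightarrow> hvec fst (fst b) (D b)"
      "lin_ext D ` free_on V (index_set g) = Z"
      "\<And>u j. u \<in> free_on V (index_set g) \<Longrightarrow> hvec fst j u \<Longrightarrow> lin_ext D u = 0 \<Longrightarrow> const_part u = 0"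
      using minimal_generators[OF V BZ(2-4)] by blast
    with BZ show ?thesis
      unfolding P_def by blast
  qed
  have "\<exists>f. \<forall>n. P n (f n) \<and> Q n (f n) (f (Suc n))"
  proof (rule dependent_nat_choice)
    have "graded_submodule V fst (single (0 :: nat, 0 :: nat) ` I)"
    proof -
      have "vcomp fst j (single (0 :: nat, 0 :: nat) p) = single (0, 0) (hcomp j p)" for j and p :: "'a mpol"
        by (rule poly_mapping_eqI) (auto simp: lookup_vcomp lookup_single when_def)
      then show ?thesis
        using I by (auto simp: graded_submodule_def graded_ideal_def scale_single
            simp flip: single_add intro!: image_eqI[of 0 _ 0])
    qed
    moreover have "single (0 :: nat, 0 :: nat) ` I \<subseteq> free_on V {(0, 0)}"
      using I by (auto simp: graded_ideal_def intro!: free_on_single)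
    ultimately have "\<exists>g D. P 0 ({(0, 0)}, single (0, 0) ` I, g, D)"
      by (intro step) auto
    then show "\<exists>x. P 0 x"
      by blast
  next
    fix x n assume P: "P n x"
    obtain B Z g D where x: "x = (B, Z, g, D)"
      by (metis prod_cases4)
    let ?Z = "{u \<in> free_on V (index_set g). lin_ext D u = 0}"
    have "finite {b \<in> index_set g. fst b = j}" for j
    proof (rule finite_subset)
      show "{b \<in> index_set g. fst b = j} \<subseteq> {j} \<times> {..<g j}"
        by (auto simp: index_set_def)
    qed simp
    moreover have "graded_submodule V fst ?Z"
    proof -
      have "lin_ext D (vcomp fst j u) = 0" if "u \<in> ?Z" for u j
      proof -
        have "vcomp fst j (lin_ext D u) = lin_ext D (vcomp fst j u)"
          using that P x by (intro vcomp_lin_ext) (auto simp: P_def free_on_def)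
        then show ?thesis
          using that by (simp add: vcomp_hvec)
      qed
      then show ?thesis
        by (auto simp: graded_submodule_def lin_ext_add lin_ext_scale free_on_add free_on_scale vcomp_free_on)
    qed
    ultimately have "\<exists>g' D'. P (Suc n) (index_set g, ?Z, g', D')"
      by (intro step) auto
    then show "\<exists>y. P (Suc n) y \<and> Q n x y"
      by (auto simp: Q_def x)
  qed
  then obtain f where f: "\<And>n. P n (f n)" "\<And>n. Q n (f n) (f (Suc n))"
    by blast
  define B where "B n = fst (f n)" for n
  define Z where "Z n = fst (snd (f n))" for n
  define g where "g n = fst (snd (snd (f n)))" for n
  define D where "D n = snd (snd (snd (f n)))" for n
  have f_eq: "f n = (B n, Z n, g n, D n)" for n
    by (simp add: B_def Z_def g_def D_def)
  have zero: "B 0 = {(0, 0)}" "Z 0 = single (0, 0) ` I"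
    using f(1)[of 0] by (simp_all add: f_eq P_def)
  have rec: "B (Suc n) = index_set (g n)" "Z (Suc n) = {u \<in> free_on V (index_set (g n)). lin_ext (D n) u = 0}" for n
    using f(2)[of n] by (simp_all add: f_eq Q_def)
  have Z_free: "Z n \<subseteq> free_on V (B n)"
    and D: "\<And>b. b \<in> B (Suc n) \<Longrightarrow> D n b \<in> Z n" "\<And>b. b \<in> B (Suc n) \<Longrightarrow> hvec fst (fst b) (D n b)"
      "lin_ext (D n) ` free_on V (B (Suc n)) = Z n"
      "\<And>u j. u \<in> free_on V (B (Suc n)) \<Longrightarrow> hvec fst j u \<Longrightarrow> lin_ext (D n) u = 0 \<Longrightarrow> const_part u = 0" for n
    using f(1)[of n] by (simp_all add: f_eq P_def rec) blast
  define F where "F = \<lparr>gens = g, aug = (\<lambda>b. lookup (D 0 b) (0, 0)), bd = (\<lambda>i. D (Suc i))\<rparr>"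
  have basis: "aug_basis F n = B n" for n
    by (cases n) (auto simp: zero rec F_def basis_def index_set_def)
  \<comment> \<open>Off the basis \<open>D 0\<close> is unconstrained and may differ from
    \<open>aug_bd F 0\<close>. Hence the maps are compared on basis elements, and
    \<open>lin_ext_cong_free\<close> transfers the equality.\<close>
  have bd: "aug_bd F n b = D n b" if b: "b \<in> B (Suc n)" for n b
  proof (cases n)
    case 0
    with D(1)[of b 0] b obtain p where "D 0 b = single (0, 0) p"
      by (auto simp: zero)
    with 0 show ?thesis
      by (simp add: F_def)
  qed (simp add: F_def)
  have cycles: "cycles V I (aug_basis F) (aug_bd F) (0, 0) n = Z n" for n
  proof (cases n)
    case (Suc m)
    have "lin_ext (aug_bd F m) u = lin_ext (D m) u" if "u \<in> free_on V (B (Suc m))" for u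
      by (rule lin_ext_cong_free[OF that bd])
    then show ?thesis
      unfolding Suc cycles_simps(2) basis by (auto simp: rec)
  qed (simp add: zero)
  have "graded_res V I (aug_basis F) fst (aug_bd F) (0, 0)"
  proof
    show "lin_ext (aug_bd F i) ` free_on V (aug_basis F (Suc i)) = cycles V I (aug_basis F) (aug_bd F) (0, 0) i" for i
      unfolding cycles basis D(3)[symmetric]
      by (intro image_cong refl) (rule lin_ext_cong_free, assumption, rule bd)
    fix i b assume "b \<in> aug_basis F (Suc i)"
    then have b: "b \<in> B (Suc i)"
      by (simp only: basis)
    show "aug_bd F i b \<in> free_on V (aug_basis F i)" "hvec fst (fst b) (aug_bd F i b)"
      unfolding bd[OF b] basis using D(1,2)[OF b] Z_free by auto
  qed simp_all
  then show thesis
  proof (rule that[of F, unfolded graded_free_resolution_iff])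
    fix i b assume "b \<in> basis F (Suc i)"
    then have "b \<in> B (Suc (Suc i))"
      using basis[of "Suc (Suc i)"] by simp
    from D(1,2)[OF this] have "D (Suc i) b \<in> free_on V (B (Suc i))" "lin_ext (D i) (D (Suc i) b) = 0"
      "hvec fst (fst b) (D (Suc i) b)"
      by (auto simp: rec)
    then show "const_part (bd F i b) = 0"
      using D(4)[of "D (Suc i) b" i "fst b"] by (simp add: F_def)
  qed
qed

section \<open>Ideals\<close>

abbreviation idl :: "nat set \<Rightarrow> 'a::field mpol set \<Rightarrow> 'a mpol set" where
  "idl V S \<equiv> genideal (poly_ring V) S"

lemma ring_poly_ring: "ring (poly_ring V :: 'a::field mpol ring)"
  using cring_poly_ring by (rule cring.axioms)

lemma ideal_poly_ringI:
  fixes J :: "'a::field mpol set"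
  assumes "J \<subseteq> polys V" "0 \<in> J" "\<And>p q. p \<in> J \<Longrightarrow> q \<in> J \<Longrightarrow> p + q \<in> J"
    "\<And>c p. c \<in> polys V \<Longrightarrow> p \<in> J \<Longrightarrow> c * p \<in> J"
  shows "ideal J (poly_ring V)"
proof (rule idealI[OF ring_poly_ring])
  interpret cring "poly_ring V" by (rule cring_poly_ring)
  show "subgroup J (add_monoid (poly_ring V))"
  proof (rule add.subgroupI)
    fix p assume "p \<in> J"
    have "\<ominus>\<^bsub>poly_ring V\<^esub> p = - 1 * p"
      by (rule minus_equality) (use \<open>p \<in> J\<close> assms(1) in \<open>auto simp: poly_ring_carrier subset_iff\<close>)
    then show "\<ominus>\<^bsub>poly_ring V\<^esub> p \<in> J"
      using assms(4)[of "- 1" p] \<open>p \<in> J\<close> polys_uminus[of 1 V] by simp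
  qed (use assms in auto)
next
  fix a x :: "'a mpol" assume "a \<in> J" "x \<in> carrier (poly_ring V)"
  then show "x \<otimes>\<^bsub>poly_ring V\<^esub> a \<in> J" "a \<otimes>\<^bsub>poly_ring V\<^esub> x \<in> J"
    using assms(4)[of x a] by (simp_all add: mult.commute[of a x])
qed

lemma ideal_poly_ringD:
  assumes "ideal J (poly_ring V)"
  shows "J \<subseteq> polys V" "0 \<in> J" "p \<in> J \<Longrightarrow> q \<in> J \<Longrightarrow> p + q \<in> J" "c \<in> polys V \<Longrightarrow> p \<in> J \<Longrightarrow> c * p \<in> J"
proof -
  interpret ideal J "poly_ring V" by fact
  show "J \<subseteq> polys V"
    using a_subset by simp
  show "0 \<in> J" "p \<in> J \<Longrightarrow> q \<in> J \<Longrightarrow> p + q \<in> J" "c \<in> polys V \<Longrightarrow> p \<in> J \<Longrightarrow> c * p \<in> J"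
    using additive_subgroup.zero_closed[OF is_additive_subgroup] I_l_closed[of p c]
      additive_subgroup.a_closed[OF is_additive_subgroup, of p q] by auto
qed

lemma ideal_sum: "ideal J (poly_ring V) \<Longrightarrow> (\<And>x. x \<in> A \<Longrightarrow> f x \<in> J) \<Longrightarrow> sum f A \<in> J"
  by (induction A rule: infinite_finite_induct) (auto dest: ideal_poly_ringD)

lemma idl_ideal: "S \<subseteq> polys V \<Longrightarrow> ideal (idl V S) (poly_ring V)"
  by (rule ring.genideal_ideal[OF ring_poly_ring])

lemma idl_self: "S \<subseteq> polys V \<Longrightarrow> S \<subseteq> idl V S"
  by (rule ring.genideal_self[OF ring_poly_ring])

lemma idl_minimal: "ideal J (poly_ring V) \<Longrightarrow> S \<subseteq> J \<Longrightarrow> idl V S \<subseteq> J"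
  by (rule ring.genideal_minimal[OF ring_poly_ring])

lemma idl_polys: "S \<subseteq> polys V \<Longrightarrow> idl V S \<subseteq> polys V"
  using ideal_poly_ringD(1)[OF idl_ideal] .

lemma ideal_restrict:
  assumes "ideal J (poly_ring W)" "V \<subseteq> W"
  shows "ideal (J \<inter> polys V) (poly_ring V)"
proof (rule ideal_poly_ringI)
  show "c * p \<in> J \<inter> polys V" if "c \<in> polys V" "p \<in> J \<inter> polys V" for c p
    using that ideal_poly_ringD(4)[OF assms(1), of c p] polys_mono[OF that(1) assms(2)] by (simp add: polys_mult)
qed (use ideal_poly_ringD(2,3)[OF assms(1)] in \<open>auto intro: polys_add\<close>)

text \<open>With \<open>idl_minimal\<close>, the colon ideal reduces a claim
  \<open>r * q \<in> J\<close> for all \<open>q\<close> in a generated ideal to the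
  generators.\<close>

lemma ideal_colon:
  assumes "ideal J (poly_ring W)" "r \<in> polys W"
  shows "ideal {q \<in> polys W. r * q \<in> J} (poly_ring W)"
  using ideal_poly_ringD[OF assms(1)]
  by (intro ideal_poly_ringI) (auto simp: distrib_left mult.left_commute intro: polys_add polys_mult)

lemma idl_idl:
  assumes "S \<subseteq> polys V" "V \<subseteq> W"
  shows "idl W (idl V S) = idl W S"
proof
  have SW: "S \<subseteq> polys W" and "idl V S \<subseteq> polys W"
    using assms idl_polys polys_mono by blast+
  have "idl V S \<subseteq> idl W S \<inter> polys V"
    using idl_self[OF SW] assms(1)
    by (intro idl_minimal[OF ideal_restrict[OF idl_ideal[OF SW] assms(2)]]) simp
  then show "idl W (idl V S) \<subseteq> idl W S"
    by (intro idl_minimal[OF idl_ideal[OF SW]]) auto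
  show "idl W S \<subseteq> idl W (idl V S)"
    using idl_self[OF \<open>idl V S \<subseteq> polys W\<close>] idl_self[OF assms(1)] \<open>idl V S \<subseteq> polys W\<close>
    by (intro idl_minimal[OF idl_ideal[OF \<open>idl V S \<subseteq> polys W\<close>]]) auto
qed

lemma idl_of_ideal: "ideal I (poly_ring V) \<Longrightarrow> idl V I = I"
  using idl_minimal[of I V I] idl_self[of I V] ideal_poly_ringD(1)[of I V] by blast

lemma graded_ideal_imp_ideal: "graded_ideal V I \<Longrightarrow> ideal I (poly_ring V)"
  by (rule ideal_poly_ringI) (auto simp: graded_ideal_def)

lemma graded_ideal_idl:
  fixes S :: "'a::field mpol set"
  assumes "S \<subseteq> polys V" "\<And>p. p \<in> S \<Longrightarrow> homogeneous d p"
  shows "graded_ideal V (idl V S)"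
proof -
  note I = ideal_poly_ringD[OF idl_ideal[OF assms(1)]]
  \<comment> \<open>Quantifying over all multiples \<open>c * p\<close> makes the set closed under
    multiplication by construction; the components of \<open>p\<close> itself are recovered at the
    end with \<open>c = 1\<close>.\<close>
  have "ideal {p \<in> idl V S. \<forall>c\<in>polys V. \<forall>j. hcomp j (c * p) \<in> idl V S} (poly_ring V)"
    using I by (intro ideal_poly_ringI)
      (auto simp: distrib_left hcomp_add mult.assoc[symmetric] intro: polys_mult)
  moreover have "S \<subseteq> {p \<in> idl V S. \<forall>c\<in>polys V. \<forall>j. hcomp j (c * p) \<in> idl V S}"
  proof (intro subsetI CollectI conjI ballI allI)
    fix p assume p: "p \<in> S"
    then show pI: "p \<in> idl V S"
      using idl_self[OF assms(1)] by blast
    fix c :: "'a mpol" and j assume c: "c \<in> polys V"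
    show "hcomp j (c * p) \<in> idl V S"
      using I(2) I(4)[OF hcomp_polys[OF c] pI] by (simp add: hcomp_mult[OF assms(2)[OF p]])
  qed
  ultimately have "idl V S \<subseteq> {p \<in> idl V S. \<forall>c\<in>polys V. \<forall>j. hcomp j (c * p) \<in> idl V S}"
    by (rule idl_minimal)
  then have "hcomp j (1 * p) \<in> idl V S" if "p \<in> idl V S" for j p
    using that polys_1[of V] by blast
  with I show ?thesis
    by (simp add: graded_ideal_def)
qed

section \<open>The ideal of an augmented resolution\<close>

context graded_res
begin

lemma aug_basis_elem:
  assumes "b \<in> B 1"
  obtains p where "D 0 b = single e p" "p \<in> I" "homogeneous (deg b) p"
proof -
  obtain p where p: "D 0 b = single e p" "p \<in> I"
    using D_cycles[of b 0] assms by auto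
  moreover have "homogeneous (deg b) p"
    using D_hvec[of b 0] assms p(1) by (cases "p = 0") (auto simp: hvec_def deg_e)
  ultimately show thesis
    by (rule that)
qed

lemma I_subset: "I \<subseteq> polys V"
proof
  fix p assume "p \<in> I"
  then have "single e p \<in> free_on V (B 0)"
    by (intro cycles_free) simp
  then show "p \<in> polys V"
    by (auto simp: free_on_def dest: spec[of _ e])
qed

text \<open>The ideal is the image of a degree-preserving map. In this way the ideal resolved by a
  cone qualifies for \<open>minimal_resolution_exists\<close>.\<close>

lemma graded_ideal: "graded_ideal V I"
proof -
  have mem: "p \<in> I \<longleftrightarrow> (\<exists>u\<in>free_on V (B 1). lin_ext (D 0) u = single e p)" for p
    using exact[of 0] by (auto simp: image_iff set_eq_iff) (metis inj_eq[OF inj_single])+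
  show ?thesis
    unfolding graded_ideal_def
  proof (intro conjI ballI allI)
    show "I \<subseteq> polys V" by (rule I_subset)
    show "0 \<in> I"
      by (simp add: mem) (intro bexI[of _ 0], auto)
    fix p assume "p \<in> I"
    then obtain u where u: "u \<in> free_on V (B 1)" "lin_ext (D 0) u = single e p"
      by (auto simp: mem)
    {
      fix q assume "q \<in> I"
      then obtain v where v: "v \<in> free_on V (B 1)" "lin_ext (D 0) v = single e q"
        by (auto simp: mem)
      show "p + q \<in> I"
        unfolding mem using u v by (intro bexI[of _ "u + v"]) (auto simp: lin_ext_add single_add free_on_add)
    }
    {
      fix c :: "'a mpol" assume "c \<in> polys V"
      then show "c * p \<in> I"
        unfolding mem using u
        by (intro bexI[of _ "scale c u"]) (auto simp: lin_ext_scale scale_single free_on_scale)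
    }
    fix j
    have "vcomp deg j (single e p) = single e (hcomp j p)"
      by (rule poly_mapping_eqI) (auto simp: lookup_vcomp lookup_single when_def deg_e)
    then show "hcomp j p \<in> I"
      unfolding mem using u vcomp_D[of u 0 j]
      by (intro bexI[of _ "vcomp deg j u"]) (auto simp: vcomp_free_on)
  qed
qed

text \<open>Position 0 of the base change: the image over \<open>W\<close> is an ideal containing
  \<open>I\<close>, and it is spanned by values of the augmentation, which lie in
  \<open>I\<close>.\<close>

lemma image_aug_idl:
  assumes "V \<subseteq> W"
  shows "lin_ext (D 0) ` free_on W (B 1) = single e ` idl W I"
proof -
  have IW: "I \<subseteq> polys W"
    using I_subset polys_mono[OF _ assms] by blast
  note J = ideal_poly_ringD[OF idl_ideal[OF IW]]
  have img: "single e (\<Sum>b\<in>keys u. lookup u b * f b) = lin_ext (D 0) u" if "\<And>b. b \<in> keys u \<Longrightarrow> D 0 b = single e (f b)" for u f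
    by (subst lin_ext_single_basis[symmetric]) (rule lin_ext_cong, simp add: that)
  have "\<exists>p. D 0 b = single e p \<and> p \<in> I" if "b \<in> B 1" for b
    by (rule aug_basis_elem[OF that]) auto
  then obtain f where f: "\<And>b. b \<in> B 1 \<Longrightarrow> D 0 b = single e (f b)" "\<And>b. b \<in> B 1 \<Longrightarrow> f b \<in> I"
    by metis
  show ?thesis
  proof (intro equalityI subsetI)
    fix x assume "x \<in> lin_ext (D 0) ` free_on W (B 1)"
    then obtain u where u: "u \<in> free_on W (B 1)" "x = lin_ext (D 0) u"
      by blast
    have "(\<Sum>b\<in>keys u. lookup u b * f b) \<in> idl W I"
      using u(1) f(2) idl_self[OF IW]
      by (intro ideal_sum[OF idl_ideal[OF IW]] J(4)) (auto simp: free_on_def)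
    moreover have "x = single e (\<Sum>b\<in>keys u. lookup u b * f b)"
      unfolding u(2) using u(1) by (intro img[symmetric] f(1)) (auto simp: free_on_def)
    ultimately show "x \<in> single e ` idl W I"
      by blast
  next
    fix x assume "x \<in> single e ` idl W I"
    then obtain p where p: "p \<in> idl W I" "x = single e p" by blast
    let ?J = "{p \<in> polys W. single e p \<in> lin_ext (D 0) ` free_on W (B 1)}"
    have "ideal ?J (poly_ring W)"
    proof (rule ideal_poly_ringI)
      show "0 \<in> ?J"
        by (auto intro!: image_eqI[of _ _ 0])
      show "p + q \<in> ?J" if "p \<in> ?J" "q \<in> ?J" for p q
        using that by (auto simp: single_add polys_add free_on_add simp flip: lin_ext_add)
      show "c * p \<in> ?J" if "c \<in> polys W" "p \<in> ?J" for c p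
        using that by (auto simp: polys_mult free_on_scale simp flip: scale_single lin_ext_scale)
    qed auto
    moreover have "I \<subseteq> ?J"
      using exact[of 0] IW free_on_mono[OF assms] by (auto simp: image_iff set_eq_iff) blast
    ultimately have "p \<in> ?J"
      using idl_minimal p(1) by blast
    then show "x \<in> lin_ext (D 0) ` free_on W (B 1)"
      by (simp add: p(2))
  qed
qed

lemma generated_in_degree:
  assumes "\<And>b. b \<in> B 1 \<Longrightarrow> deg b = d"
  shows "I = idl V {p \<in> I. homogeneous d p}"
proof
  let ?S = "{p \<in> I. homogeneous d p}"
  have S: "?S \<subseteq> polys V"
    using I_subset by blast
  have "\<exists>p. D 0 b = single e p \<and> p \<in> ?S" if "b \<in> B 1" for b
    by (rule aug_basis_elem[OF that]) (use assms[OF that] in auto)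
  then obtain f where f: "\<And>b. b \<in> B 1 \<Longrightarrow> D 0 b = single e (f b)" "\<And>b. b \<in> B 1 \<Longrightarrow> f b \<in> ?S"
    by metis
  show "I \<subseteq> idl V ?S"
  proof
    fix p assume "p \<in> I"
    then have "single e p \<in> lin_ext (D 0) ` free_on V (B 1)"
      using exact[of 0] by auto
    then obtain u where u: "u \<in> free_on V (B 1)" "single e p = lin_ext (D 0) u"
      by blast
    have "lin_ext (D 0) u = lin_ext (\<lambda>b. single e (f b)) u"
      by (rule lin_ext_cong_free[OF u(1) f(1)])
    then have "p = (\<Sum>b\<in>keys u. lookup u b * f b)"
      using u(2) by (simp add: lin_ext_single_basis inj_eq)
    also have "\<dots> \<in> idl V ?S"
      using u(1) f(2) idl_self[OF S]
      by (intro ideal_sum[OF idl_ideal[OF S]] ideal_poly_ringD(4)[OF idl_ideal[OF S]]) (auto simp: free_on_def)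
    finally show "p \<in> idl V ?S" .
  qed
  show "idl V ?S \<subseteq> I"
    by (rule idl_minimal[OF graded_ideal_imp_ideal[OF graded_ideal]]) blast
qed

end

section \<open>Adjoining a variable\<close>

definition split0 :: "nat \<Rightarrow> 'a::field mpol \<Rightarrow> 'a mpol" where
  "split0 y p = Poly_Mapping.mapp (\<lambda>m c. if lookup m y = 0 then c else 0) p"

text \<open>Reading the coefficient of \<open>m\<close> off at \<open>single y 1 + m\<close> divides
  by \<open>y\<close> and discards the monomials free of \<open>y\<close>. The result may still
  contain \<open>y\<close>; only one power is removed.\<close>

definition split1 :: "nat \<Rightarrow> 'a::field mpol \<Rightarrow> 'a mpol" where
  "split1 y p = Poly_Mapping.map_key (\<lambda>m. single y 1 + m) p"

lemma lookup_split0: "lookup (split0 y p) m = (if lookup m y = 0 then lookup p m else 0)"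
  by (auto simp: split0_def lookup_mapp when_def in_keys_iff)

lemma lookup_split1: "lookup (split1 y p) m = lookup p (single y 1 + m)"
  by (simp add: split1_def Poly_Mapping.map_key.rep_eq inj_def)

lemma split_eq: "p = split0 y p + variable y * split1 y p"
proof (induction p rule: poly_mapping_induct_add)
  case zero
  then show ?case
    by (intro poly_mapping_eqI) (simp add: split0_def split1_def lookup_mapp lookup_add inj_def)
next
  case (single m c)
  show ?case
  proof (cases "lookup m y = 0")
    case True
    have "split0 y (single m c) = single m c"
      by (rule poly_mapping_eqI) (use True in \<open>auto simp: lookup_split0 lookup_single when_def\<close>)
    moreover have "split1 y (single m c) = 0"
      by (rule poly_mapping_eqI) (use True in \<open>auto simp: lookup_split1 lookup_single when_def lookup_add\<close>)
    ultimately show ?thesis by simp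
  next
    case False
    define m' where "m' = m - single y 1"
    have m: "m = single y 1 + m'"
      by (rule poly_mapping_eqI) (use False in \<open>auto simp: m'_def lookup_add lookup_minus lookup_single when_def\<close>)
    have "split0 y (single m c) = 0"
      by (rule poly_mapping_eqI) (use False in \<open>auto simp: lookup_split0 lookup_single when_def\<close>)
    moreover have "split1 y (single m c) = single m' c"
      by (rule poly_mapping_eqI) (auto simp: lookup_split1 lookup_single when_def m)
    ultimately show ?thesis
      by (simp add: variable_def monomial_def mult_single m)
  qed
next
  case (add p q)
  have "split0 y (p + q) = split0 y p + split0 y q" "split1 y (p + q) = split1 y p + split1 y q"
    by (rule poly_mapping_eqI, simp add: lookup_split0 lookup_split1 lookup_add)+
  with add show ?case
    by (simp add: distrib_left algebra_simps)
qed

lemma split0_polys: "p \<in> polys (insert y V) \<Longrightarrow> split0 y p \<in> polys V"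
  unfolding poly_ring_carrier
proof
  fix m assume p: "\<forall>m\<in>keys p. keys m \<subseteq> insert y V" and m: "m \<in> keys (split0 y p)"
  then have "m \<in> keys p" "y \<notin> keys m"
    by (auto simp: in_keys_iff lookup_split0 split: if_splits)
  with p show "keys m \<subseteq> V" by blast
qed

lemma split1_polys: "p \<in> polys V \<Longrightarrow> split1 y p \<in> polys V"
  unfolding poly_ring_carrier
proof
  fix m assume p: "\<forall>m\<in>keys p. keys m \<subseteq> V" and m: "m \<in> keys (split1 y p)"
  then have "keys (single y 1 + m) \<subseteq> V"
    by (simp add: in_keys_iff lookup_split1)
  moreover have "keys m \<subseteq> keys (single y 1 + m)"
    by (auto simp: in_keys_iff lookup_add)
  ultimately show "keys m \<subseteq> V" by blast
qed

lemma variable_nonzero: "variable y \<noteq> (0 :: 'a::field mpol)"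
proof
  assume "variable y = (0 :: 'a mpol)"
  then have "lookup (variable y :: 'a mpol) (single y 1) = 0"
    by simp
  then show False
    by (simp add: variable_def monomial_def)
qed

lemma split_unique:
  assumes "p \<in> polys V" "y \<notin> V" "p + variable y * q = 0"
  shows "p = 0" "q = 0"
proof -
  have "m \<notin> keys p" for m
  proof
    assume m: "m \<in> keys p"
    have "p = - (variable y * q)"
      using assms(3) by (simp add: eq_neg_iff_add_eq_0)
    with m have "m \<in> keys (variable y * q)"
      by simp
    then obtain b where "m = single y 1 + b"
      using keys_mult[of "variable y" q] by (auto simp: variable_def monomial_def)
    then have "y \<in> keys m"
      by (simp add: in_keys_iff lookup_add)
    with assms(1,2) m show False
      by (auto simp: poly_ring_carrier)
  qed
  then show "p = 0"
    using keys_eq_empty by blast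
  with assms(3) show "q = 0"
    by (simp add: variable_nonzero)
qed

lemma split_unique_vec:
  assumes "u \<in> free_on V B" "y \<notin> V" "u + scale (variable y) w = 0"
  shows "u = 0" "w = 0"
proof -
  have "lookup u b = 0 \<and> lookup w b = 0" for b
  proof -
    have "lookup (u + scale (variable y) w) b = 0"
      by (simp add: assms(3))
    then have "lookup u b + variable y * lookup w b = 0"
      by (simp add: lookup_add)
    moreover have "lookup u b \<in> polys V"
      using assms(1) by (simp add: free_on_def)
    ultimately show ?thesis
      using split_unique assms(2) by blast
  qed
  then show "u = 0" "w = 0"
    by (auto intro: poly_mapping_eqI)
qed

lemma split_vec:
  assumes "u \<in> free_on (insert y V) B"
  obtains u0 u1 where "u0 \<in> free_on V B" "u1 \<in> free_on (insert y V) B" "u = u0 + scale (variable y) u1"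
    "\<And>b. lookup u1 b = split1 y (lookup u b)"
proof
  have 0: "split0 y 0 = 0" "split1 y 0 = 0"
    by (rule poly_mapping_eqI, simp add: lookup_split0 lookup_split1)+
  let ?u0 = "Poly_Mapping.map (split0 y) u" and ?u1 = "Poly_Mapping.map (split1 y) u"
  have "keys ?u0 \<subseteq> keys u" "keys ?u1 \<subseteq> keys u"
    by (auto simp: in_keys_iff lookup_map 0)
  then show "?u0 \<in> free_on V B" "?u1 \<in> free_on (insert y V) B"
    using assms by (auto simp: free_on_def lookup_map 0 split0_polys split1_polys)
  show "u = ?u0 + scale (variable y) ?u1"
    by (rule poly_mapping_eqI) (simp add: lookup_add lookup_map 0 flip: split_eq)
  show "lookup ?u1 b = split1 y (lookup u b)" for b
    by (simp add: lookup_map 0)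
qed

section \<open>Exactness after adjoining a variable\<close>

context graded_res
begin

text \<open>\<open>y\<close> is a nonzerodivisor modulo a submodule extended from a ring without
  \<open>y\<close>. In \<open>y q = D g0 + y (D g1)\<close> the term \<open>D g0\<close> is free of
  \<open>y\<close>, so it vanishes and \<open>q = D g1\<close>.\<close>

lemma image_colon:
  assumes "y \<notin> V" "scale (variable y) q \<in> lin_ext (D i) ` free_on (insert y V) (B (Suc i))"
  shows "q \<in> lin_ext (D i) ` free_on (insert y V) (B (Suc i))"
proof -
  obtain g where g: "g \<in> free_on (insert y V) (B (Suc i))" "scale (variable y) q = lin_ext (D i) g"
    using assms(2) by blast
  obtain g0 g1 where s: "g0 \<in> free_on V (B (Suc i))" "g1 \<in> free_on (insert y V) (B (Suc i))"
    "g = g0 + scale (variable y) g1"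
    using split_vec[OF g(1)] by blast
  have "lin_ext (D i) g0 \<in> free_on V (B i)"
    by (rule free_on_lin_ext[OF D_free s(1)])
  moreover have "lin_ext (D i) g0 + scale (variable y) (lin_ext (D i) g1 - q) = 0"
    using g(2) by (simp add: s(3) lin_ext_add lin_ext_scale scale.scale_right_diff_distrib)
  ultimately have "lin_ext (D i) g1 - q = 0"
    using split_unique_vec(2) assms(1) by blast
  then show ?thesis
    using s(2) by (intro image_eqI[of _ _ g1]) auto
qed

text \<open>Flatness, by induction on a bound \<open>N\<close> for the exponents of
  \<open>y\<close>. The differential is free of \<open>y\<close>, so both parts of a cycle
  \<open>u0 + y u1\<close> are cycles; \<open>u0\<close> is a boundary over the old ring, and
  \<open>u1\<close> has smaller exponents.\<close>

theorem base_change: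
  assumes y: "y \<notin> V"
  shows "graded_res (insert y V) (idl (insert y V) I) B deg D e"
proof
  let ?W = "insert y V"
  show "D i b \<in> free_on ?W (B i)" if "b \<in> B (Suc i)" for i b
    using D_free[OF that] by (rule free_on_mono[rotated]) blast
  show "lin_ext (D i) ` free_on ?W (B (Suc i)) = cycles ?W (idl ?W I) B D e i" for i
  proof (cases i)
    case 0
    then show ?thesis
      using image_aug_idl[of ?W] by auto
  next
    case (Suc l)
    have "u \<in> lin_ext (D (Suc l)) ` free_on ?W (B (Suc (Suc l)))"
      if "u \<in> free_on ?W (B (Suc l))" "lin_ext (D l) u = 0" "\<forall>b. \<forall>m\<in>keys (lookup u b). lookup m y < N" for u N
      using that
    proof (induction N arbitrary: u)
      case 0
      have "lookup u b = 0" for b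
        using 0(3) by (subst keys_eq_empty[symmetric]) (meson not_less_zero equals0I)
      then have "u = 0"
        by (intro poly_mapping_eqI) simp
      then show ?case
        by (intro image_eqI[of _ _ 0]) auto
    next
      case (Suc N)
      obtain u0 u1 where u: "u0 \<in> free_on V (B (Suc l))" "u1 \<in> free_on ?W (B (Suc l))"
        "u = u0 + scale (variable y) u1" "\<And>b. lookup u1 b = split1 y (lookup u b)"
        using split_vec[OF Suc.prems(1)] by blast
      have eq: "lin_ext (D l) u0 + scale (variable y) (lin_ext (D l) u1) = 0"
        using Suc.prems(2) by (simp add: u(3) lin_ext_add lin_ext_scale)
      note zero = split_unique_vec[OF free_on_lin_ext[OF D_free u(1)] y eq]
      have "lookup m y < N" if "m \<in> keys (lookup u1 b)" for b m
      proof -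
        have "single y 1 + m \<in> keys (lookup u b)"
          using that by (simp add: u(4) in_keys_iff lookup_split1)
        with Suc.prems(3) have "lookup (single y 1 + m) y < Suc N"
          by blast
        then show ?thesis by (simp add: lookup_add)
      qed
      with Suc.IH[OF u(2) zero(2)] obtain w1 where w1: "w1 \<in> free_on ?W (B (Suc (Suc l)))" "u1 = lin_ext (D (Suc l)) w1"
        by blast
      have "u0 \<in> lin_ext (D (Suc l)) ` free_on V (B (Suc (Suc l)))"
        unfolding exact using u(1) zero(1) by simp
      then obtain w0 where w0: "w0 \<in> free_on V (B (Suc (Suc l)))" "u0 = lin_ext (D (Suc l)) w0"
        by blast
      show ?case
      proof (rule image_eqI)
        show "u = lin_ext (D (Suc l)) (w0 + scale (variable y) w1)"
          by (simp add: lin_ext_add lin_ext_scale u(3) w0(2) w1(2))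
        show "w0 + scale (variable y) w1 \<in> free_on ?W (B (Suc (Suc l)))"
          by (intro free_on_add free_on_scale w1(1) polys_variable free_on_mono[OF _ w0(1)]) auto
      qed
    qed
    moreover have "\<exists>N. \<forall>b. \<forall>m\<in>keys (lookup u b). lookup m y < N" for u :: "'b \<Rightarrow>\<^sub>0 'a mpol"
    proof -
      let ?M = "\<Union>b\<in>keys u. (\<lambda>m. lookup m y) ` keys (lookup u b)"
      have "finite ?M" by simp
      then obtain N where "\<forall>x\<in>?M. x < N"
        using finite_nat_set_iff_bounded by blast
      moreover have "b \<in> keys u" if "m \<in> keys (lookup u b)" for b m
        using that by (auto simp: in_keys_iff)
      ultimately show ?thesis
        by (intro exI[of _ N]) blast
    qed
    moreover have "lin_ext (D (Suc l)) w \<in> free_on ?W (B (Suc l))" "lin_ext (D l) (lin_ext (D (Suc l)) w) = 0"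
      if "w \<in> free_on ?W (B (Suc (Suc l)))" for w
    proof -
      show "lin_ext (D (Suc l)) w \<in> free_on ?W (B (Suc l))"
        by (rule free_on_lin_ext[OF free_on_mono[OF _ D_free] that]) auto
      have "lin_ext (D l) (lin_ext (D (Suc l)) w) = lin_ext (\<lambda>b. 0) w"
        unfolding lin_ext_comp by (rule lin_ext_cong_free[OF that D_D])
      then show "lin_ext (D l) (lin_ext (D (Suc l)) w) = 0"
        by simp
    qed
    ultimately show ?thesis
      unfolding Suc cycles_simps by blast
  qed
qed (auto simp: B_0 deg_e D_hvec)

end

section \<open>The mapping cone\<close>

definition emb :: "nat \<Rightarrow> ('b \<Rightarrow>\<^sub>0 'a::field mpol) \<Rightarrow> (nat \<times> 'b \<Rightarrow>\<^sub>0 'a mpol)" where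
  "emb t u = lin_ext (\<lambda>b. single (t, b) 1) u"

definition proj :: "nat \<Rightarrow> (nat \<times> 'b \<Rightarrow>\<^sub>0 'a::field mpol) \<Rightarrow> ('b \<Rightarrow>\<^sub>0 'a mpol)" where
  "proj t u = lin_ext (\<lambda>(s, b). if s = t then single b 1 else 0) u"

interpretation emb: module_hom scale scale "emb t"
  unfolding emb_def by (rule lin_ext.module_hom_axioms)

interpretation proj: module_hom scale scale "proj t"
  unfolding proj_def by (rule lin_ext.module_hom_axioms)

lemma emb_single [simp]: "emb t (single b c) = single (t, b) c"
  by (simp add: emb_def scale_single)

lemma lin_ext_emb: "lin_ext f (emb t u) = lin_ext (\<lambda>b. f (t, b)) u"
  by (simp add: emb_def lin_ext_comp)

lemma lin_ext_fun_emb: "lin_ext (\<lambda>b. emb t (f b)) u = emb t (lin_ext f u)"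
  by (simp add: emb_def lin_ext_comp)

lemma proj_emb: "proj s (emb t u) = (if s = t then u else 0)"
  by (simp add: proj_def lin_ext_emb)

lemma emb_free_on: "u \<in> free_on V B \<Longrightarrow> {t} \<times> B \<subseteq> C \<Longrightarrow> emb t u \<in> free_on V C"
  unfolding emb_def by (erule free_on_lin_ext[rotated]) (auto intro: free_on_single)

lemma hvec_emb:
  assumes "hvec deg j u" "\<And>b. deg' (t, b) = deg b + k"
  shows "hvec deg' (j + k) (emb t u)"
proof -
  have "hvec deg' (j + k) (scale (lookup u b) (single (t, b) 1))" if b: "b \<in> keys u" for b
  proof -
    have "homogeneous (j - deg b) (lookup u b)" "deg b \<le> j"
      using b assms(1) by (auto simp: hvec_def)
    with hvec_single[OF this(1), of deg' "(t, b)"] show ?thesis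
      by (simp add: assms(2) scale_single add.commute add.left_commute)
  qed
  then show ?thesis
    unfolding emb_def lin_ext_def by (rule hvec_sum)
qed

lemma const_part_emb: "const_part u = 0 \<Longrightarrow> const_part (emb t u) = 0"
  by (simp add: emb_def const_part_lin_ext)

text \<open>
  If \<open>y q \<in> J\<close> implies \<open>q \<in> J\<close>, then the kernel of \<open>J \<oplus> I(-1) \<rightarrow> J + y I\<close> consists of the pairs
  \<open>(y q, - q)\<close> with \<open>q \<in> J\<close>. So \<open>J + y I\<close> is resolved by the cone of the map \<open>(y, - \<phi>)\<close> from
  \<open>G(-1)\<close> to \<open>G \<oplus> F(-1)\<close>, where \<open>\<phi>\<close> lifts the inclusion to resolutions \<open>G\<close> of \<open>J\<close> and \<open>F\<close> of \<open>I\<close>.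
  The tags 0, 1, 2 mark the summands \<open>G\<close>, \<open>F(-1)\<close> and the shifted \<open>G(-1)\<close>.
\<close>

locale cone = G: graded_res V J BG deg DG e + F: graded_res V I BF deg DF e
  for V :: "nat set" and J I :: "'a::field mpol set" and BG BF :: "nat \<Rightarrow> 'b set"
    and deg :: "'b \<Rightarrow> nat" and DG DF and e +
  fixes y :: nat and \<phi> :: "nat \<Rightarrow> 'b \<Rightarrow> ('b \<Rightarrow>\<^sub>0 'a mpol)"
  assumes y: "y \<in> V"
    and colon: "\<And>q. q \<in> I \<Longrightarrow> variable y * q \<in> J \<Longrightarrow> q \<in> J"
    and \<phi>_0: "\<phi> 0 = (\<lambda>_. single e 1)"
    and \<phi>_free: "\<And>i b. b \<in> BG i \<Longrightarrow> \<phi> i b \<in> free_on V (BF i)"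
    and \<phi>_hvec: "\<And>i b. b \<in> BG i \<Longrightarrow> hvec deg (deg b) (\<phi> i b)"
    and \<phi>_comm: "\<And>i b. b \<in> BG (Suc i) \<Longrightarrow> lin_ext (DF i) (\<phi> (Suc i) b) = lin_ext (\<phi> i) (DG i b)"
begin

text \<open>Position 0 of \<open>BG\<close> is the ring itself and must not be shifted into the
  cone; dropping it leaves just the modules of \<open>G\<close>.\<close>

definition BG' :: "nat \<Rightarrow> 'b set" where
  "BG' i = (if i = 0 then {} else BG i)"

text \<open>For \<open>i = 1\<close> the shifted differential would be the augmentation
  \<open>DG 0\<close>, whose target has been dropped; hence the value 0.\<close>

definition DG' :: "nat \<Rightarrow> 'b \<Rightarrow> ('b \<Rightarrow>\<^sub>0 'a mpol)" where
  "DG' i b = (if i \<le> 1 then 0 else DG (i - 1) b)"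

definition cone_basis :: "nat \<Rightarrow> (nat \<times> 'b) set" where
  "cone_basis i = (case i of 0 \<Rightarrow> {(0, e)}
    | Suc l \<Rightarrow> {0} \<times> BG (Suc l) \<union> {1} \<times> BF (Suc l) \<union> {2} \<times> BG' l)"

definition cone_deg :: "nat \<times> 'b \<Rightarrow> nat" where
  "cone_deg = (\<lambda>(t, b). if t = 0 then deg b else deg b + 1)"

text \<open>In position 0 the summands \<open>G\<close> and \<open>F(-1)\<close> map to the ring by
  \<open>g + y f\<close>, which is where \<open>J + y I\<close> arises. From position 1 on,
  \<open>y\<close> occurs only in the map from the shifted \<open>G\<close> to \<open>G\<close>. The
  minus sign on the shifted differential makes consecutive maps compose to zero: it cancels
  \<open>y D h\<close> against \<open>D (y h)\<close>, and likewise the two terms with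
  \<open>\<phi>\<close>.\<close>

definition cone_bd :: "nat \<Rightarrow> nat \<times> 'b \<Rightarrow> (nat \<times> 'b \<Rightarrow>\<^sub>0 'a mpol)" where
  "cone_bd i = (\<lambda>(t, b).
    if t = 0 then emb 0 (DG i b)
    else if t = 1 then (if i = 0 then emb 0 (scale (variable y) (DF 0 b)) else emb 1 (DF i b))
    else emb 0 (scale (variable y) (single b 1)) - emb 1 (\<phi> i b) - emb 2 (DG' i b))"

definition triple :: "('b \<Rightarrow>\<^sub>0 'a mpol) \<Rightarrow> ('b \<Rightarrow>\<^sub>0 'a mpol) \<Rightarrow> ('b \<Rightarrow>\<^sub>0 'a mpol) \<Rightarrow> (nat \<times> 'b \<Rightarrow>\<^sub>0 'a mpol)" where
  "triple g f h = emb 0 g + emb 1 f + emb 2 h"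

lemma triple_eq_iff: "triple g f h = triple g' f' h' \<longleftrightarrow> g = g' \<and> f = f' \<and> h = h'"
proof
  assume eq: "triple g f h = triple g' f' h'"
  have "proj 0 (triple g f h) = g" "proj 1 (triple g f h) = f" "proj 2 (triple g f h) = h" for g f h
    by (simp_all add: triple_def proj.add proj_emb)
  then show "g = g' \<and> f = f' \<and> h = h'"
    using eq by metis
qed simp

lemma triple_0: "triple g f h = 0 \<longleftrightarrow> g = 0 \<and> f = 0 \<and> h = 0"
  using triple_eq_iff[of g f h 0 0 0] by (simp add: triple_def)

lemma triple_free_on:
  assumes "g \<in> free_on V (BG (Suc l))" "f \<in> free_on V (BF (Suc l))" "h \<in> free_on V (BG' l)"
  shows "triple g f h \<in> free_on V (cone_basis (Suc l))"
  unfolding triple_def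
  by (intro free_on_add emb_free_on[OF assms(1)] emb_free_on[OF assms(2)] emb_free_on[OF assms(3)])
    (auto simp: cone_basis_def)

lemma triple_cases:
  assumes "u \<in> free_on V (cone_basis (Suc l))"
  obtains g f h where "g \<in> free_on V (BG (Suc l))" "f \<in> free_on V (BF (Suc l))" "h \<in> free_on V (BG' l)"
    "u = triple g f h"
proof
  have proj: "proj t u \<in> free_on V C" if "\<And>b. (t, b) \<in> cone_basis (Suc l) \<Longrightarrow> b \<in> C" for t C
    unfolding proj_def
    by (rule free_on_lin_ext[OF _ assms]) (auto intro!: free_on_single that)
  show "proj 0 u \<in> free_on V (BG (Suc l))" "proj 1 u \<in> free_on V (BF (Suc l))" "proj 2 u \<in> free_on V (BG' l)"
    by (auto intro!: proj simp: cone_basis_def)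
  have "triple (proj 0 u) (proj 1 u) (proj 2 u) =
      lin_ext (\<lambda>x. triple (proj 0 (single x 1)) (proj 1 (single x 1)) (proj 2 (single x 1))) u"
    by (simp add: triple_def lin_ext_fun_add lin_ext_fun_emb proj_def)
  also have "\<dots> = lin_ext (\<lambda>x. single x 1) u"
    by (rule lin_ext_cong_free[OF assms])
      (auto simp: triple_def proj_def cone_basis_def)
  finally show "u = triple (proj 0 u) (proj 1 u) (proj 2 u)"
    by simp
qed

lemma lin_ext_cone_bd_0:
  "lin_ext (cone_bd 0) (triple g f 0) = emb 0 (lin_ext (DG 0) g + scale (variable y) (lin_ext (DF 0) f))"
  by (simp add: triple_def lin_ext_add lin_ext_emb cone_bd_def lin_ext_fun_emb lin_ext_fun_scale
      emb.add emb.scale)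

lemma lin_ext_cone_bd_Suc:
  "lin_ext (cone_bd (Suc i)) (triple g f h) = triple (lin_ext (DG (Suc i)) g + scale (variable y) h)
    (lin_ext (DF (Suc i)) f - lin_ext (\<phi> (Suc i)) h) (- lin_ext (DG' (Suc i)) h)"
proof -
  have "lin_ext (\<lambda>b. cone_bd (Suc i) (0, b)) g = emb 0 (lin_ext (DG (Suc i)) g)"
    "lin_ext (\<lambda>b. cone_bd (Suc i) (1, b)) f = emb 1 (lin_ext (DF (Suc i)) f)"
    "lin_ext (\<lambda>b. cone_bd (Suc i) (2, b)) h =
      emb 0 (scale (variable y) h) - emb 1 (lin_ext (\<phi> (Suc i)) h) - emb 2 (lin_ext (DG' (Suc i)) h)"
    by (simp_all add: cone_bd_def lin_ext_fun_diff lin_ext_fun_emb lin_ext_fun_scale del: emb_single)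
  then show ?thesis
    by (simp add: triple_def lin_ext_add lin_ext_emb emb.add emb.diff emb.neg)
qed

lemma lin_ext_\<phi>_0: "u \<in> free_on V (BG 0) \<Longrightarrow> lin_ext (\<phi> 0) u = u"
  using lin_ext_cong_free[of u V "BG 0" "\<phi> 0" "\<lambda>b. single b 1"] by (simp add: \<phi>_0 G.B_0)

lemma lin_ext_\<phi>_comm:
  assumes "u \<in> free_on V (BG (Suc i))"
  shows "lin_ext (DF i) (lin_ext (\<phi> (Suc i)) u) = lin_ext (\<phi> i) (lin_ext (DG i) u)"
  unfolding lin_ext_comp by (rule lin_ext_cong_free[OF assms \<phi>_comm])

lemma lin_ext_\<phi>_free: "u \<in> free_on V (BG i) \<Longrightarrow> lin_ext (\<phi> i) u \<in> free_on V (BF i)"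
  by (rule free_on_lin_ext[OF \<phi>_free])

lemma lin_ext_DG_free: "u \<in> free_on V (BG (Suc i)) \<Longrightarrow> lin_ext (DG i) u \<in> free_on V (BG i)"
  by (rule free_on_lin_ext[OF G.D_free])

lemma y_polys: "variable y \<in> polys V"
  by (rule polys_variable[OF y])

lemma scale_y_cancel: "scale (variable y) u = 0 \<Longrightarrow> u = (0 :: 'b \<Rightarrow>\<^sub>0 'a mpol)"
proof (rule poly_mapping_eqI)
  fix b assume "scale (variable y) u = 0"
  then have "variable y * lookup u b = 0"
    using lookup_scale[of "variable y" u b] by simp
  then show "lookup u b = lookup 0 b"
    by (simp add: variable_nonzero)
qed

lemma cone_bd_free:
  assumes "x \<in> cone_basis (Suc i)"
  shows "cone_bd i x \<in> free_on V (cone_basis i)"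
proof (cases i)
  case 0
  have "emb 0 (DG 0 b) \<in> free_on V {(0, e)}" if "b \<in> BG 1" for b
    using emb_free_on[OF G.D_free[of b 0]] that by (simp add: G.B_0)
  moreover have "emb 0 (scale (variable y) (DF 0 b)) \<in> free_on V {(0, e)}" if "b \<in> BF 1" for b
    using emb_free_on[OF free_on_scale[OF y_polys F.D_free[of b 0]]] that by (simp add: F.B_0)
  ultimately show ?thesis
    using assms 0 by (auto simp: cone_basis_def cone_bd_def BG'_def)
next
  case (Suc l)
  have cone_bd: "cone_bd i (0, b) = triple (DG i b) 0 0" "cone_bd i (1, b) = triple 0 (DF i b) 0"
    "cone_bd i (2, b) = triple (scale (variable y) (single b 1)) (- \<phi> i b) (- DG' i b)" for b
    using Suc by (simp_all add: cone_bd_def triple_def emb.neg)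
  have "DG' i b \<in> free_on V (BG' l)" if "b \<in> BG i" for b
    using G.D_free[of b l] that Suc by (auto simp: DG'_def BG'_def)
  then have "cone_bd i (2, b) \<in> free_on V (cone_basis i)" if "b \<in> BG i" for b
    unfolding cone_bd using Suc that
    by (auto intro!: triple_free_on free_on_uminus \<phi>_free free_on_scale free_on_single y_polys)
  moreover have "cone_bd i (0, b) \<in> free_on V (cone_basis i)" if "b \<in> BG (Suc i)" for b
    unfolding cone_bd using Suc G.D_free[OF that] by (auto intro!: triple_free_on)
  moreover have "cone_bd i (1, b) \<in> free_on V (cone_basis i)" if "b \<in> BF (Suc i)" for b
    unfolding cone_bd using Suc F.D_free[OF that] by (auto intro!: triple_free_on)
  ultimately show ?thesis
    using assms Suc by (auto simp: cone_basis_def[of "Suc _"] BG'_def)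
qed

lemma cone_bd_hvec:
  assumes "x \<in> cone_basis (Suc i)"
  shows "hvec cone_deg (cone_deg x) (cone_bd i x)"
proof -
  have emb0: "hvec cone_deg j (emb 0 u)" if "hvec deg j u" for j u
    using hvec_emb[OF that, of cone_deg 0 0] by (simp add: cone_deg_def)
  have emb: "hvec cone_deg (j + 1) (emb t u)" if "hvec deg j u" "t \<noteq> 0" for j t u
    using hvec_emb[OF that(1), of cone_deg t 1] that(2) by (simp add: cone_deg_def)
  have scale: "hvec deg (j + 1) (scale (variable y) u)" if "hvec deg j u" for j u
    using hvec_scale[OF homogeneous_variable that] by (simp add: add.commute)
  have single: "hvec deg (deg b) (single b (1 :: 'a mpol))" for b
    using hvec_single[of 0 "1 :: 'a mpol" deg b] by (simp add: homogeneous_iff)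
  consider b where "x = (0, b)" "b \<in> BG (Suc i)" | b where "x = (1, b)" "b \<in> BF (Suc i)"
    | b where "x = (2, b)" "b \<in> BG i" "i \<noteq> 0"
    using assms by (auto simp: cone_basis_def BG'_def split: if_splits)
  then show ?thesis
  proof cases
    case 1
    then show ?thesis
      using emb0[OF G.D_hvec] by (simp add: cone_bd_def cone_deg_def)
  next
    case 2
    then show ?thesis
      using emb0[OF scale[OF F.D_hvec[of b i]]] emb[OF F.D_hvec[of b i], of 1]
      by (cases i) (simp_all add: cone_bd_def cone_deg_def)
  next
    case 3
    have "hvec deg (deg b) (DG' i b)"
      using G.D_hvec[of b "i - 1"] 3 by (simp add: DG'_def)
    with 3 show ?thesis
      using hvec_diff[OF hvec_diff[OF emb0[OF scale[OF single[of b]]] emb[OF \<phi>_hvec[of b i], of 1]]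
        emb[of "deg b" "DG' i b" 2]]
      by (simp add: cone_bd_def cone_deg_def)
  qed
qed

lemma cone_exact_0:
  "lin_ext (cone_bd 0) ` free_on V (cone_basis (Suc 0)) = single (0 :: nat, e) ` {p + variable y * q | p q. p \<in> J \<and> q \<in> I}"
proof (intro equalityI subsetI)
  fix x assume "x \<in> lin_ext (cone_bd 0) ` free_on V (cone_basis (Suc 0))"
  then obtain u where "u \<in> free_on V (cone_basis (Suc 0))" and x_u: "x = lin_ext (cone_bd 0) u"
    by blast
  from triple_cases[OF this(1)] obtain g f h where
    u: "g \<in> free_on V (BG (Suc 0))" "f \<in> free_on V (BF (Suc 0))" "h \<in> free_on V (BG' 0)"
    and x: "x = lin_ext (cone_bd 0) (triple g f h)"
    unfolding x_u by blast
  have "h = 0"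
    using u(3) by (simp add: BG'_def free_on_def keys_eq_empty)
  obtain p q where "lin_ext (DG 0) g = single e p" "p \<in> J" "lin_ext (DF 0) f = single e q" "q \<in> I"
    using G.lin_ext_D_cycles[OF u(1)] F.lin_ext_D_cycles[OF u(2)] by auto
  then have "x = single (0, e) (p + variable y * q)"
    by (simp add: x \<open>h = 0\<close> lin_ext_cone_bd_0 scale_single single_add emb.add)
  then show "x \<in> single (0 :: nat, e) ` {p + variable y * q | p q. p \<in> J \<and> q \<in> I}"
    using \<open>p \<in> J\<close> \<open>q \<in> I\<close> by blast
next
  fix x assume "x \<in> single (0 :: nat, e) ` {p + variable y * q | p q. p \<in> J \<and> q \<in> I}"
  then obtain p q where x: "x = single (0, e) (p + variable y * q)" "p \<in> J" "q \<in> I"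
    by blast
  have "single e p \<in> cycles V J BG DG e 0" "single e q \<in> cycles V I BF DF e 0"
    using x by auto
  then obtain g f where "g \<in> free_on V (BG (Suc 0))" "single e p = lin_ext (DG 0) g"
    "f \<in> free_on V (BF (Suc 0))" "single e q = lin_ext (DF 0) f"
    unfolding G.exact[symmetric] F.exact[symmetric] by blast
  then show "x \<in> lin_ext (cone_bd 0) ` free_on V (cone_basis (Suc 0))"
    by (intro image_eqI[of _ _ "triple g f 0"] triple_free_on)
      (auto simp: lin_ext_cone_bd_0 x scale_single single_add emb.add simp flip: \<open>single e p = _\<close> \<open>single e q = _\<close>)
qed

text \<open>Common end of both cases of exactness: once \<open>h\<close> is found such that the
  corrected first two coordinates are cycles, exactness of \<open>G\<close> and \<open>F\<close>
  lifts them.\<close>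

lemma lift_relation:
  assumes u: "g \<in> free_on V (BG (Suc i))" "f \<in> free_on V (BF (Suc i))" "h \<in> free_on V (BG (Suc i))"
    and eq: "lin_ext (DG i) (g + scale (variable y) h) = 0" "lin_ext (DF i) f = lin_ext (\<phi> i) (lin_ext (DG i) h)"
  obtains g' f' where "g' \<in> free_on V (BG (Suc (Suc i)))" "f' \<in> free_on V (BF (Suc (Suc i)))"
    "g + scale (variable y) h = lin_ext (DG (Suc i)) g'" "f - lin_ext (\<phi> (Suc i)) h = lin_ext (DF (Suc i)) f'"
proof -
  have "g + scale (variable y) h \<in> cycles V J BG DG e (Suc i)"
    using u eq(1) by (simp add: free_on_add free_on_scale y_polys)
  moreover have "f - lin_ext (\<phi> (Suc i)) h \<in> cycles V I BF DF e (Suc i)"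
    using u eq(2) by (simp add: free_on_diff lin_ext_\<phi>_free lin_ext.diff lin_ext_\<phi>_comm)
  ultimately show thesis
    unfolding G.exact[symmetric] F.exact[symmetric] using that by blast
qed

text \<open>The third coordinate is removed first: \<open>h'\<close> bounds it, and
  \<open>y h'\<close> and \<open>\<phi> h'\<close> correct the other two. For \<open>i = 0\<close>
  that coordinate is zero, and \<open>h'\<close> is a lift of the element \<open>q\<close> with
  \<open>p + y q = 0\<close>, which lies in \<open>J\<close> by \<open>colon\<close>. For positive
  \<open>i\<close>, cancelling \<open>y\<close> shows that \<open>h\<close> is a cycle of
  \<open>G\<close>.\<close>

lemma cone_cycle_subset:
  assumes "u \<in> free_on V (cone_basis (Suc i))" "lin_ext (cone_bd i) u = 0"
  shows "u \<in> lin_ext (cone_bd (Suc i)) ` free_on V (cone_basis (Suc (Suc i)))"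
proof -
  obtain g f h where free: "g \<in> free_on V (BG (Suc i))" "f \<in> free_on V (BF (Suc i))" "h \<in> free_on V (BG' i)"
    and u: "u = triple g f h"
    using triple_cases[OF assms(1)] by blast
  have "\<exists>h'. h' \<in> free_on V (BG (Suc i)) \<and> h = lin_ext (DG' (Suc i)) h' \<and>
      lin_ext (DG i) (g + scale (variable y) h') = 0 \<and> lin_ext (DF i) f = lin_ext (\<phi> i) (lin_ext (DG i) h')"
  proof (cases i)
    case 0
    then have "h = 0"
      using free(3) by (simp add: BG'_def free_on_def keys_eq_empty)
    obtain p q where pq: "lin_ext (DG 0) g = single e p" "p \<in> J" "lin_ext (DF 0) f = single e q" "q \<in> I"
      using G.lin_ext_D_cycles[of g 0] F.lin_ext_D_cycles[of f 0] free 0 by auto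
    have "single (0 :: nat, e) (p + variable y * q) = 0"
      using assms(2) 0 pq by (simp add: u \<open>h = 0\<close> lin_ext_cone_bd_0 scale_single single_add emb.add)
    then have "p + variable y * q = 0"
      by (metis lookup_single_eq lookup_zero)
    then have eq: "variable y * q = (- 1) * p"
      by (simp add: eq_neg_iff_add_eq_0 add.commute)
    also have "\<dots> \<in> J"
      using G.graded_ideal pq(2) polys_uminus[OF polys_1, of V] by (auto simp: graded_ideal_def simp del: mult_minus1)
    finally have "single e q \<in> cycles V J BG DG e 0"
      using colon[OF pq(4)] by simp
    then obtain h' where h': "h' \<in> free_on V (BG (Suc 0))" "lin_ext (DG 0) h' = single e q"
      unfolding G.exact[symmetric] by (metis imageE)
    have "lin_ext (DG 0) (g + scale (variable y) h') = single e (p + variable y * q)"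
      by (simp add: lin_ext_add lin_ext_scale pq h' scale_single single_add)
    moreover have "lin_ext (\<phi> 0) (lin_ext (DG 0) h') = lin_ext (DG 0) h'"
      by (rule lin_ext_\<phi>_0[OF lin_ext_DG_free[OF h'(1)]])
    ultimately show ?thesis
      using 0 h' pq \<open>p + variable y * q = 0\<close>
      by (intro exI[of _ h']) (simp add: \<open>h = 0\<close> DG'_def[abs_def])
  next
    case (Suc l)
    have eq: "lin_ext (DG i) g + scale (variable y) h = 0" "lin_ext (DF i) f - lin_ext (\<phi> i) h = 0"
      using assms(2) Suc by (simp_all add: u lin_ext_cone_bd_Suc triple_0)
    have h: "h \<in> free_on V (BG (Suc l))"
      using free(3) Suc by (simp add: BG'_def)
    have "scale (variable y) (lin_ext (DG l) h) = lin_ext (DG l) (lin_ext (DG i) g + scale (variable y) h)"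
      using G.lin_ext_D_D[of g l] free(1) Suc by (simp add: lin_ext_add lin_ext_scale)
    then have "lin_ext (DG l) h = 0"
      using eq(1) scale_y_cancel by simp
    then have "h \<in> cycles V J BG DG e (Suc l)"
      using h by simp
    then obtain h' where h': "h' \<in> free_on V (BG (Suc i))" "h = lin_ext (DG i) h'"
      unfolding G.exact[symmetric] using Suc by blast
    with eq Suc show ?thesis
      by (intro exI[of _ h']) (auto simp: DG'_def[abs_def] lin_ext_add lin_ext_scale)
  qed
  then obtain h' where h': "h' \<in> free_on V (BG (Suc i))" "h = lin_ext (DG' (Suc i)) h'"
    "lin_ext (DG i) (g + scale (variable y) h') = 0" "lin_ext (DF i) f = lin_ext (\<phi> i) (lin_ext (DG i) h')"
    by blast
  obtain g' f' where *: "g' \<in> free_on V (BG (Suc (Suc i)))" "f' \<in> free_on V (BF (Suc (Suc i)))"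
    "g + scale (variable y) h' = lin_ext (DG (Suc i)) g'" "f - lin_ext (\<phi> (Suc i)) h' = lin_ext (DF (Suc i)) f'"
    using lift_relation[OF free(1,2) h'(1,3,4)] by blast
  show ?thesis
  proof (rule image_eqI)
    \<comment> \<open>The sign of \<open>h'\<close> turns the corrected coordinates back into
      \<open>g\<close> and \<open>f\<close> and offsets the minus sign of the shifted
      differential.\<close>
    show "u = lin_ext (cone_bd (Suc i)) (triple g' f' (- h'))"
      by (simp add: lin_ext_cone_bd_Suc u triple_eq_iff h'(2) lin_ext.neg flip: *(3,4))
    show "triple g' f' (- h') \<in> free_on V (cone_basis (Suc (Suc i)))"
      using * h'(1) by (intro triple_free_on free_on_uminus) (simp_all add: BG'_def)
  qed
qed

lemma cone_bd_bd:
  assumes "u \<in> free_on V (cone_basis (Suc (Suc i)))"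
  shows "lin_ext (cone_bd i) (lin_ext (cone_bd (Suc i)) u) = 0"
proof -
  obtain g f h where free: "g \<in> free_on V (BG (Suc (Suc i)))" "f \<in> free_on V (BF (Suc (Suc i)))"
    and h: "h \<in> free_on V (BG (Suc i))" and u: "u = triple g f h"
    using triple_cases[OF assms] by (auto simp: BG'_def)
  have comm: "lin_ext (DF i) (lin_ext (\<phi> (Suc i)) h) = lin_ext (\<phi> i) (lin_ext (DG i) h)"
    by (rule lin_ext_\<phi>_comm[OF h])
  show ?thesis
  proof (cases i)
    case 0
    have "lin_ext (\<phi> 0) (lin_ext (DG 0) h) = lin_ext (DG 0) h"
      by (rule lin_ext_\<phi>_0[OF lin_ext_DG_free]) (use h 0 in simp)
    then show ?thesis
      using 0 comm G.lin_ext_D_D[OF free(1)] F.lin_ext_D_D[OF free(2)]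
      by (simp add: u lin_ext_cone_bd_Suc DG'_def[abs_def] lin_ext_cone_bd_0 lin_ext_add lin_ext.diff
          lin_ext_scale scale.scale_right_diff_distrib)
  next
    case (Suc l)
    have "lin_ext (DG l) (lin_ext (DG i) h) = 0"
      using G.lin_ext_D_D[of h l] h Suc by simp
    \<comment> \<open>The split on \<open>l\<close> decides whether \<open>DG'\<close> is cut off to
      zero or is a differential of \<open>G\<close>.\<close>
    then show ?thesis
      using Suc comm G.lin_ext_D_D[OF free(1)] F.lin_ext_D_D[OF free(2)]
      by (cases l) (simp_all add: u lin_ext_cone_bd_Suc DG'_def[abs_def] lin_ext_add lin_ext.diff
          lin_ext.neg lin_ext_scale triple_0)
  qed
qed

theorem cone_res:
  "graded_res V {p + variable y * q | p q. p \<in> J \<and> q \<in> I} cone_basis cone_deg cone_bd (0, e)"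
proof
  fix i
  show "lin_ext (cone_bd i) ` free_on V (cone_basis (Suc i)) =
    cycles V {p + variable y * q | p q. p \<in> J \<and> q \<in> I} cone_basis cone_bd (0, e) i"
  proof (cases i)
    case 0
    then show ?thesis
      using cone_exact_0 by simp
  next
    case (Suc l)
    show ?thesis
      unfolding Suc cycles_simps
    proof (intro equalityI subsetI)
      fix x assume "x \<in> lin_ext (cone_bd (Suc l)) ` free_on V (cone_basis (Suc (Suc l)))"
      then show "x \<in> {u \<in> free_on V (cone_basis (Suc l)). lin_ext (cone_bd l) u = 0}"
        using cone_bd_bd free_on_lin_ext[OF cone_bd_free] by auto
    qed (simp add: cone_cycle_subset)
  qed
qed (auto simp: cone_bd_free cone_bd_hvec, auto simp: cone_basis_def cone_deg_def G.deg_e)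

end

section \<open>Products with the irrelevant ideal in new variables\<close>

definition minimal_resolution :: "nat set \<Rightarrow> 'a::field mpol set \<Rightarrow> 'a free_cplx \<Rightarrow> bool" where
  "minimal_resolution V I F \<longleftrightarrow> graded_free_resolution V I F \<and>
    (\<forall>i. \<forall>b\<in>basis F (Suc i). const_part (bd F i b) = 0)"

lemma minimal_resolution_graded_res:
  "minimal_resolution V I F \<Longrightarrow> graded_res V I (aug_basis F) fst (aug_bd F) (0, 0)"
  by (simp add: minimal_resolution_def graded_free_resolution_iff)

lemma betti_gens:
  assumes "minimal_resolution V I F"
  shows "betti V I i j = gens F i j"
proof -
  have *: "{b \<in> aug_basis F (Suc i). fst b = j} = {j} \<times> {..<gens F i j}"
    by (auto simp: basis_def)
  then have fin: "finite {b \<in> aug_basis F (Suc i). fst b = j}"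
    by simp
  have "betti V I i j = card {b \<in> aug_basis F (Suc i). fst b = j}"
    using assms by (intro betti_minimal[OF _ minimal_resolution_graded_res[OF assms] _ fin])
      (auto simp: minimal_resolution_def)
  then show ?thesis
    unfolding * by simp
qed

definition linear_gens :: "nat \<Rightarrow> 'a::field free_cplx \<Rightarrow> bool" where
  "linear_gens d F \<longleftrightarrow> (\<forall>i j. j \<noteq> i + d \<longrightarrow> gens F i j = 0)"

lemma linear_gens_basis:
  assumes "linear_gens d F"
  shows "basis F i = {i + d} \<times> {..<gens F i (i + d)}"
proof -
  have "j = i + d" if "a < gens F i j" for j a
    using assms that by (cases "j = i + d") (auto simp: linear_gens_def)
  then show ?thesis
    by (auto simp: basis_def)
qed

lemma linear_resolutionI:
  assumes "minimal_resolution V I F" "linear_gens d F"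
  shows "linear_resolution V d I"
proof -
  interpret F: graded_res V I "aug_basis F" fst "aug_bd F" "(0, 0)"
    by (rule minimal_resolution_graded_res[OF assms(1)])
  have "I = idl V {p \<in> I. homogeneous d p}"
    by (rule F.generated_in_degree) (auto simp: linear_gens_basis[OF assms(2)])
  then show ?thesis
    using assms(2) by (simp add: linear_resolution_def betti_gens[OF assms(1)] linear_gens_def)
qed

lemma total_betti_gens:
  assumes "minimal_resolution V I F" "linear_gens d F"
  shows "total_betti V I (int i) = gens F i (i + d)"
proof -
  have "j = i + d" if "gens F i j \<noteq> 0" for j
    using assms(2) that by (cases "j = i + d") (auto simp: linear_gens_def)
  then have "Sum_any (betti V I i) = (\<Sum>j\<in>{i + d}. gens F i j)"
    by (subst Sum_any.expand_superset[of "{i + d}"]) (auto simp: betti_gens[OF assms(1)])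
  then show ?thesis
    by (simp add: total_betti_def)
qed

text \<open>The three summands of the rank formula are those of the cone. The cone is not a
  \<open>free_cplx\<close>, so \<open>H\<close> is chosen anew as a minimal resolution of the ideal
  that the cone resolves.\<close>

lemma product_step:
  fixes F G :: "'a::field free_cplx"
  assumes F: "minimal_resolution V I F" "linear_gens d F"
    and G: "minimal_resolution V J G" "linear_gens (d + 1) G"
    and V: "finite V" "y \<notin> V" and JI: "J \<subseteq> I"
  obtains H where
    "minimal_resolution (insert y V) {p + variable y * q | p q. p \<in> idl (insert y V) J \<and> q \<in> idl (insert y V) I} H"
    "linear_gens (d + 1) H"
    "\<And>i. gens H i (i + (d + 1)) = gens G i (i + (d + 1)) + gens F i (i + d) +
      (if i = 0 then 0 else gens G (i - 1) (i - 1 + (d + 1)))"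
proof -
  let ?W = "insert y V"
  let ?J = "{p + variable y * q | p q. p \<in> idl ?W J \<and> q \<in> idl ?W I}"
  interpret F0: graded_res V I "aug_basis F" fst "aug_bd F" "(0, 0)"
    by (rule minimal_resolution_graded_res[OF F(1)])
  interpret G0: graded_res V J "aug_basis G" fst "aug_bd G" "(0, 0)"
    by (rule minimal_resolution_graded_res[OF G(1)])
  have F': "graded_res ?W (idl ?W I) (aug_basis F) fst (aug_bd F) (0, 0)"
    by (rule F0.base_change[OF V(2)])
  have G': "graded_res ?W (idl ?W J) (aug_basis G) fst (aug_bd G) (0, 0)"
    by (rule G0.base_change[OF V(2)])
  have IW: "I \<subseteq> polys ?W"
    using F0.I_subset polys_mono by blast
  have "idl ?W J \<subseteq> idl ?W I"
    using JI idl_self[OF IW] by (intro idl_minimal[OF idl_ideal[OF IW]]) blast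
  then obtain \<phi> where \<phi>: "\<phi> 0 = (\<lambda>_. single (0, 0) 1)"
    "\<And>i b. b \<in> aug_basis G i \<Longrightarrow> \<phi> i b \<in> free_on ?W (aug_basis F i)"
    "\<And>i b. b \<in> aug_basis G i \<Longrightarrow> hvec fst (fst b) (\<phi> i b)"
    "\<And>i b. b \<in> aug_basis G (Suc i) \<Longrightarrow> lin_ext (aug_bd F i) (\<phi> (Suc i) b) = lin_ext (\<phi> i) (aug_bd G i b)"
    using comparison[OF G' F'] by blast
  have "cone ?W (idl ?W J) (idl ?W I) (aug_basis G) (aug_basis F) fst (aug_bd G) (aug_bd F) (0, 0) y \<phi>"
  proof (intro cone.intro cone_axioms.intro F' G' \<phi>)
    \<comment> \<open>Membership in the extension of \<open>J\<close> is membership in the image of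
      the augmentation of \<open>G\<close>, so \<open>image_colon\<close> in position 0 is the colon
      condition.\<close>
    fix q assume "variable y * q \<in> idl ?W J"
    then have "scale (variable y) (single (0, 0) q) \<in> lin_ext (aug_bd G 0) ` free_on ?W (aug_basis G (Suc 0))"
      using G0.image_aug_idl[of ?W] by (auto simp: scale_single)
    then have "single (0, 0) q \<in> lin_ext (aug_bd G 0) ` free_on ?W (aug_basis G (Suc 0))"
      by (rule G0.image_colon[OF V(2)])
    then show "q \<in> idl ?W J"
      using G0.image_aug_idl[of ?W] by (auto dest: injD[OF inj_single])
  qed auto
  then interpret cone ?W "idl ?W J" "idl ?W I" "aug_basis G" "aug_basis F" fst "aug_bd G" "aug_bd F" "(0, 0)" y \<phi> .
  interpret C: graded_res ?W ?J cone_basis cone_deg cone_bd "(0, (0, 0))"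
    by (rule cone_res)
  have minimal: "const_part (cone_bd (Suc i) x) = 0" if x: "x \<in> cone_basis (Suc (Suc i))" for i x
  proof -
    consider b where "x = (0, b)" "b \<in> basis G (Suc i)" | b where "x = (1, b)" "b \<in> basis F (Suc i)"
      | b where "x = (2, b)" "b \<in> basis G i"
      using x by (auto simp: cone_basis_def BG'_def)
    then show ?thesis
    proof cases
      case 1
      then show ?thesis
        using G(1) by (auto simp: cone_bd_def minimal_resolution_def intro: const_part_emb)
    next
      case 2
      then show ?thesis
        using F(1) by (auto simp: cone_bd_def minimal_resolution_def intro: const_part_emb)
    next
      case 3
      \<comment> \<open>The generators of \<open>G\<close> lie one degree above those of
        \<open>F\<close> in the same position. So \<open>\<phi>\<close> has no entry of degree 0,
        and its reduction vanishes.\<close>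
      have "fst b = Suc (i + d)"
        using 3 by (auto simp: linear_gens_basis[OF G(2)])
      then have empty: "{b' \<in> aug_basis F (Suc i). fst b' = fst b} = {}"
        by (auto simp: linear_gens_basis[OF F(2)])
      have "b \<in> aug_basis G (Suc i)"
        using 3 by simp
      from keys_const_part[OF \<phi>(2)[OF this] \<phi>(3)[OF this]] have "const_part (\<phi> (Suc i) b) = 0"
        unfolding empty by (simp only: subset_empty keys_eq_empty)
      moreover have "const_part (DG' (Suc i) b) = 0"
        using 3 G(1) by (cases i) (simp_all add: DG'_def minimal_resolution_def)
      moreover have "const_part (scale (variable y) (single b (1 :: 'a mpol))) = 0"
        by (simp add: const_part_scale)
      ultimately show ?thesis
        using 3 by (simp add: cone_bd_def const_part_diff const_part_emb del: emb_single)
    qed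
  qed
  \<comment> \<open>Both shifted summands land in the right degree: \<open>F\<close> gives
    \<open>(i + d) + 1\<close>, and \<open>G\<close> from one place lower gives
    \<open>(i - 1) + (d + 1) + 1\<close>.\<close>
  have deg: "cone_deg x = i + (d + 1)" if "x \<in> cone_basis (Suc i)" for x i
    using that by (cases i)
      (auto simp: cone_basis_def BG'_def cone_deg_def linear_gens_basis[OF F(2)] linear_gens_basis[OF G(2)])
  have BG': "BG' i = (if i = 0 then {} else basis G (i - 1))" for i
    by (cases i) (simp_all add: BG'_def)
  have fin: "finite (basis F i)" "finite (basis G i)" "finite (BG' i)" for i
    by (auto simp: BG' linear_gens_basis[OF F(2)] linear_gens_basis[OF G(2)])
  have basis: "cone_basis (Suc i) = {0} \<times> basis G i \<union> {1} \<times> basis F i \<union> {2} \<times> BG' i" for i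
    by (simp add: cone_basis_def)
  have finite_cone: "finite (cone_basis (Suc i))" for i
    by (simp add: basis fin)
  obtain H where H: "graded_free_resolution ?W ?J H"
    "\<And>i b. b \<in> basis H (Suc i) \<Longrightarrow> const_part (bd H i b) = 0"
    using minimal_resolution_exists[OF _ C.graded_ideal] V(1) by auto
  then have H': "minimal_resolution ?W ?J H"
    by (simp add: minimal_resolution_def)
  \<comment> \<open>The cone and \<open>H\<close> are both minimal, so each computes the same Betti
    number: one by counting, the other by its rank.\<close>
  have gens_H: "gens H i j = card {x \<in> cone_basis (Suc i). cone_deg x = j}" for i j
    using betti_minimal[OF H(1) C.graded_res_axioms minimal, of i j] finite_cone
    by (simp add: betti_gens[OF H'])
  show thesis
  proof (rule that[OF H'])
    have "gens H i j = 0" if "j \<noteq> i + (d + 1)" for i j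
    proof -
      have "{x \<in> cone_basis (Suc i). cone_deg x = j} = {}"
        using that deg by auto
      then show ?thesis
        unfolding gens_H by (simp only: card.empty)
    qed
    then show "linear_gens (d + 1) H"
      by (simp add: linear_gens_def)
    fix i
    have "{x \<in> cone_basis (Suc i). cone_deg x = i + (d + 1)} = cone_basis (Suc i)"
      using deg by auto
    then have "gens H i (i + (d + 1)) = card ({0 :: nat} \<times> basis G i \<union> {1} \<times> basis F i \<union> {2} \<times> BG' i)"
      by (simp add: gens_H basis)
    also have "\<dots> = card ({0 :: nat} \<times> basis G i) + card ({1 :: nat} \<times> basis F i) + card ({2 :: nat} \<times> BG' i)"
    proof -
      have "card (({0 :: nat} \<times> basis G i \<union> {1} \<times> basis F i) \<union> {2} \<times> BG' i) =
          card ({0 :: nat} \<times> basis G i \<union> {1} \<times> basis F i) + card ({2 :: nat} \<times> BG' i)"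
        by (rule card_Un_disjoint) (auto simp: fin)
      moreover have "card ({0 :: nat} \<times> basis G i \<union> {1} \<times> basis F i) =
          card ({0 :: nat} \<times> basis G i) + card ({1 :: nat} \<times> basis F i)"
        by (rule card_Un_disjoint) (auto simp: fin)
      ultimately show ?thesis
        by (simp only:)
    qed
    also have "\<dots> = gens G i (i + (d + 1)) + gens F i (i + d) +
        (if i = 0 then 0 else gens G (i - 1) (i - 1 + (d + 1)))"
      by (simp add: card_cartesian_product BG' linear_gens_basis[OF F(2)] linear_gens_basis[OF G(2)])
    finally show "gens H i (i + (d + 1)) = gens G i (i + (d + 1)) + gens F i (i + d) +
        (if i = 0 then 0 else gens G (i - 1) (i - 1 + (d + 1)))" .
  qed
qed

text \<open>Brings the product with one more variable into the form \<open>J + y I\<close> of the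
  cone. The right-hand side is an ideal containing all generators; conversely, the colon ideal by
  \<open>y\<close> contains \<open>I\<close>, hence its extension.\<close>

lemma idl_product_insert:
  fixes I :: "'a::field mpol set"
  assumes Y: "Y \<subseteq> V" and I: "I \<subseteq> polys V"
  shows "idl (insert y V) {variable v * p | v p. v \<in> insert y Y \<and> p \<in> I} =
    {p + variable y * q | p q. p \<in> idl (insert y V) (idl V {variable v * p | v p. v \<in> Y \<and> p \<in> I}) \<and>
      q \<in> idl (insert y V) I}"
    (is "idl ?W ?X = {p + variable y * q | p q. p \<in> idl ?W (idl V ?X') \<and> q \<in> idl ?W I}")
proof -
  have IW: "I \<subseteq> polys ?W"
    using I polys_mono by blast
  have X': "?X' \<subseteq> polys V"
    using Y I by (auto intro!: polys_mult polys_variable)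
  then have X'W: "?X' \<subseteq> polys ?W"
    using polys_mono by blast
  have X: "?X \<subseteq> polys ?W"
    using Y IW by (auto intro!: polys_mult polys_variable)
  have eq: "idl ?W (idl V ?X') = idl ?W ?X'"
    by (rule idl_idl[OF X']) blast
  note L = ideal_poly_ringD[OF idl_ideal[OF X]]
  note P = ideal_poly_ringD[OF idl_ideal[OF X'W]]
  note Q = ideal_poly_ringD[OF idl_ideal[OF IW]]
  have yW: "variable y \<in> polys ?W"
    by (simp add: polys_variable)
  let ?R = "{p + variable y * q | p q. p \<in> idl ?W ?X' \<and> q \<in> idl ?W I}"
  have "ideal ?R (poly_ring ?W)"
  proof (rule ideal_poly_ringI)
    show "?R \<subseteq> polys ?W"
      using P(1) Q(1) yW by (auto intro!: polys_add polys_mult)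
    show "0 \<in> ?R"
      using P(2) Q(2) by force
    show "a + b \<in> ?R" if ab: "a \<in> ?R" "b \<in> ?R" for a b
    proof -
      obtain p q p' q' where "a = p + variable y * q" "p \<in> idl ?W ?X'" "q \<in> idl ?W I"
        "b = p' + variable y * q'" "p' \<in> idl ?W ?X'" "q' \<in> idl ?W I"
        using ab by blast
      then show ?thesis
        using P(3)[of p p'] Q(3)[of q q']
        by (intro CollectI exI[of _ "p + p'"] exI[of _ "q + q'"]) (simp add: algebra_simps)
    qed
    show "c * a \<in> ?R" if c: "c \<in> polys ?W" and a: "a \<in> ?R" for c a
    proof -
      obtain p q where "a = p + variable y * q" "p \<in> idl ?W ?X'" "q \<in> idl ?W I"
        using a by blast
      then show ?thesis
        using P(4)[OF c, of p] Q(4)[OF c, of q]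
        by (intro CollectI exI[of _ "c * p"] exI[of _ "c * q"]) (simp add: algebra_simps)
    qed
  qed
  moreover have "?X \<subseteq> ?R"
  proof
    fix x assume "x \<in> ?X"
    then obtain v p where x: "x = variable v * p" "v \<in> insert y Y" "p \<in> I" by blast
    show "x \<in> ?R"
    proof (cases "v = y")
      case True
      then show ?thesis
        using x P(2) idl_self[OF IW] by (intro CollectI exI[of _ 0] exI[of _ p]) auto
    next
      case False
      then have "x \<in> ?X'"
        using x by blast
      then show ?thesis
        using Q(2) idl_self[OF X'W] by (intro CollectI exI[of _ x] exI[of _ 0]) auto
    qed
  qed
  ultimately have "idl ?W ?X \<subseteq> ?R"
    by (rule idl_minimal)
  moreover have "?R \<subseteq> idl ?W ?X"
  proof
    fix x assume "x \<in> ?R"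
    then obtain p q where x: "x = p + variable y * q" "p \<in> idl ?W ?X'" "q \<in> idl ?W I" by blast
    have "idl ?W ?X' \<subseteq> idl ?W ?X"
      using idl_self[OF X] by (intro idl_minimal[OF idl_ideal[OF X]]) blast
    moreover have "idl ?W I \<subseteq> {q \<in> polys ?W. variable y * q \<in> idl ?W ?X}"
      using idl_self[OF X] IW by (intro idl_minimal[OF ideal_colon[OF idl_ideal[OF X] yW]]) blast
    ultimately show "x \<in> idl ?W ?X"
      using x L(3) by blast
  qed
  ultimately show ?thesis
    unfolding eq by (rule equalityI)
qed

text \<open>Replaces the product of the extended ideals by an ideal with explicit generators, in
  which \<open>p\<close> still ranges over the ideal of the small ring. The induction on the
  variables works with this form.\<close>

lemma ideal_prod_irrelevant:
  fixes I :: "'a::field mpol set"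
  assumes Y: "Y \<subseteq> W" and I: "I \<subseteq> polys W"
  shows "ideal_prod (poly_ring W) (extend_ideal W (irrelevant_ideal Y)) (extend_ideal W I) =
    idl W {variable v * p | v p. v \<in> Y \<and> p \<in> I}"
    (is "?L = idl W ?X")
proof -
  have X: "?X \<subseteq> polys W"
    using assms by (auto intro!: polys_mult polys_variable)
  have vY: "variable ` Y \<subseteq> (polys Y :: 'a mpol set)"
    by (auto intro: polys_variable)
  then have vW: "variable ` Y \<subseteq> (polys W :: 'a mpol set)"
    using polys_mono[OF _ Y] by blast
  have n: "extend_ideal W (irrelevant_ideal Y) = idl W (variable ` Y :: 'a mpol set)"
    unfolding extend_ideal_def irrelevant_ideal_def by (rule idl_idl[OF vY Y])
  note J = ideal_poly_ringD[OF idl_ideal[OF X]]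
  \<comment> \<open>Bilinearity in two passes through a colon ideal: a fixed variable against all
    \<open>j\<close> in the extension of \<open>I\<close>, and then a fixed \<open>j\<close> against
    the ideal of the variables.\<close>
  have prod: "i * j \<in> idl W ?X" if "i \<in> idl W (variable ` Y)" "j \<in> idl W I" for i j
  proof -
    have "variable v * j \<in> idl W ?X" if v: "v \<in> Y" for v
    proof -
      have "variable v \<in> polys W"
        using v Y by (auto intro: polys_variable)
      moreover have "I \<subseteq> {q \<in> polys W. variable v * q \<in> idl W ?X}"
        using idl_self[OF X] I v by blast
      ultimately have "idl W I \<subseteq> {q \<in> polys W. variable v * q \<in> idl W ?X}"
        by (intro idl_minimal[OF ideal_colon[OF idl_ideal[OF X]]])
      then show ?thesis
        using \<open>j \<in> idl W I\<close> by blast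
    qed
    then have "variable ` Y \<subseteq> {q \<in> polys W. j * q \<in> idl W ?X}"
      using vW by (auto simp: mult.commute)
    moreover have "j \<in> polys W"
      using idl_polys[OF I] that by blast
    ultimately have "idl W (variable ` Y) \<subseteq> {q \<in> polys W. j * q \<in> idl W ?X}"
      by (intro idl_minimal[OF ideal_colon[OF idl_ideal[OF X]]])
    then show ?thesis
      using that by (auto simp: mult.commute)
  qed
  have "x \<in> idl W ?X" if "x \<in> ?L" for x
    using that unfolding n extend_ideal_def[of W I]
    by (induction rule: ideal_prod.induct) (auto intro: prod J(3))
  moreover have "idl W ?X \<subseteq> ?L"
  proof (rule idl_minimal)
    show "ideal ?L (poly_ring W)"
      unfolding n extend_ideal_def[of W I]
      by (intro ring.ideal_prod_is_ideal ring_poly_ring idl_ideal I vW)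
    show "?X \<subseteq> ?L"
    proof
      fix x assume "x \<in> ?X"
      then obtain v p where "x = variable v * p" "variable v \<in> idl W (variable ` Y :: 'a mpol set)" "p \<in> idl W I"
        using idl_self[OF vW] idl_self[OF I] by blast
      then show "x \<in> ?L"
        using ideal_prod.prod[of "variable v" _ p _ "poly_ring W"] by (simp add: n extend_ideal_def[of W I])
    qed
  qed
  ultimately show ?thesis by blast
qed

text \<open>Start of the induction: without new variables the product is the zero ideal, and a
  complex without generators is linear for every \<open>d\<close>.\<close>

lemma zero_resolution: "\<exists>F. minimal_resolution V {0 :: 'a::field mpol} F \<and> (\<forall>i j. gens F i j = 0)"
proof -
  let ?F = "\<lparr>gens = \<lambda>_ _. 0, aug = \<lambda>_. 0 :: 'a mpol, bd = \<lambda>_ _. 0\<rparr>"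
  have "basis ?F i = {}" for i
    by (simp add: basis_def)
  moreover have "free_mod V ?F i = {0}" for i
    unfolding free_mod_def by (auto simp: basis_def)
  ultimately have "minimal_resolution V {0} ?F"
    by (auto simp: minimal_resolution_def graded_free_resolution_def aug_map_def bd_map_def)
  then show ?thesis
    by (intro exI[of _ ?F]) simp
qed

text \<open>Pascal's rule in the shape of \<open>product_step\<close>: the terms on the right belong
  to \<open>G\<close>, to \<open>F(-1)\<close> and to the shifted \<open>G\<close>. The conditionals
  stand for vanishing Betti numbers in negative degrees.\<close>

lemma sum_choose_Suc:
  fixes c :: "nat \<Rightarrow> nat"
  shows "(\<Sum>s<Suc k. (Suc k choose Suc s) * (if s \<le> i then c (i - s) else 0)) =
    (\<Sum>s<k. (k choose Suc s) * (if s \<le> i then c (i - s) else 0)) + c i +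
    (if i = 0 then 0 else \<Sum>s<k. (k choose Suc s) * (if s \<le> i - 1 then c (i - 1 - s) else 0))"
proof -
  let ?c = "\<lambda>s. if s \<le> i then c (i - s) else 0"
  have "(\<Sum>s<Suc k. (Suc k choose Suc s) * ?c s) =
      (\<Sum>s<Suc k. (k choose Suc s) * ?c s) + (\<Sum>s<Suc k. (k choose s) * ?c s)"
    unfolding sum.distrib[symmetric] by (rule sum.cong) (simp_all add: distrib_right add.commute)
  also have "(\<Sum>s<Suc k. (k choose Suc s) * ?c s) = (\<Sum>s<k. (k choose Suc s) * ?c s)"
    by simp
  \<comment> \<open>The term \<open>s = 0\<close> splits off as the contribution \<open>c i\<close>
    of \<open>F(-1)\<close>; the rest is the sum for \<open>k\<close> moved down by one homological
    degree.\<close>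
  also have "(\<Sum>s<Suc k. (k choose s) * ?c s) = c i + (\<Sum>s<k. (k choose Suc s) * ?c (Suc s))"
    by (subst sum.lessThan_Suc_shift) simp
  also have "(\<Sum>s<k. (k choose Suc s) * ?c (Suc s)) =
      (if i = 0 then 0 else \<Sum>s<k. (k choose Suc s) * (if s \<le> i - 1 then c (i - 1 - s) else 0))"
    by (cases i) (auto intro!: sum.cong)
  finally show ?thesis
    by simp
qed

text \<open>Summing over \<open>s < k\<close> rather than up to \<open>k - 1\<close> gives the empty
  sum for \<open>k = 0\<close>, so that the induction can begin at the zero ideal.\<close>

lemma product_resolution:
  fixes F :: "'a::field free_cplx"
  assumes F: "minimal_resolution {1..n} I F" "linear_gens d F"
  shows "\<exists>G. minimal_resolution {1..n + k} (idl {1..n + k} {variable v * p | v p. v \<in> {n + 1..n + k} \<and> p \<in> I}) G \<and>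
    linear_gens (d + 1) G \<and>
    (\<forall>i. gens G i (i + (d + 1)) = (\<Sum>s<k. (k choose Suc s) * (if s \<le> i then gens F (i - s) (i - s + d) else 0)))"
proof -
  let ?V = "\<lambda>k. {1..n + k}" and ?X = "\<lambda>k. {variable v * p | v p. v \<in> {n + 1..n + k} \<and> p \<in> I}"
  interpret F: graded_res "{1..n}" I "aug_basis F" fst "aug_bd F" "(0, 0)"
    by (rule minimal_resolution_graded_res[OF F(1)])
  have IV: "I \<subseteq> polys (?V k)" for k
  proof
    fix p assume "p \<in> I"
    then show "p \<in> polys (?V k)"
      using F.I_subset polys_mono[of p "{1..n}" "?V k"] by auto
  qed
  have V_Suc: "?V (Suc k) = insert (n + k + 1) (?V k)" and Y_Suc: "{n + 1..n + Suc k} = insert (n + k + 1) {n + 1..n + k}" for k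
    by auto
  \<comment> \<open>The same \<open>F\<close> resolves the extension of \<open>I\<close> to every
    larger ring: base change keeps bases and differentials, hence also minimality and ranks.\<close>
  have Fk: "minimal_resolution (?V k) (idl (?V k) I) F" for k
  proof (induction k)
    case 0
    show ?case
      using F(1) idl_of_ideal[OF graded_ideal_imp_ideal[OF F.graded_ideal]] by simp
  next
    case (Suc k)
    interpret Fk: graded_res "?V k" "idl (?V k) I" "aug_basis F" fst "aug_bd F" "(0, 0)"
      by (rule minimal_resolution_graded_res[OF Suc])
    have "graded_res (?V (Suc k)) (idl (?V (Suc k)) (idl (?V k) I)) (aug_basis F) fst (aug_bd F) (0, 0)"
      unfolding V_Suc by (rule Fk.base_change) simp
    moreover have "idl (?V (Suc k)) (idl (?V k) I) = idl (?V (Suc k)) I"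
      by (rule idl_idl[OF IV]) auto
    ultimately show ?case
      using F(1) by (simp add: minimal_resolution_def graded_free_resolution_iff)
  qed
  show ?thesis
  proof (induction k)
    case 0
    have "idl (?V 0) (?X 0) = ({0} :: 'a mpol set)"
    proof
      have "ideal ({0} :: 'a mpol set) (poly_ring (?V 0))"
        by (rule ideal_poly_ringI) auto
      then show "idl (?V 0) (?X 0) \<subseteq> ({0} :: 'a mpol set)"
        by (rule idl_minimal) simp
      show "({0} :: 'a mpol set) \<subseteq> idl (?V 0) (?X 0)"
        using ideal_poly_ringD(2)[OF idl_ideal[of "?X 0" "?V 0"]] by simp
    qed
    then show ?case
      using zero_resolution[of "?V 0"] by (auto simp: linear_gens_def)
  next
    case (Suc k)
    then obtain G where G: "minimal_resolution (?V k) (idl (?V k) (?X k)) G" "linear_gens (d + 1) G"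
      "\<And>i. gens G i (i + (d + 1)) = (\<Sum>s<k. (k choose Suc s) * (if s \<le> i then gens F (i - s) (i - s + d) else 0))"
      by blast
    have "?X k \<subseteq> idl (?V k) I"
    proof
      fix x assume "x \<in> ?X k"
      then obtain v p where x: "x = variable v * p" "v \<in> {n + 1..n + k}" "p \<in> I" by blast
      then have "variable v \<in> (polys (?V k) :: 'a mpol set)"
        by (intro polys_variable) auto
      then show "x \<in> idl (?V k) I"
        using x idl_self[OF IV] ideal_poly_ringD(4)[OF idl_ideal[OF IV]] by blast
    qed
    then have sub: "idl (?V k) (?X k) \<subseteq> idl (?V k) I"
      by (rule idl_minimal[OF idl_ideal[OF IV]])
    have "n + k + 1 \<notin> ?V k" by simp
    from product_step[OF Fk F(2) G(1,2) _ this sub] obtain H where H: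
      "minimal_resolution (?V (Suc k)) {p + variable (n + k + 1) * q | p q.
        p \<in> idl (?V (Suc k)) (idl (?V k) (?X k)) \<and> q \<in> idl (?V (Suc k)) (idl (?V k) I)} H"
      "linear_gens (d + 1) H"
      "\<And>i. gens H i (i + (d + 1)) = gens G i (i + (d + 1)) + gens F i (i + d) +
        (if i = 0 then 0 else gens G (i - 1) (i - 1 + (d + 1)))"
      unfolding V_Suc by blast
    have "idl (?V (Suc k)) (idl (?V k) I) = idl (?V (Suc k)) I"
      by (rule idl_idl[OF IV]) auto
    moreover have "idl (?V (Suc k)) (?X (Suc k)) = {p + variable (n + k + 1) * q | p q.
        p \<in> idl (?V (Suc k)) (idl (?V k) (?X k)) \<and> q \<in> idl (?V (Suc k)) I}"
      unfolding V_Suc Y_Suc by (rule idl_product_insert[OF _ IV]) auto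
    ultimately have "minimal_resolution (?V (Suc k)) (idl (?V (Suc k)) (?X (Suc k))) H"
      using H(1) by (simp only:)
    moreover have "gens H i (i + (d + 1)) =
        (\<Sum>s<Suc k. (Suc k choose Suc s) * (if s \<le> i then gens F (i - s) (i - s + d) else 0))" for i
      unfolding H(3) G(3) by (rule sum_choose_Suc[symmetric, of k i "\<lambda>i. gens F i (i + d)"])
    ultimately show ?case
      using H(2) by blast
  qed
qed

theorem proposition3p3:
  fixes I :: "'a::field mpol set" and n k d :: nat
  assumes "squarefree_monomial_ideal {1..n} I"
    and "linear_resolution {1..n} d I"
    and "k > 0"
  shows "let R = {1..n + k};
             nI = ideal_prod (poly_ring R)
                    (extend_ideal R (irrelevant_ideal {n + 1..n + k})) (extend_ideal R I)
         in linear_resolution R (d + 1) nI \<and>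
            (\<forall>i::nat. total_betti R nI (int i) =
               (\<Sum>s = 0..k - 1. (k choose (s + 1)) * total_betti {1..n} I (int i - int s)))"
proof -
  obtain M where M: "\<And>m. m \<in> M \<Longrightarrow> keys m \<subseteq> {1..n}" "I = idl {1..n} (monomial ` M)"
    using assms(1) unfolding squarefree_monomial_ideal_def by blast
  then have I: "I \<subseteq> polys {1..n}"
    unfolding M(2) by (intro idl_polys image_subsetI) (simp only: monomial_def, rule polys_single)
  \<comment> \<open>Gradedness of \<open>I\<close>, which the existence of a minimal resolution
    requires, comes from the generation clause of \<open>linear_resolution\<close>.\<close>
  have "graded_ideal {1..n} (idl {1..n} {p \<in> I. homogeneous d p})"
    by (rule graded_ideal_idl) (use I in auto)
  then have "graded_ideal {1..n} I"
    using assms(2) by (simp add: linear_resolution_def)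
  then obtain F where F: "minimal_resolution {1..n} I F"
    unfolding minimal_resolution_def
    using minimal_resolution_exists[OF finite_atLeastAtMost[of 1 n]] by metis
  have lin: "linear_gens d F"
    using assms(2) unfolding linear_gens_def linear_resolution_def betti_gens[OF F] by blast
  let ?R = "{1..n + k}"
  let ?nI = "ideal_prod (poly_ring ?R) (extend_ideal ?R (irrelevant_ideal {n + 1..n + k})) (extend_ideal ?R I)"
  have "I \<subseteq> polys ?R"
  proof
    fix p assume "p \<in> I"
    then show "p \<in> polys ?R"
      using I polys_mono[of p "{1..n}" ?R] by auto
  qed
  then have "?nI = idl ?R {variable v * p | v p. v \<in> {n + 1..n + k} \<and> p \<in> I}"
    by (intro ideal_prod_irrelevant) auto
  with product_resolution[OF F lin, of k] obtain G where G: "minimal_resolution ?R ?nI G" "linear_gens (d + 1) G"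
    "\<And>i. gens G i (i + (d + 1)) = (\<Sum>s<k. (k choose Suc s) * (if s \<le> i then gens F (i - s) (i - s + d) else 0))"
    by auto
  have "total_betti ?R ?nI (int i) = (\<Sum>s = 0..k - 1. (k choose (s + 1)) * total_betti {1..n} I (int i - int s))" for i
  proof -
    have "total_betti {1..n} I (int i - int s) = (if s \<le> i then gens F (i - s) (i - s + d) else 0)" for s
    proof (cases "s \<le> i")
      case True
      then show ?thesis
        using total_betti_gens[OF F lin, of "i - s"] by (simp add: of_nat_diff)
    qed (simp add: total_betti_def)
    \<comment> \<open>Positivity of \<open>k\<close> matters here: for \<open>k = 0\<close>
      truncated subtraction would leave the index 0.\<close>
    moreover have "{0..k - 1} = {..<k}"
      using assms(3) by auto
    ultimately show ?thesis
      unfolding total_betti_gens[OF G(1,2)] G(3) by simp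
  qed
  then show ?thesis
    unfolding Let_def using linear_resolutionI[OF G(1,2)] by blast
qed

end
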